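(* Let $\psi:[0,\infty)\to\mathbb{R}$ be a continuous function, $\ell\in\mathbb{N}$ and $n\ge\ell$. The following conditions are equivalent: (i) The function $(t_1,\dots,t_n)\in[0,\infty)^n\mapsto(-1)^\ell\psi(t_1+\cdots+t_n)$ is PDI$_{\ell,n}^\infty$. (ii) The kernel $(x,y)\in\mathbb{R}^d\times\mathbb{R}^d\mapsto\psi(\|x-y\|^2)\in\mathbb{R}$ is CPD$_\ell$ for every $d\in\mathbb{N}$. (iii) The function $\psi$ can be represented, for $t\ge 0$, as $$\psi(t)=\sum_{k=0}^\ell a_kt^k+\int_{(0,\infty)}\big(e^{-rt}-e_\ell(r)\omega_\ell(rt)\big)\frac{(1+r)^\ell}{r^\ell}\,d\eta(r),$$ where $a_0,\dots,a_\ell\in\mathbb{R}$, $(-1)^\ell a_\ell\ge0$, and $\eta\in\mathfrak{M}((0,\infty))$ is a nonnegative measure. The representation is unique. (iv) The function $\psi$ is a completely monotone function of order $\ell$, that is, $\psi\in C^\infty((0,\infty))$ and $(-1)^\ell\psi^{(\ell)}$ is a completely monotone function.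
   Context: $\mathbb{N}=\{1,2,\dots\}$. A discrete measure is a finite real linear combination of Dirac measures; $\mathfrak{M}(A)$ denotes the finite (signed) Borel measures on $A$. $\mathcal{M}_\ell((\mathbb{R}^d)^n)$ is the space of discrete measures $\mu$ in the product of $n$ copies of $\mathbb{R}^d$ such that $\mu(\prod_{i=1}^nA_i)=0$ for all $A_i\subset\mathbb{R}^d$ with $|\{i:A_i=\mathbb{R}^d\}|\ge n-\ell+1$. A function $g:[0,\infty)^n\to\mathbb{R}$ is PDI$_{\ell,n}^\infty$ if for every $d\in\mathbb{N}$ and $\mu\in\mathcal{M}_\ell((\mathbb{R}^d)^n)$, $$\int_{(\mathbb{R}^d)^n}\int_{(\mathbb{R}^d)^n}(-1)^\ell g(\|u_1-v_1\|^2,\ldots,\|u_n-v_n\|^2)\,d\mu(u)\,d\mu(v)\ge0.$$ The kernel $\psi(\|x-y\|^2)$ on $\mathbb{R}^d$ is CPD$_\ell$ (conditionally positive definite of order $\ell$) if $\sum_{i,j=1}^mc_ic_j\psi(\|x_i-x_j\|^2)\ge0$ for all finitely many points $x_1,\dots,x_m\in\mathbb{R}^d$ and real scalars $c_1,\dots,c_m$ satisfying $\sum_{i=1}^mc_ip(x_i)=0$ for every polynomial $p$ on $\mathbb{R}^d$ of degree at most $\ell-1$. $\omega_\ell(s):=\sum_{j=0}^{\ell-1}(-1)^j\frac{s^j}{j!}$ and $e_\ell(s):=e^{-s}\sum_{j=0}^{\ell-1}\frac{s^j}{j!}$. A function $h:(0,\infty)\to\mathbb{R}$ is completely monotone if it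 is $C^\infty$ and $(-1)^mh^{(m)}\ge0$ for all $m\in\mathbb{Z}_+$. *)

theory Defs
  imports "HOL-Analysis.Analysis"
begin

text \<open>
  The dimension is quantified inside the statement, so \<open>\<real>\<^sup>d\<close> is the carrier
  \<^term>\<open>topspace (Euclidean_space d)\<close>: the sequences \<open>x :: nat \<Rightarrow> real\<close> with
  \<open>x i = 0\<close> for \<open>i \<ge> d\<close>. An \<open>n\<close>-tuple is an extensional function on \<open>{..<n}\<close>.
\<close>

abbreviation Rd :: "nat \<Rightarrow> (nat \<Rightarrow> real) set" where
  "Rd d \<equiv> topspace (Euclidean_space d)"

definition norm_Rd :: "nat \<Rightarrow> (nat \<Rightarrow> real) \<Rightarrow> real" where
  "norm_Rd d x = L2_set x {..<d}"

abbreviation sqdist :: "nat \<Rightarrow> (nat \<Rightarrow> real) \<Rightarrow> (nat \<Rightarrow> real) \<Rightarrow> real" where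
  "sqdist d x y \<equiv> (norm_Rd d (\<lambda>i. x i - y i))\<^sup>2"

text \<open>
  A discrete measure \<open>\<Sum>\<^sub>j c\<^sub>j \<delta>\<^bsub>x\<^sub>j\<^esub>\<close> is given by its weight function
  \<open>x \<mapsto> \<mu>({x})\<close>, which has finite support. Such a measure is defined on every subset.
\<close>

definition discrete_measure_on :: "'a set \<Rightarrow> ('a \<Rightarrow> real) \<Rightarrow> bool" where
  "discrete_measure_on X \<mu> \<longleftrightarrow> finite {x. \<mu> x \<noteq> 0} \<and> {x. \<mu> x \<noteq> 0} \<subseteq> X"

definition dmeasure :: "('a \<Rightarrow> real) \<Rightarrow> 'a set \<Rightarrow> real" where
  "dmeasure \<mu> A = (\<Sum>x | \<mu> x \<noteq> 0 \<and> x \<in> A. \<mu> x)"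

definition dintegral :: "('a \<Rightarrow> real) \<Rightarrow> ('a \<Rightarrow> real) \<Rightarrow> real" where
  "dintegral \<mu> f = (\<Sum>x | \<mu> x \<noteq> 0. f x * \<mu> x)"

(* The bound n + 1 - l is n - l + 1 in a form that is not affected by truncated subtraction. *)
definition M_space :: "nat \<Rightarrow> nat \<Rightarrow> nat \<Rightarrow> ((nat \<Rightarrow> nat \<Rightarrow> real) \<Rightarrow> real) set" where
  "M_space l n d = {\<mu>. discrete_measure_on (PiE {..<n} (\<lambda>_. Rd d)) \<mu> \<and>
     (\<forall>A. (\<forall>i<n. A i \<subseteq> Rd d) \<and> card {i. i < n \<and> A i = Rd d} \<ge> n + 1 - l
        \<longrightarrow> dmeasure \<mu> (PiE {..<n} A) = 0)}"

(* g is only ever evaluated at extensional n-tuples of nonnegative reals. *)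
definition PDI :: "nat \<Rightarrow> nat \<Rightarrow> ((nat \<Rightarrow> real) \<Rightarrow> real) \<Rightarrow> bool" where
  "PDI l n g \<longleftrightarrow> (\<forall>d\<ge>1. \<forall>\<mu>\<in>M_space l n d.
     dintegral \<mu> (\<lambda>v. dintegral \<mu> (\<lambda>u.
       (-1) ^ l * g (\<lambda>i\<in>{..<n}. sqdist d (u i) (v i)))) \<ge> 0)"

definition poly_fun :: "nat \<Rightarrow> nat \<Rightarrow> ((nat \<Rightarrow> real) \<Rightarrow> real) \<Rightarrow> bool" where
  "poly_fun d k p \<longleftrightarrow> (\<exists>b :: (nat \<Rightarrow> nat) \<Rightarrow> real. \<forall>x.
     p x = (\<Sum>\<alpha> | \<alpha> \<in> PiE {..<d} (\<lambda>_. UNIV) \<and> (\<Sum>i<d. \<alpha> i) \<le> k. b \<alpha> * (\<Prod>i<d. x i ^ \<alpha> i)))"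

definition CPD :: "nat \<Rightarrow> nat \<Rightarrow> ((nat \<Rightarrow> real) \<Rightarrow> (nat \<Rightarrow> real) \<Rightarrow> real) \<Rightarrow> bool" where
  "CPD l d K \<longleftrightarrow> (\<forall>(m::nat) (x :: nat \<Rightarrow> nat \<Rightarrow> real) (c :: nat \<Rightarrow> real).
     (\<forall>i<m. x i \<in> Rd d) \<and> (\<forall>p. poly_fun d (l - 1) p \<longrightarrow> (\<Sum>i<m. c i * p (x i)) = 0)
     \<longrightarrow> (\<Sum>i<m. \<Sum>j<m. c i * c j * K (x i) (x j)) \<ge> 0)"

definition omega_fun :: "nat \<Rightarrow> real \<Rightarrow> real" where
  "omega_fun l s = (\<Sum>j<l. (-1) ^ j * (s ^ j / fact j))"

definition e_fun :: "nat \<Rightarrow> real \<Rightarrow> real" where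
  "e_fun l s = exp (- s) * (\<Sum>j<l. s ^ j / fact j)"

definition nonneg_finite_measure_pos :: "real measure \<Rightarrow> bool" where
  "nonneg_finite_measure_pos \<eta> \<longleftrightarrow>
     finite_measure \<eta> \<and> sets \<eta> = sets (restrict_space borel {0<..})"

definition kernel_rep :: "nat \<Rightarrow> real \<Rightarrow> real \<Rightarrow> real" where
  "kernel_rep l t r = (exp (- (r * t)) - e_fun l r * omega_fun l (r * t)) * ((1 + r) ^ l / r ^ l)"

(* Integrability is explicit because the Bochner integral of a non-integrable function is 0. *)
definition represents :: "nat \<Rightarrow> (real \<Rightarrow> real) \<Rightarrow> (nat \<Rightarrow> real) \<Rightarrow> real measure \<Rightarrow> bool" where
  "represents l \<psi> a \<eta> \<longleftrightarrow> (-1) ^ l * a l \<ge> 0 \<and> nonneg_finite_measure_pos \<eta> \<and>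
     (\<forall>t\<ge>0. integrable \<eta> (kernel_rep l t) \<and>
        \<psi> t = (\<Sum>k\<le>l. a k * t ^ k) + (LINT r|\<eta>. kernel_rep l t r))"

definition smooth_pos :: "(real \<Rightarrow> real) \<Rightarrow> bool" where
  "smooth_pos h \<longleftrightarrow> (\<forall>m. \<forall>t>0. ((deriv ^^ m) h) differentiable (at t))"

definition completely_monotone :: "(real \<Rightarrow> real) \<Rightarrow> bool" where
  "completely_monotone h \<longleftrightarrow>
     smooth_pos h \<and> (\<forall>m. \<forall>t>0. (-1) ^ m * (deriv ^^ m) h t \<ge> 0)"

definition completely_monotone_order :: "nat \<Rightarrow> (real \<Rightarrow> real) \<Rightarrow> bool" where
  "completely_monotone_order l \<psi> \<longleftrightarrow>
     smooth_pos \<psi> \<and> completely_monotone (\<lambda>t. (-1) ^ l * (deriv ^^ l) \<psi> t)"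

end

theory Submission
  imports Defs "HOL-Probability.Probability" "HOL-Real_Asymp.Real_Asymp"
begin

text \<open>
The four conditions are compared through one elementary property: all alternating differences
of \<open>\<psi>\<close> of order \<open>m \<ge> l\<close> are nonnegative, that is,
\<open>\<Sum>\<epsilon>\<subseteq>{..<m}. (-1) ^ card \<epsilon> * \<psi> (t + (\<Sum>c\<in>\<epsilon>. h c)) \<ge> 0\<close> for all positive steps \<open>h\<close>
and all \<open>t \<ge> 0\<close> (\<open>alternating_from\<close>). The implications proved are:
(i) implies the difference property, which implies (iii); (iii) implies (ii), which implies (i);
and (iii) implies (iv), which implies the difference property again.

From (i) to differences (\<open>alternating_if_PDI\<close>): a cube with edges \<open>sqrt (h c)\<close> along different
coordinate axes, with alternating signs at its vertices, is an admissible measure as soon as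
\<open>l\<close> of its edges lie in \<open>l\<close> different factors (blocks) of the product space. Squared distances
between vertices are sums of \<open>h c\<close>, so the quadratic form is an alternating difference of \<open>\<psi>\<close> at \<open>0\<close>. Averaging over
\<open>N\<close> copies of the cube that are shifted in mutually orthogonal directions turns the base point
\<open>0\<close> into \<open>t\<close> as \<open>N\<close> grows.

From differences to (iii) (\<open>represents_if_alternating\<close>): for each step \<open>s = 1 / 2 ^ p\<close> the
\<open>l\<close>-th difference of \<open>\<psi>\<close> with step \<open>s\<close> is alternating of every order, hence by Bernstein's
theorem the Laplace transform of a finite measure \<open>M\<^sub>p\<close> on \<open>[0,\<infinity>)\<close>. Taking further
differences and using that a Laplace transform determines its measure,
\<open>(1 - exp (-r)) ^ l M\<^sub>p = (1 - exp (-r s)) ^ l M\<^sub>0\<close>, so away from \<open>0\<close> all the \<open>M\<^sub>p\<close>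
come from one measure \<open>(1 - exp (-r)) powi (-l) M\<^sub>0\<close>, which is \<open>\<eta>\<close> up to the weight
\<open>((1 + r) / r) ^ l\<close>. The difference of \<open>\<psi>\<close> and the integral in (iii) then has constant
\<open>l\<close>-th differences with all dyadic steps, so it is a polynomial of degree at most \<open>l\<close>. The
atom of \<open>M\<^sub>0\<close> at \<open>0\<close> accounts for the sign of the leading coefficient.

Bernstein's theorem itself is obtained from the Hausdorff moment problem for the sequences
\<open>f (k / 2 ^ p)\<close>; the measures on \<open>[0,1]\<close> for different \<open>p\<close> are images of each other under
powers of \<open>x\<close>, because moments determine them.

From (iii) to (ii) (\<open>CPD_if_represents\<close>): the Gaussian kernel is positive definite, and
\<open>sqdist x y ^ k\<close> with \<open>k < l\<close> is annihilated by the admissible weights, since each monomial in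
it has degree less than \<open>l\<close> in \<open>x\<close> or in \<open>y\<close>. Therefore the subtracted polynomial in the kernel
of (iii) is invisible, and the leading term \<open>(-1) ^ l * sqdist x y ^ l\<close> is a limit of
rescaled Gaussians.

From (ii) to (i) (\<open>PDI_if_CPD\<close>): an \<open>n\<close>-tuple of vectors in dimension \<open>d\<close> is one vector in
dimension \<open>n * d\<close>, and a monomial of degree less than \<open>l\<close> sees fewer than \<open>l\<close> blocks, so it is
integrated to \<open>0\<close> by the measures of the class.

From (iii) to (iv) one differentiates under the integral sign, and from (iv) to differences one
uses the mean value theorem. The representation is unique because differences of order
\<open>l + 1\<close> remove the polynomial and leave the Laplace transform of \<open>\<eta>\<close> times a positive weight.
\<close>

section \<open>Moments and Laplace transforms determine a finite measure\<close>

lemma continuous_bounded_on_unit_interval: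
  fixes f :: "real \<Rightarrow> real"
  assumes "continuous_on UNIV f"
  obtains B where "\<And>x. 0 \<le> x \<Longrightarrow> x \<le> 1 \<Longrightarrow> \<bar>f x\<bar> \<le> B"
proof -
  have "compact (f ` {0..1})" by (intro compact_continuous_image continuous_on_subset[OF assms]) auto
  from compact_imp_bounded[OF this] obtain B where "\<forall>y\<in>f ` {0..1}. norm y \<le> B"
    unfolding bounded_iff by blast
  then show thesis using that[of B] by simp
qed

lemma finite_measure_integrable_on_unit_interval:
  fixes f :: "real \<Rightarrow> real"
  assumes "finite_measure M" "sets M = sets borel" "AE x in M. 0 \<le> x \<and> x \<le> 1"
    "continuous_on UNIV f"
  shows "integrable M f"
proof -
  interpret finite_measure M by fact
  obtain B where B: "\<And>x. 0 \<le> x \<Longrightarrow> x \<le> 1 \<Longrightarrow> \<bar>f x\<bar> \<le> B"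
    using continuous_bounded_on_unit_interval[OF assms(4)] by blast
  have meas: "f \<in> borel_measurable M"
    using borel_measurable_continuous_onI[OF assms(4)] assms(2) by (simp cong: measurable_cong_sets)
  have "AE x in M. norm (f x) \<le> B"
    using assms(3) by eventually_elim (simp add: B)
  then show ?thesis
    using meas by (rule integrable_const_bound)
qed

text \<open>
  The Bernstein polynomials of \<open>f\<close> are bounded by the supremum of \<open>\<bar>f\<bar>\<close> on \<open>[0,1]\<close> and converge
  to \<open>f\<close> there; their integrals depend only on the moments.
\<close>

lemma integral_continuous_eq_of_moments_eq:
  fixes f :: "real \<Rightarrow> real"
  assumes M: "finite_measure M" "sets M = sets borel" "AE x in M. 0 \<le> x \<and> x \<le> 1"
    and N: "finite_measure N" "sets N = sets borel" "AE x in N. 0 \<le> x \<and> x \<le> 1"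
    and moments: "\<And>k. (LINT x|M. x ^ k) = (LINT x|N. x ^ k)"
    and f: "continuous_on UNIV f"
  shows "(LINT x|M. f x) = (LINT x|N. f x)"
proof -
  define B where "B = (\<lambda>n x. \<Sum>k\<le>n. f (k / n) * Bernstein n k x)"
  have poly: "\<exists>p. B n = poly p" for n
  proof -
    have "B n = poly (\<Sum>k\<le>n. smult (f (k / n) * real (n choose k)) ([:0, 1:] ^ k * [:1, -1:] ^ (n - k)))"
      by (auto simp: B_def Bernstein_def poly_sum fun_eq_iff intro!: sum.cong)
    then show ?thesis by blast
  qed
  have integrable_monomial: "integrable M (\<lambda>x. x ^ i)" "integrable N (\<lambda>x. x ^ i)" for i
    by (rule finite_measure_integrable_on_unit_interval[OF M] finite_measure_integrable_on_unit_interval[OF N];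
        intro continuous_intros)+
  have poly_eq: "(LINT x|M. poly p x) = (LINT x|N. poly p x)" for p :: "real poly"
    unfolding poly_altdef
    by (subst (1 2) Bochner_Integration.integral_sum) (simp_all add: moments integrable_monomial)
  obtain C where C: "\<And>x. 0 \<le> x \<Longrightarrow> x \<le> 1 \<Longrightarrow> \<bar>f x\<bar> \<le> C"
    using continuous_bounded_on_unit_interval[OF f] by blast
  have lim: "(\<lambda>n. LINT x|L. B n x) \<longlonglongrightarrow> (LINT x|L. f x)"
    if L: "finite_measure L" "sets L = sets borel" "AE x in L. 0 \<le> x \<and> x \<le> 1" for L
  proof -
    interpret finite_measure L by fact
    have cB: "continuous_on UNIV (B n)" for n unfolding B_def Bernstein_def by (intro continuous_intros)
    have m: "g \<in> borel_measurable L" if "continuous_on UNIV g" for g :: "real \<Rightarrow> real"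
      using borel_measurable_continuous_onI[OF that] L(2) by (simp cong: measurable_cong_sets)
    show ?thesis
    proof (rule integral_dominated_convergence[where w = "\<lambda>_. C"])
      show "AE x in L. (\<lambda>n. B n x) \<longlonglongrightarrow> f x"
        using L(3)
      proof eventually_elim
        case (elim x)
        show ?case
        proof (rule LIMSEQ_I)
          fix e :: real assume "0 < e"
          then obtain N where "\<forall>n x. N \<le> n \<and> x \<in> {0..1} \<longrightarrow> \<bar>f x - B n x\<bar> < e"
            using Bernstein_Weierstrass[OF continuous_on_subset[OF f subset_UNIV], of e] unfolding B_def by blast
          then show "\<exists>N. \<forall>n\<ge>N. norm (B n x - f x) < e"
            using elim by (auto simp: abs_minus_commute)
        qed
      qed
      show "AE x in L. norm (B n x) \<le> C" for n
        using L(3)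
      proof eventually_elim
        case (elim x)
        have "\<bar>B n x\<bar> \<le> (\<Sum>k\<le>n. C * Bernstein n k x)"
          unfolding B_def
          by (rule order_trans[OF sum_abs sum_mono])
             (use elim C in \<open>auto simp: abs_mult Bernstein_nonneg divide_simps intro!: mult_right_mono\<close>)
        also have "\<dots> = C" by (simp flip: sum_distrib_left)
        finally show ?case by simp
      qed
    qed (auto intro: m cB f)
  qed
  have "(LINT x|M. B n x) = (LINT x|N. B n x)" for n using poly[of n] poly_eq by auto
  then show ?thesis using lim[OF M] lim[OF N] LIMSEQ_unique by auto
qed

text \<open>
  Cosine and sine are among the continuous functions whose integrals agree, so after normalisation
  the characteristic functions coincide.
\<close>

theorem moments_determine_measure:
  assumes M: "finite_measure M" "sets M = sets borel" "AE x in M. 0 \<le> x \<and> x \<le> 1"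
    and N: "finite_measure N" "sets N = sets borel" "AE x in N. 0 \<le> x \<and> x \<le> (1 :: real)"
    and moments: "\<And>k. (LINT x|M. x ^ k) = (LINT x|N. x ^ k)"
  shows "M = N"
proof -
  interpret M: finite_measure M by fact
  interpret N: finite_measure N by fact
  have sp: "space M = UNIV" "space N = UNIV" using M(2) N(2) by (auto dest: sets_eq_imp_space_eq)
  define c where "c = measure M UNIV"
  have c: "measure N UNIV = c" using moments[of 0] sp by (simp add: c_def)
  have int: "(LINT x|M. f x) = (LINT x|N. f x)" if "continuous_on UNIV f" for f :: "real \<Rightarrow> real"
    using integral_continuous_eq_of_moments_eq[OF M N moments that] .
  \<comment> \<open>Uniqueness by characteristic functions is a statement about probability measures, so the total
    mass \<open>c\<close> is divided out.\<close>
  show ?thesis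
  proof (cases "c = 0")
    case True
    have "emeasure M A = 0" "emeasure N A = 0" if "A \<in> sets borel" for A
    proof -
      have "emeasure M A \<le> emeasure M UNIV" "emeasure N A \<le> emeasure N UNIV"
        using M(2) N(2) by (auto intro!: emeasure_mono)
      then show "emeasure M A = 0" "emeasure N A = 0"
        using True c by (simp_all add: c_def M.emeasure_eq_measure N.emeasure_eq_measure measure_le_0_iff)
    qed
    then show ?thesis using M(2) N(2) by (intro measure_eqI) auto
  next
    case False
    then have cpos: "c > 0" by (simp add: c_def less_le)
    define S where "S = (\<lambda>L :: real measure. density L (\<lambda>_. ennreal (1 / c)))"
    have rd: "real_distribution (S L)"
      if "sets L = sets borel" "emeasure L UNIV = ennreal c" for L
    proof -
      have "space L = UNIV" using that(1) by (auto dest: sets_eq_imp_space_eq)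
      then have "emeasure (S L) (space (S L)) = 1"
        using that cpos
        by (simp add: S_def emeasure_density_const flip: ennreal_mult'')
      then have "prob_space (S L)" by (rule prob_spaceI)
      then show ?thesis
        using that(1) by (intro real_distribution.intro real_distribution_axioms.intro) (simp_all add: S_def)
    qed
    have ch: "char (S L) t = complex_of_real (1 / c) * Complex (LINT x|L. cos (t * x)) (LINT x|L. sin (t * x))"
      if L: "finite_measure L" "sets L = sets borel" for L t
    proof -
      interpret finite_measure L by fact
      have m: "g \<in> borel_measurable L" if "continuous_on UNIV g" for g :: "real \<Rightarrow> 'b :: real_normed_vector"
        using borel_measurable_continuous_onI[OF that] L(2) by (simp cong: measurable_cong_sets)
      have i: "integrable L (\<lambda>x. iexp (t * x))"
        by (rule integrable_const_bound[where B = 1]) (auto intro!: m continuous_intros)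
      have "char (S L) t = (LINT x|L. (1 / c) *\<^sub>R iexp (t * x))"
        unfolding char_def S_def using cpos
        by (subst integral_density) (auto intro!: m continuous_intros)
      also have "\<dots> = complex_of_real (1 / c) * (LINT x|L. iexp (t * x))"
        by (simp add: scaleR_conv_of_real)
      also have "(LINT x|L. iexp (t * x)) = Complex (LINT x|L. cos (t * x)) (LINT x|L. sin (t * x))"
        using i by (simp add: complex_eq_iff integral_Re[symmetric] integral_Im[symmetric] Re_exp Im_exp del: of_real_mult)
      finally show ?thesis .
    qed
    have "S M = S N"
    proof (rule Levy_uniqueness)
      show "real_distribution (S M)" "real_distribution (S N)"
        using M(2) N(2) c by (auto intro!: rd simp: c_def M.emeasure_eq_measure N.emeasure_eq_measure)
      have "(LINT x|M. cos (t * x)) = (LINT x|N. cos (t * x))"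
        "(LINT x|M. sin (t * x)) = (LINT x|N. sin (t * x))" for t
        by (rule int; intro continuous_intros)+
      then show "char (S M) = char (S N)"
        by (intro ext) (simp only: ch[OF M(1,2)] ch[OF N(1,2)])
    qed
    have dens: "emeasure (S L) A = ennreal (1 / c) * emeasure L A" if "A \<in> sets L" for L A
      using that unfolding S_def by (rule emeasure_density_const)
    have eq: "ennreal (1 / c) * emeasure M A = ennreal (1 / c) * emeasure N A" if "A \<in> sets borel" for A
      using that M(2) N(2) dens[of A M] dens[of A N] \<open>S M = S N\<close> by simp
    show ?thesis
    proof (rule measure_eqI)
      fix A assume "A \<in> sets M"
      then show "emeasure M A = emeasure N A"
        using eq[of A] M(2) cpos by (simp add: M.emeasure_eq_measure N.emeasure_eq_measure flip: ennreal_mult'')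
    qed (use M(2) N(2) in auto)
  qed
qed

text \<open>
  The substitution \<open>x = exp (-r)\<close> turns the values of the Laplace transform at the natural numbers
  into moments on \<open>[0,1]\<close>.
\<close>

theorem Laplace_transform_determines_measure:
  assumes M: "finite_measure M" "sets M = sets borel" "AE r in M. 0 \<le> (r :: real)"
    and N: "finite_measure N" "sets N = sets borel" "AE r in N. 0 \<le> r"
    and Laplace: "\<And>k :: nat. (LINT r|M. exp (- (r * k))) = (LINT r|N. exp (- (r * k)))"
  shows "M = N"
proof -
  define D where "D = (\<lambda>L :: real measure. distr L borel (\<lambda>r. exp (- r)))"
  have D: "finite_measure (D L)" "sets (D L) = sets borel" "AE x in D L. 0 \<le> x \<and> x \<le> 1"
    "(LINT x|D L. x ^ k) = (LINT r|L. exp (- (r * k)))"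
    "distr (D L) borel (\<lambda>x. - ln x) = L"
    if L: "finite_measure L" "sets L = sets borel" "AE r in L. 0 \<le> r" for L k
  proof -
    have sp: "space L = UNIV" using L(2) by (auto dest: sets_eq_imp_space_eq)
    have m: "(\<lambda>r::real. exp (- r)) \<in> L \<rightarrow>\<^sub>M borel"
      by (simp add: L(2) cong: measurable_cong_sets)
    show "finite_measure (D L)"
      unfolding D_def by (rule finite_measure.finite_measure_distr[OF L(1) m])
    show "sets (D L) = sets borel" by (simp add: D_def)
    show "AE x in D L. 0 \<le> x \<and> x \<le> 1"
      unfolding D_def by (subst AE_distr_iff[OF m]) (use L(3) in auto)
    show "(LINT x|D L. x ^ k) = (LINT r|L. exp (- (r * k)))"
      unfolding D_def by (subst integral_distr[OF m]) (auto simp: exp_of_nat2_mult[symmetric])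
    have "distr (D L) borel (\<lambda>x. - ln x) = distr L borel ((\<lambda>x. - ln x) \<circ> (\<lambda>r. exp (- r)))"
      unfolding D_def by (rule distr_distr) (auto intro: m)
    also have "\<dots> = L" using L(2) by (simp add: comp_def distr_id2)
    finally show "distr (D L) borel (\<lambda>x. - ln x) = L" .
  qed
  have "D M = D N"
    using D(1-3)[OF M] D(1-3)[OF N]
    by (rule moments_determine_measure) (simp only: D(4)[OF M] D(4)[OF N] Laplace)
  then have "distr (D M) borel (\<lambda>x. - ln x) = distr (D N) borel (\<lambda>x. - ln x)" by simp
  then show ?thesis unfolding D(5)[OF M] D(5)[OF N] .
qed

section \<open>The Hausdorff moment problem\<close>

text \<open>
  This is \<open>(-1) ^ m\<close> times the usual forward difference. With this sign, \<open>sdiff m c j\<close> is the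
  integral of \<open>(1 - x) ^ m * x ^ j\<close> if \<open>c\<close> is a sequence of moments, so it is nonnegative for
  measures on \<open>[0,1]\<close>.
\<close>

primrec sdiff :: "nat \<Rightarrow> (nat \<Rightarrow> real) \<Rightarrow> nat \<Rightarrow> real" where
  "sdiff 0 c j = c j"
| "sdiff (Suc m) c j = sdiff m c j - sdiff m c (Suc j)"

text \<open>
  Pascal's rule, in the form needed for inductions on binomial expansions of operators.
\<close>

lemma sum_choose_Suc:
  fixes b :: "nat \<Rightarrow> real"
  shows "(\<Sum>k\<le>Suc K. real (Suc K choose k) * b k)
    = (\<Sum>k\<le>K. real (K choose k) * b k) + (\<Sum>k\<le>K. real (K choose k) * b (Suc k))"
proof -
  have "(\<Sum>k\<le>K. real (K choose k) * b k) = (\<Sum>k\<le>Suc K. real (K choose k) * b k)" by simp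
  also have "\<dots> = b 0 + (\<Sum>k\<le>K. real (K choose Suc k) * b (Suc k))"
    by (subst sum.atMost_Suc_shift) simp
  finally show ?thesis
    by (subst sum.atMost_Suc_shift) (simp add: sum.distrib algebra_simps)
qed

text \<open>
  With the shift \<open>E\<close> and \<open>D = 1 - E\<close> this is \<open>(D + E) ^ K = 1\<close> applied to \<open>D ^ m c\<close>.
\<close>

lemma sdiff_expand_binomial:
  "(\<Sum>k\<le>K. real (K choose k) * sdiff (m + (K - k)) c (i + k)) = sdiff m c i"
proof (induction K arbitrary: m i)
  case (Suc K)
  define b where "b = (\<lambda>k. sdiff (m + (Suc K - k)) c (i + k))"
  have "sdiff m c i = sdiff (Suc m) c i + sdiff m c (Suc i)" by simp
  also have "sdiff (Suc m) c i = (\<Sum>k\<le>K. real (K choose k) * b k)"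
    unfolding Suc.IH[of "Suc m" i, symmetric] b_def
    by (intro sum.cong refl arg_cong2[of _ _ _ _ "(*)"]) (simp add: Suc_diff_le del: sdiff.simps)
  also have "sdiff m c (Suc i) = (\<Sum>k\<le>K. real (K choose k) * b (Suc k))"
    unfolding Suc.IH[of m "Suc i", symmetric] b_def by simp
  also have "(\<Sum>k\<le>K. real (K choose k) * b k) + (\<Sum>k\<le>K. real (K choose k) * b (Suc k))
      = (\<Sum>k\<le>Suc K. real (Suc K choose k) * b k)"
    by (rule sum_choose_Suc[symmetric])
  finally show ?case by (simp add: b_def)
qed simp

lemma binomial_ratio_close_to_power:
  assumes "k \<le> n" "2 * i < n"
  shows "\<bar>(real k / real n) ^ i - real (k choose i) / real (n choose i)\<bar> \<le> real i * (real i / (real n - real i))"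
proof -
  have "real (k choose i) / real (n choose i) = (\<Prod>s<i. (real k - real s) / (real n - real s))"
    by (simp add: binomial_gbinomial gbinomial_prod_rev prod_dividef lessThan_atLeast0)
  then have "\<bar>(real k / real n) ^ i - real (k choose i) / real (n choose i)\<bar>
      = norm ((\<Prod>s<i. real k / real n) - (\<Prod>s<i. (real k - real s) / (real n - real s)))"
    by simp
  also have "\<dots> \<le> (\<Sum>s<i. norm (real k / real n - (real k - real s) / (real n - real s)))"
    using assms by (intro norm_prod_diff) (auto simp: divide_simps abs_le_iff)
  also have "\<dots> \<le> (\<Sum>s<i. real i / (real n - real i))"
  proof (rule sum_mono)
    fix s assume "s \<in> {..<i}"
    then have s: "real s < real i" by simp
    have n: "real n > 2 * real i" using assms(2) by linarith
    have "real k / real n - (real k - real s) / (real n - real s)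
        = (real s / (real n - real s)) * ((real n - real k) / real n)" (is "?d = ?a * ?b")
      using s n by (simp add: field_simps)
    moreover have b: "0 \<le> ?b" "?b \<le> 1"
      using assms by (auto simp: divide_simps)
    moreover have a: "0 \<le> ?a" "?a \<le> real i / (real n - real i)"
      using s n by (auto intro!: frac_le)
    ultimately have "norm ?d = ?a * ?b"
      by (metis abs_of_nonneg mult_nonneg_nonneg real_norm_def)
    also have "\<dots> \<le> ?a" using a(1) b(2) by (rule mult_left_le[rotated])
    also note a(2)
    finally show "norm ?d \<le> real i / (real n - real i)" .
  qed
  finally show ?thesis by simp
qed

text \<open>
  The approximating measures are discrete: up to normalisation by \<open>c 0\<close>, the point \<open>k / n\<close> gets the
  mass \<open>(n choose k) * sdiff (n - k) c k\<close>, which is the value of the moment functional at the Bernstein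
  polynomial \<open>(n choose k) * x ^ k * (1 - x) ^ (n - k)\<close>. By \<open>sdiff_expand_binomial\<close> the integral of
  \<open>(k choose i) / (n choose i)\<close> is exactly \<open>c i\<close>, and this function is close to \<open>(k / n) ^ i\<close>.
  Helly's selection theorem provides the limit measure.
\<close>

theorem Hausdorff_moment_problem:
  assumes cm: "\<And>m j. sdiff m c j \<ge> 0"
  obtains M where "finite_measure M" "sets M = sets borel" "AE x in M. 0 \<le> x \<and> x \<le> (1 :: real)"
    "\<And>k. (LINT x|M. x ^ k) = c k"
proof (cases "c 0 = 0")
  case True
  have "c k = 0" for k
  proof (induction k)
    case (Suc k)
    then show ?case using cm[of 1 k] cm[of 0 "Suc k"] by simp
  qed (rule True)
  then show thesis
    by (intro that[of "null_measure borel"])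
       (auto intro!: finite_measureI simp: integral_eq_zero_null_sets AE_iff_null)
next
  case False
  then have c0: "c 0 > 0" using cm[of 0 0] by simp
  define p where "p = (\<lambda>n k. real (n choose k) * sdiff (n - k) c k / c 0)"
  have p0: "p n k \<ge> 0" for n k using cm c0 by (simp add: p_def)
  have psum: "(\<Sum>k\<le>n. p n k) = 1" for n
    using sdiff_expand_binomial[of n 0 c 0] c0 by (simp add: p_def flip: sum_divide_distrib)
  define \<mu> where "\<mu> = (\<lambda>n. distr (point_measure {..n} (\<lambda>k. ennreal (p n k))) borel (\<lambda>k. real k / real n))"
  have \<mu>_int: "(LINT x|\<mu> n. f x) = (\<Sum>k\<le>n. p n k * f (real k / real n))"
    if [measurable]: "f \<in> borel_measurable borel" for n and f :: "real \<Rightarrow> real"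
    unfolding \<mu>_def
    by (subst integral_distr) (auto simp: lebesgue_integral_point_measure_finite p0)
  have \<mu>_em: "emeasure (\<mu> n) A = 1" if "A \<in> sets borel" "{0..1} \<subseteq> A" for n A
  proof -
    have "(\<lambda>k. real k / real n) -` A \<inter> {..n} = {..n}"
      using that(2) by (force simp: divide_le_eq_1)
    then have "emeasure (\<mu> n) A = (\<Sum>k\<le>n. ennreal (p n k))"
      using that(1) unfolding \<mu>_def
      by (subst emeasure_distr) (auto simp: space_point_measure emeasure_point_measure_finite)
    then show ?thesis using psum by (simp add: sum_ennreal p0)
  qed
  have rd: "real_distribution (\<mu> n)" for n
  proof -
    have "prob_space (\<mu> n)"
      by (rule prob_spaceI) (simp add: \<mu>_def flip: \<mu>_em[of UNIV n])
    then show ?thesis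
      by (intro real_distribution.intro real_distribution_axioms.intro) (simp_all add: \<mu>_def)
  qed
  have "tight \<mu>"
    unfolding tight_def
  proof (intro conjI allI impI rd)
    fix e :: real assume "0 < e"
    have "measure (\<mu> n) {-1<..1} = 1" for n
      unfolding measure_def by (subst \<mu>_em) auto
    then show "\<exists>a b. a < b \<and> (\<forall>n. 1 - e < measure (\<mu> n) {a<..b})"
      using \<open>0 < e\<close> by (intro exI[of _ "-1"] exI[of _ 1]) simp
  qed
  from tight_imp_convergent_subsubsequence[OF this strict_mono_id]
  obtain r M' where r: "strict_mono (r :: nat \<Rightarrow> nat)" and M': "real_distribution M'"
    and conv: "weak_conv_m (\<mu> \<circ> r) M'" by auto
  interpret M': real_distribution M' by fact
  \<comment> \<open>Truncation to \<open>[0,1]\<close> makes the powers bounded continuous functions on the whole line, and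
    the image of the limit measure under \<open>cl\<close> lives on \<open>[0,1]\<close>.\<close>
  define cl where "cl = (\<lambda>x::real. max 0 (min 1 x))"
  have cl[measurable]: "cl \<in> borel_measurable borel" by (simp add: cl_def)
  have lim1: "(\<lambda>n. LINT x|\<mu> n. cl x ^ i) \<longlonglongrightarrow> c i / c 0" for i
  proof -
    have "(\<Sum>k\<le>n. p n k * (real (k choose i) / real (n choose i))) = c i / c 0" if "i \<le> n" for n
    proof -
      have "(\<Sum>k\<le>n. p n k * (real (k choose i) / real (n choose i)))
          = (\<Sum>k\<in>{i..n}. p n k * (real (k choose i) / real (n choose i)))"
        by (rule sum.mono_neutral_right) (auto simp: binomial_eq_0)
      also have "\<dots> = (\<Sum>k\<in>{i..n}. real (n - i choose (k - i)) * sdiff (n - k) c k / c 0)"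
      proof (rule sum.cong[OF refl])
        fix k assume "k \<in> {i..n}"
        then have "real (n choose k) * real (k choose i) = real (n choose i) * real (n - i choose (k - i))"
          using choose_mult[of i k n] by (simp flip: of_nat_mult)
        moreover have "real (n choose i) \<noteq> 0" using that by simp
        moreover have "p n k * (real (k choose i) / real (n choose i))
            = (real (n choose k) * real (k choose i)) * (sdiff (n - k) c k / (c 0 * real (n choose i)))"
          by (simp add: p_def)
        ultimately show "p n k * (real (k choose i) / real (n choose i))
            = real (n - i choose (k - i)) * sdiff (n - k) c k / c 0"
          by simp
      qed
      also have "\<dots> = (\<Sum>k\<le>n - i. real (n - i choose k) * sdiff (0 + (n - i - k)) c (i + k)) / c 0"
        unfolding sum_divide_distrib
        by (rule sum.reindex_bij_witness[of _ "\<lambda>k. k + i" "\<lambda>k. k - i"]) (use that in auto)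
      also have "\<dots> = c i / c 0" by (subst sdiff_expand_binomial) simp
      finally show ?thesis .
    qed
    note exact = this
    have close: "norm ((LINT x|\<mu> n. cl x ^ i) - c i / c 0) \<le> real i * (real i / (real n - real i))"
      if n: "2 * i < n" for n
    proof -
      have "(LINT x|\<mu> n. cl x ^ i) = (\<Sum>k\<le>n. p n k * (real k / real n) ^ i)"
        by (subst \<mu>_int) (auto simp: cl_def divide_simps intro!: sum.cong split: if_splits)
      then have "(LINT x|\<mu> n. cl x ^ i) - c i / c 0
          = (\<Sum>k\<le>n. p n k * ((real k / real n) ^ i - real (k choose i) / real (n choose i)))"
        using exact[of n] n by (simp add: sum_subtractf right_diff_distrib)
      also have "norm \<dots> \<le> (\<Sum>k\<le>n. p n k * (real i * (real i / (real n - real i))))"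
        by (rule order_trans[OF norm_sum sum_mono])
           (simp only: real_norm_def abs_mult abs_of_nonneg[OF p0] atMost_iff,
            intro mult_left_mono binomial_ratio_close_to_power n p0, auto)
      also have "\<dots> = real i * (real i / (real n - real i))"
        by (simp only: psum mult_1_left flip: sum_distrib_right)
      finally show ?thesis .
    qed
    have "(\<lambda>n. real i * (real i / (real n - real i))) \<longlonglongrightarrow> 0" by real_asymp
    moreover have "\<forall>\<^sub>F n in sequentially.
        norm ((LINT x|\<mu> n. cl x ^ i) - c i / c 0) \<le> real i * (real i / (real n - real i))"
      using eventually_gt_at_top[of "2 * i"] by eventually_elim (rule close)
    ultimately have "(\<lambda>n. (LINT x|\<mu> n. cl x ^ i) - c i / c 0) \<longlonglongrightarrow> 0"
      by (rule Lim_null_comparison[rotated])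
    then show ?thesis by (rule LIM_zero_cancel)
  qed
  have mom: "(LINT x|M'. cl x ^ i) = c i / c 0" for i
  proof (rule LIMSEQ_unique)
    show "(\<lambda>n. LINT x|(\<mu> \<circ> r) n. cl x ^ i) \<longlonglongrightarrow> (LINT x|M'. cl x ^ i)"
    proof (rule weak_conv_imp_integral_bdd_continuous_conv[OF _ M' conv, where B = 1])
      show "real_distribution ((\<mu> \<circ> r) n)" for n using rd by simp
      show "isCont (\<lambda>x. cl x ^ i) x" for x unfolding cl_def by (intro continuous_intros)
      show "norm (cl x ^ i) \<le> 1" for x by (simp add: cl_def power_le_one)
    qed
    show "(\<lambda>n. LINT x|(\<mu> \<circ> r) n. cl x ^ i) \<longlonglongrightarrow> c i / c 0"
      using LIMSEQ_subseq_LIMSEQ[OF lim1 r] by (simp add: comp_def)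
  qed
  define M where "M = distr (density M' (\<lambda>_. ennreal (c 0))) borel cl"
  have m: "cl \<in> density M' (\<lambda>_. ennreal (c 0)) \<rightarrow>\<^sub>M borel" by simp
  show thesis
  proof (rule that[of M])
    have "finite_measure (density M' (\<lambda>_. ennreal (c 0)))"
      by (rule finite_measureI) (simp add: emeasure_density_const M'.emeasure_eq_measure ennreal_mult_eq_top_iff)
    then show "finite_measure M"
      unfolding M_def by (rule finite_measure.finite_measure_distr[OF _ m])
    show "sets M = sets borel" by (simp add: M_def)
    show "AE x in M. 0 \<le> x \<and> x \<le> 1"
      unfolding M_def by (subst AE_distr_iff[OF m]) (auto simp: cl_def)
    show "(LINT x|M. x ^ k) = c k" for k
      unfolding M_def using c0 mom[of k]
      by (subst integral_distr[OF m]) (auto simp: integral_density)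
  qed
qed

section \<open>Alternating differences\<close>

text \<open>
  As for \<open>sdiff\<close>, the sign \<open>(-1) ^ m\<close> is included; the steps \<open>h 0, h 1, ...\<close> may differ from each other.
\<close>

primrec adiff :: "nat \<Rightarrow> (nat \<Rightarrow> real) \<Rightarrow> (real \<Rightarrow> real) \<Rightarrow> real \<Rightarrow> real" where
  "adiff 0 h f t = f t"
| "adiff (Suc m) h f t = adiff m h f t - adiff m h f (t + h m)"

definition alternating_from :: "nat \<Rightarrow> (real \<Rightarrow> real) \<Rightarrow> bool" where
  "alternating_from l f \<longleftrightarrow> (\<forall>m\<ge>l. \<forall>h. (\<forall>j. 0 < h j) \<longrightarrow> (\<forall>t\<ge>0. 0 \<le> adiff m h f t))"

lemma adiff_add_order:
  "adiff (m + k) h f t = adiff k (\<lambda>j. h (m + j)) (adiff m h f) t"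
  by (induction k arbitrary: t) auto

lemma adiff_cong_steps: "(\<And>j. j < m \<Longrightarrow> h j = h' j) \<Longrightarrow> adiff m h f t = adiff m h' f t"
  by (induction m arbitrary: t) auto

lemma adiff_cong:
  "(\<And>s. s \<ge> t \<Longrightarrow> f s = g s) \<Longrightarrow> (\<And>j. 0 < h j) \<Longrightarrow> adiff m h f t = adiff m h g t"
proof (induction m arbitrary: t)
  case (Suc m)
  have "adiff m h f (t + h m) = adiff m h g (t + h m)"
    using Suc.prems(2)[of m] by (intro Suc.IH Suc.prems) auto
  then show ?case using Suc by simp
qed simp

lemma adiff_add: "adiff m h (\<lambda>s. f s + g s) t = adiff m h f t + adiff m h g t"
  by (induction m arbitrary: t) auto

lemma adiff_diff: "adiff m h (\<lambda>s. f s - g s) t = adiff m h f t - adiff m h g t"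
  by (induction m arbitrary: t) auto

lemma adiff_cmult: "adiff m h (\<lambda>s. c * f s) t = c * adiff m h f t"
  by (induction m arbitrary: t) (auto simp: right_diff_distrib)

lemma adiff_shift: "adiff m h (\<lambda>s. f (s + a)) t = adiff m h f (t + a)"
  by (induction m arbitrary: t) (auto simp: ac_simps)

text \<open>
  Differences in one family of steps are translation invariant operators, so they commute with those
  in another family.
\<close>

lemma adiff_commute: "adiff m h (adiff k g f) t = adiff k g (adiff m h f) t"
proof (induction k arbitrary: t)
  case (Suc k)
  have "adiff (Suc k) g f = (\<lambda>s. adiff k g f s - adiff k g f (s + g k))" by (rule ext) simp
  then show ?case by (simp add: adiff_diff adiff_shift[where f = "adiff k g f"] Suc.IH)
next
  case 0
  have "adiff 0 g f = f" by (rule ext) simp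
  then show ?case by simp
qed

text \<open>
  Exponentials are eigenfunctions of differences.
\<close>

lemma adiff_exp:
  "adiff m h (\<lambda>t. exp (- (r * t))) t = exp (- (r * t)) * (\<Prod>j<m. 1 - exp (- (r * h j)))"
  by (induction m arbitrary: t) (auto simp: algebra_simps exp_add[symmetric])

lemma adiff_integral:
  assumes "\<And>t. t \<ge> 0 \<Longrightarrow> integrable M (K t)" "\<And>j. 0 < h j" "t \<ge> 0"
  shows "integrable M (\<lambda>r. adiff m h (\<lambda>t. K t r) t)"
    and "adiff m h (\<lambda>t. LINT r|M. K t r) t = (LINT r|M. adiff m h (\<lambda>t. K t r) t)"
  using assms(3)
proof (induction m arbitrary: t)
  case (Suc m)
  { case 1 then show ?case using Suc.IH(1) assms(2)[of m] by (simp add: add_nonneg_nonneg less_imp_le) }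
  { case 2 then show ?case using Suc.IH assms(2)[of m] by (simp add: add_nonneg_nonneg less_imp_le) }
qed (use assms in auto)

lemma continuous_on_adiff:
  assumes "continuous_on {0..} f" "\<And>j. 0 < h j"
  shows "continuous_on {0..} (adiff m h f)"
proof (induction m)
  case (Suc m)
  have "continuous_on {0..} (\<lambda>t. adiff m h f (t + h m))"
    by (rule continuous_on_compose2[OF Suc.IH])
       (use assms(2)[of m] in \<open>auto intro!: continuous_intros\<close>)
  then have "continuous_on {0..} (\<lambda>t. adiff m h f t - adiff m h f (t + h m))"
    using Suc.IH by (intro continuous_on_diff)
  then show ?case by simp
next
  case 0
  have "adiff 0 h f = f" by (rule ext) simp
  then show ?case using assms(1) by simp
qed

text \<open>
  Concatenating the two lists of steps gives a difference of order at least \<open>l\<close>.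
\<close>

lemma alternating_from_adiff:
  assumes "alternating_from l f" "\<And>j. 0 < h j"
  shows "alternating_from 0 (adiff l h f)"
  unfolding alternating_from_def
proof (intro allI impI)
  fix m :: nat and g :: "nat \<Rightarrow> real" and t :: real
  assume g: "\<forall>j. 0 < g j" and t: "0 \<le> t"
  define k where "k = (\<lambda>j. if j < l then h j else g (j - l))"
  have "adiff (l + m) k f t = adiff m (\<lambda>j. k (l + j)) (adiff l k f) t" by (rule adiff_add_order)
  also have "adiff l k f = adiff l h f" by (intro ext adiff_cong_steps) (simp add: k_def)
  also have "(\<lambda>j. k (l + j)) = g" by (simp add: k_def)
  finally have "adiff m g (adiff l h f) t = adiff (l + m) k f t" by simp
  moreover have "\<forall>j. 0 < k j" using assms(2) g by (simp add: k_def)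
  ultimately show "0 \<le> adiff m g (adiff l h f) t"
    using assms(1) t unfolding alternating_from_def by simp
qed

lemma adiff_lattice: "adiff m (\<lambda>_. h) f (real j * h) = sdiff m (\<lambda>j. f (real j * h)) j"
proof (induction m arbitrary: j)
  case (Suc m)
  have "real j * h + h = real (Suc j) * h" by (simp add: algebra_simps)
  then show ?case by (simp only: adiff.simps sdiff.simps Suc.IH)
qed simp

section \<open>Bernstein's theorem\<close>

lemma dyadic_approximation:
  assumes "t \<ge> 0"
  shows "(\<lambda>p. real (nat \<lfloor>t * 2 ^ p\<rfloor> + 1) / 2 ^ p) \<longlonglongrightarrow> t"
proof (rule tendsto_sandwich[where f = "\<lambda>_. t" and h = "\<lambda>p. t + (1 / 2) ^ p"])
  have "t * 2 ^ p \<le> real (nat \<lfloor>t * 2 ^ p\<rfloor> + 1)" "real (nat \<lfloor>t * 2 ^ p\<rfloor> + 1) \<le> t * 2 ^ p + 1" for p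
    using assms by (simp_all add: of_nat_nat) linarith+
  then show "\<forall>\<^sub>F p in sequentially. t \<le> real (nat \<lfloor>t * 2 ^ p\<rfloor> + 1) / 2 ^ p"
    "\<forall>\<^sub>F p in sequentially. real (nat \<lfloor>t * 2 ^ p\<rfloor> + 1) / 2 ^ p \<le> t + (1 / 2) ^ p"
    by (auto simp: field_simps)
  have "(\<lambda>p. t + (1 / 2) ^ p) \<longlonglongrightarrow> t + 0"
    by (intro tendsto_intros LIMSEQ_power_zero) auto
  then show "(\<lambda>p. t + (1 / 2) ^ p) \<longlonglongrightarrow> t" by simp
qed auto

text \<open>
  In the proof of Bernstein's theorem the two sides can be compared at first only at positive dyadic
  numbers; continuity supplies the point \<open>0\<close> as well.
\<close>

lemma eq_if_eq_on_positive_dyadics: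
  fixes f g :: "real \<Rightarrow> real"
  assumes "continuous_on {0..} f" "continuous_on {0..} g"
    and eq: "\<And>p k. k > 0 \<Longrightarrow> f (real k / 2 ^ p) = g (real k / 2 ^ p)" and "t \<ge> 0"
  shows "f t = g t"
proof (rule LIMSEQ_unique)
  let ?x = "\<lambda>p. real (nat \<lfloor>t * 2 ^ p\<rfloor> + 1) / 2 ^ p"
  have x: "?x \<longlonglongrightarrow> t" by (rule dyadic_approximation[OF assms(4)])
  show "(\<lambda>p. f (?x p)) \<longlonglongrightarrow> f t"
    by (rule continuous_on_tendsto_compose[OF assms(1) x]) (use assms(4) in auto)
  have "(\<lambda>p. g (?x p)) \<longlonglongrightarrow> g t"
    by (rule continuous_on_tendsto_compose[OF assms(2) x]) (use assms(4) in auto)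
  then show "(\<lambda>p. f (?x p)) \<longlonglongrightarrow> g t" by (simp only: eq zero_less_Suc Suc_eq_plus1[symmetric])
qed

text \<open>
  Let \<open>M p\<close> be the measure on \<open>[0,1]\<close> whose \<open>k\<close>-th moment is \<open>f (k / 2 ^ p)\<close>. Its image under
  \<open>x \<mapsto> x ^ (2 ^ p)\<close> has the moments \<open>f k\<close> of \<open>M 0\<close> and therefore is \<open>M 0\<close>. Hence \<open>f t\<close> is the
  integral of \<open>x powr t\<close> with respect to \<open>M 0\<close> for dyadic \<open>t\<close>, and by continuity for all \<open>t\<close>.
  Continuity at \<open>0\<close> excludes an atom at \<open>x = 0\<close>, so that \<open>x = exp (-r)\<close> can be substituted.
\<close>

theorem Bernstein_completely_monotone:
  assumes cont: "continuous_on {0..} f" and cm: "alternating_from 0 f"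
  obtains M where "finite_measure M" "sets M = sets borel" "AE r in M. 0 \<le> (r :: real)"
    "\<And>t. t \<ge> 0 \<Longrightarrow> f t = (LINT r|M. exp (- (r * t)))"
proof -
  have "\<exists>M. finite_measure M \<and> sets M = sets borel \<and> (AE x in M. 0 \<le> x \<and> x \<le> (1 :: real)) \<and>
      (\<forall>k. (LINT x|M. x ^ k) = f (real k / 2 ^ p))" for p
  proof -
    have "sdiff m (\<lambda>k. f (real k / 2 ^ p)) j \<ge> 0" for m j
    proof -
      have "0 \<le> adiff m (\<lambda>_. 1 / 2 ^ p) f (real j * (1 / 2 ^ p))"
        using cm unfolding alternating_from_def by simp
      then show ?thesis unfolding adiff_lattice by simp
    qed
    from Hausdorff_moment_problem[OF this] show ?thesis by metis
  qed
  then obtain M where M: "\<And>p. finite_measure (M p)" "\<And>p. sets (M p) = sets borel"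
    "\<And>p. AE x in M p. 0 \<le> x \<and> x \<le> (1 :: real)"
    and mom: "\<And>p k. (LINT x|M p. x ^ k) = f (real k / 2 ^ p)" by metis
  have push: "distr (M p) borel (\<lambda>x. x ^ 2 ^ p) = M 0" for p
  proof (rule moments_determine_measure)
    have m: "(\<lambda>x. x ^ 2 ^ p) \<in> M p \<rightarrow>\<^sub>M borel" by (simp add: M(2) cong: measurable_cong_sets)
    show "finite_measure (distr (M p) borel (\<lambda>x. x ^ 2 ^ p))"
      by (rule finite_measure.finite_measure_distr[OF M(1) m])
    show "AE x in distr (M p) borel (\<lambda>x. x ^ 2 ^ p). 0 \<le> x \<and> x \<le> 1"
      by (subst AE_distr_iff[OF m]) (use M(3)[of p] in \<open>auto simp: power_le_one\<close>)
    show "(LINT x|distr (M p) borel (\<lambda>x. x ^ 2 ^ p). x ^ k) = (LINT x|M 0. x ^ k)" for k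
      by (subst integral_distr[OF m]) (simp_all add: mom power_mult[symmetric])
  qed (use M in auto)
  interpret M0: finite_measure "M 0" by (rule M)
  have sp: "space (M 0) = UNIV" using M(2)[of 0] by (auto dest: sets_eq_imp_space_eq)
  define G where "G = (\<lambda>t. LINT x|M 0. x powr t)"
  have meas: "(\<lambda>x. x powr t) \<in> borel_measurable (M 0)" for t
    by (simp add: M(2) cong: measurable_cong_sets)
  have contG: "continuous_on {0..} G"
    unfolding continuous_on_sequentially
  proof (intro allI ballI impI, elim conjE)
    fix u :: "nat \<Rightarrow> real" and a assume "a \<in> {0..}" and u: "\<forall>n. u n \<in> {0..}" "u \<longlonglongrightarrow> a"
    show "(G \<circ> u) \<longlonglongrightarrow> G a"
      unfolding comp_def G_def
    proof (rule integral_dominated_convergence[where w = "\<lambda>_. 1"])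
      show "AE x in M 0. (\<lambda>n. x powr u n) \<longlonglongrightarrow> x powr a"
        using M(3)[of 0]
      proof eventually_elim
        case (elim x)
        then show ?case using u(2) by (cases "x = 0") (auto intro!: tendsto_powr)
      qed
      show "AE x in M 0. norm (x powr u n) \<le> 1" for n
        using M(3)[of 0] by eventually_elim (use u in \<open>auto intro!: powr_le1\<close>)
    qed (auto intro: meas)
  qed
  have fG: "f t = G t" if "t \<ge> 0" for t
  proof (rule eq_if_eq_on_positive_dyadics[OF cont contG _ that])
    fix p k :: nat assume k: "k > 0"
    have m: "(\<lambda>x. x ^ 2 ^ p) \<in> M p \<rightarrow>\<^sub>M borel" by (simp add: M(2) cong: measurable_cong_sets)
    have "G (real k / 2 ^ p) = (LINT x|M p. (x ^ 2 ^ p) powr (real k / 2 ^ p))"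
      unfolding G_def push[of p, symmetric] by (subst integral_distr[OF m]) auto
    also have "\<dots> = (LINT x|M p. x ^ k)"
    proof (rule integral_cong_AE)
      show "AE x in M p. (x ^ 2 ^ p) powr (real k / 2 ^ p) = x ^ k"
        using M(3)[of p]
      proof eventually_elim
        case (elim x)
        show ?case
        proof (cases "x = 0")
          case True
          then show ?thesis using k by (simp add: zero_power)
        next
          case False
          then have "0 < x" using elim by simp
          then have "(x ^ 2 ^ p) powr (real k / 2 ^ p) = (x powr real (2 ^ p)) powr (real k / 2 ^ p)"
            by (simp only: powr_realpow)
          also have "\<dots> = x powr real k" by (simp only: powr_powr) simp
          also have "\<dots> = x ^ k" using \<open>0 < x\<close> by (rule powr_realpow)
          finally show ?thesis .
        qed
      qed
    qed (simp_all add: M(2) cong: measurable_cong_sets)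
    finally show "f (real k / 2 ^ p) = G (real k / 2 ^ p)" by (simp add: mom)
  qed
  \<comment> \<open>\<open>x powr 0\<close> is \<open>0\<close> for \<open>x = 0\<close> and \<open>1\<close> otherwise, whereas \<open>x ^ 0\<close> is always \<open>1\<close>.\<close>
  have "measure (M 0) {0} = 0"
  proof -
    have "G 0 = f 0" using fG[of 0] by simp
    also have "f 0 = measure (M 0) UNIV" using mom[of 0 0] sp by simp
    also have "G 0 = (LINT x|M 0. indicator (- {0}) x)"
      unfolding G_def by (intro Bochner_Integration.integral_cong) (auto simp: powr_def indicator_def)
    also have "\<dots> = measure (M 0) (- {0})" using sp M(2) by simp
    also have "- {0} = space (M 0) - {0::real}" using sp by auto
    also have "measure (M 0) (space (M 0) - {0}) = measure (M 0) UNIV - measure (M 0) {0}"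
      by (subst M0.finite_measure_compl) (auto simp: M(2) sp)
    finally show ?thesis by simp
  qed
  then have "AE x in M 0. x \<notin> {0}"
    by (intro AE_not_in null_setsI) (auto simp: M(2) M0.emeasure_eq_measure)
  then have pos: "AE x in M 0. 0 < x \<and> x \<le> 1"
    using M(3)[of 0] by eventually_elim auto
  have m: "(\<lambda>x. - ln x) \<in> M 0 \<rightarrow>\<^sub>M borel" by (simp add: M(2) cong: measurable_cong_sets)
  show thesis
  proof (rule that[of "distr (M 0) borel (\<lambda>x. - ln x)"])
    show "finite_measure (distr (M 0) borel (\<lambda>x. - ln x))"
      by (rule M0.finite_measure_distr[OF m])
    show "AE r in distr (M 0) borel (\<lambda>x. - ln x). 0 \<le> r"
      by (subst AE_distr_iff[OF m]) (use pos in auto)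
    show "f t = (LINT r|distr (M 0) borel (\<lambda>x. - ln x). exp (- (r * t)))" if "t \<ge> 0" for t
    proof -
      have "(LINT r|distr (M 0) borel (\<lambda>x. - ln x). exp (- (r * t))) = (LINT x|M 0. exp (ln x * t))"
        by (subst integral_distr[OF m]) auto
      also have "\<dots> = G t"
        unfolding G_def
      proof (rule integral_cong_AE)
        show "AE x in M 0. exp (ln x * t) = x powr t"
          using pos by eventually_elim (simp add: powr_def mult.commute)
      qed (auto simp: M(2) cong: measurable_cong_sets)
      finally show ?thesis using fG[OF that] by simp
    qed
  qed simp
qed

section \<open>Vanishing differences and polynomials\<close>

text \<open>
  Newton's forward difference formula: \<open>E ^ j = (1 - D) ^ j\<close> for the shift \<open>E\<close> and \<open>D = 1 - E\<close>.
\<close>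

lemma sdiff_Newton:
  "sdiff m c (i + j) = (\<Sum>k\<le>j. real (j choose k) * ((-1) ^ k * sdiff (m + k) c i))"
proof (induction j arbitrary: m)
  case (Suc j)
  have "sdiff m c (i + Suc j) = sdiff m c (i + j) - sdiff (Suc m) c (i + j)" by simp
  also have "\<dots> = (\<Sum>k\<le>j. real (j choose k) * ((-1) ^ k * sdiff (m + k) c i))
      + (\<Sum>k\<le>j. real (j choose k) * ((-1) ^ Suc k * sdiff (m + Suc k) c i))"
    unfolding Suc.IH by (simp add: sum_negf del: sdiff.simps)
  also have "\<dots> = (\<Sum>k\<le>Suc j. real (Suc j choose k) * ((-1) ^ k * sdiff (m + k) c i))"
    by (rule sum_choose_Suc[symmetric])
  finally show ?case .
qed simp

text \<open>
  Only the first \<open>l + 1\<close> terms of Newton's formula remain, and each binomial coefficient is a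
  polynomial in \<open>j\<close>.
\<close>

lemma polynomial_sequence_if_sdiff_zero:
  assumes "\<And>j. sdiff (Suc l) c j = 0"
  obtains q where "degree q \<le> l" "\<And>j. c j = poly q (real j)"
proof -
  have zero: "sdiff k c j = 0" if "k > l" for k j
    using that
  proof (induction k arbitrary: j)
    case (Suc k)
    then show ?case using assms[of j] by (cases "k = l") auto
  qed simp
  define B where "B = (\<lambda>k. smult (1 / fact k) (\<Prod>i<k. [:- real i, 1:]))"
  have B: "poly (B k) (real j) = real (j choose k)" for k j
    by (simp add: B_def poly_prod binomial_gbinomial gbinomial_prod_rev lessThan_atLeast0)
  have degB: "degree (B k) \<le> k" for k
  proof -
    have "degree (\<Prod>i<k. [:- real i, 1:]) \<le> (\<Sum>i<k. 1)"
      by (rule order_trans[OF degree_prod_sum_le sum_mono]) auto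
    then show ?thesis unfolding B_def using degree_smult_le order_trans by fastforce
  qed
  define q where "q = (\<Sum>k\<le>l. smult ((-1) ^ k * sdiff k c 0) (B k))"
  show thesis
  proof (rule that[of q])
    show "degree q \<le> l"
      unfolding q_def
    proof (rule degree_sum_le)
      fix k assume "k \<in> {..l}"
      then show "degree (smult ((-1) ^ k * sdiff k c 0) (B k)) \<le> l"
        using order_trans[OF degree_smult_le degB, of _ k] by (meson atMost_iff order_trans)
    qed simp
    fix j
    have "c j = (\<Sum>k\<le>j. real (j choose k) * ((-1) ^ k * sdiff k c 0))"
      using sdiff_Newton[of 0 c 0 j] by simp
    also have "\<dots> = (\<Sum>k\<le>j + l. real (j choose k) * ((-1) ^ k * sdiff k c 0))"
      by (rule sum.mono_neutral_left) (auto simp: binomial_eq_0)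
    also have "\<dots> = (\<Sum>k\<le>l. real (j choose k) * ((-1) ^ k * sdiff k c 0))"
      by (rule sum.mono_neutral_right) (auto simp: zero)
    also have "\<dots> = poly q (real j)"
      unfolding q_def poly_sum by (intro sum.cong refl) (simp add: B)
    finally show "c j = poly q (real j)" .
  qed
qed

lemma poly_eq_if_eq_on_nat:
  fixes p q :: "real poly"
  assumes "\<And>j :: nat. poly p (real j) = poly q (real j)"
  shows "p = q"
proof (rule ccontr)
  assume "p \<noteq> q"
  then have "finite {x. poly (p - q) x = 0}" by (intro poly_roots_finite) simp
  moreover have "range real \<subseteq> {x. poly (p - q) x = 0}" using assms by auto
  ultimately have "finite (range real)" by (rule rev_finite_subset)
  then show False using range_inj_infinite[of real] by (simp add: inj_of_nat)
qed

text \<open>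
  On every lattice of mesh \<open>1 / 2 ^ p\<close> the function is a polynomial, and it is the same polynomial for
  every \<open>p\<close> because all these lattices contain the natural numbers.
\<close>

theorem polynomial_if_adiff_zero:
  assumes cont: "continuous_on {0..} u"
    and zero: "\<And>p t. t \<ge> 0 \<Longrightarrow> adiff (Suc l) (\<lambda>_. 1 / 2 ^ p) u t = 0"
  obtains q where "degree q \<le> l" "\<And>t. t \<ge> 0 \<Longrightarrow> u t = poly q t"
proof -
  have "\<exists>q. degree q \<le> l \<and> (\<forall>j. u (real j / 2 ^ p) = poly q (real j / 2 ^ p))" for p
  proof -
    have "sdiff (Suc l) (\<lambda>j. u (real j * (1 / 2 ^ p))) j = 0" for j
      unfolding adiff_lattice[symmetric] by (rule zero) simp
    then obtain q where q: "degree q \<le> l" "\<And>j. u (real j * (1 / 2 ^ p)) = poly q (real j)"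
      using polynomial_sequence_if_sdiff_zero[of l "\<lambda>j. u (real j * (1 / 2 ^ p))"] by metis
    have "degree (pcompose q [:0, 2 ^ p:]) \<le> l"
      by (rule order_trans[OF degree_pcompose_le]) (use q(1) in simp)
    moreover have "\<forall>j. u (real j / 2 ^ p) = poly (pcompose q [:0, 2 ^ p:]) (real j / 2 ^ p)"
      using q(2) by (simp add: poly_pcompose)
    ultimately show ?thesis by blast
  qed
  then obtain Q where Q: "\<And>p. degree (Q p) \<le> l" "\<And>p j. u (real j / 2 ^ p) = poly (Q p) (real j / 2 ^ p)"
    by metis
  have "Q p = Q 0" for p
  proof (rule poly_eq_if_eq_on_nat)
    fix j
    show "poly (Q p) (real j) = poly (Q 0) (real j)"
      using Q(2)[of "j * 2 ^ p" p] Q(2)[of j 0] by simp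
  qed
  then have "u (real k / 2 ^ p) = poly (Q 0) (real k / 2 ^ p)" for k p
    using Q(2)[of k p] by metis
  then have "u t = poly (Q 0) t" if "t \<ge> 0" for t
    by (intro eq_if_eq_on_positive_dyadics[OF cont _ _ that] continuous_intros)
  then show thesis using that Q(1) by blast
qed

section \<open>Differences and derivatives\<close>

text \<open>
  Here \<open>F j\<close> plays the role of the \<open>j\<close>-th derivative of \<open>F 0\<close>. Replacing \<open>F\<close> by
  \<open>F - F (\<sqdot> + h m)\<close> lowers the order of the difference by one, and the mean value theorem bounds
  the new top derivative. The bound by \<open>c\<close> rather than by \<open>0\<close> makes the lemma give exact values for
  polynomials.
\<close>

lemma adiff_lower_bound:
  assumes deriv: "\<And>j t. j < m \<Longrightarrow> 0 < t \<Longrightarrow> (F j has_real_derivative F (Suc j) t) (at t)"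
    and bound: "\<And>t. 0 < t \<Longrightarrow> c \<le> (-1) ^ m * F m t"
    and h: "\<And>j. 0 < h j" and "0 < t"
  shows "c * (\<Prod>j<m. h j) \<le> adiff m h (F 0) t"
  using assms(1,2,4)
proof (induction m arbitrary: F c t)
  case (Suc m)
  define G where "G = (\<lambda>j s. F j s - F j (s + h m))"
  have "(c * h m) * (\<Prod>j<m. h j) \<le> adiff m h (G 0) t"
  proof (rule Suc.IH)
    fix j s assume "j < m" "0 < (s :: real)"
    then have "(F j has_real_derivative F (Suc j) (s + h m)) (at (s + h m))"
      using Suc.prems(1)[of j "s + h m"] h[of m] by simp
    then show "(G j has_real_derivative G (Suc j) s) (at s)"
      unfolding G_def using \<open>j < m\<close> \<open>0 < s\<close>
      by (intro DERIV_diff Suc.prems) (simp_all add: DERIV_shift)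
  next
    fix s assume s: "0 < (s :: real)"
    obtain z where z: "s < z" "F m (s + h m) - F m s = (s + h m - s) * F (Suc m) z"
      using MVT2[of s "s + h m" "F m" "F (Suc m)"] Suc.prems(1)[of m] h[of m] s by auto
    have "c * h m \<le> ((-1) ^ Suc m * F (Suc m) z) * h m"
      using Suc.prems(2)[of z] z s h[of m] by (intro mult_right_mono) auto
    also have "\<dots> = (-1) ^ m * (- (h m * F (Suc m) z))" by simp
    also have "- (h m * F (Suc m) z) = G m s" using z by (simp add: G_def)
    finally show "c * h m \<le> (-1) ^ m * G m s" .
  qed (rule Suc.prems)
  moreover have "adiff m h (G 0) t = adiff (Suc m) h (F 0) t"
    by (simp add: G_def adiff_diff adiff_shift)
  ultimately show ?case by (simp add: ac_simps)
qed simp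

lemma adiff_lower_bound_at_0:
  assumes "continuous_on {0..} f" "\<And>j. 0 < h j" "\<And>t. 0 < t \<Longrightarrow> c \<le> adiff m h f t"
    and "0 \<le> t"
  shows "c \<le> adiff m h f t"
proof (cases "t = 0")
  case True
  have "(\<lambda>n. 1 / real (Suc n)) \<longlonglongrightarrow> 0" by (rule LIMSEQ_Suc, rule lim_1_over_n)
  then have "(\<lambda>n. adiff m h f (1 / real (Suc n))) \<longlonglongrightarrow> adiff m h f 0"
    by (rule continuous_on_tendsto_compose[OF continuous_on_adiff[OF assms(1,2)]]) auto
  then show ?thesis
    unfolding True by (rule LIMSEQ_le_const) (use assms(3) in auto)
qed (use assms in auto)

text \<open>
  Stated for \<open>degree q \<le> l\<close>, so that the right-hand side is \<open>0\<close> when the degree is smaller.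
\<close>

lemma higher_pderiv_top:
  fixes q :: "real poly"
  assumes "degree q \<le> l"
  shows "(pderiv ^^ l) q = [:fact l * coeff q l:]"
  using assms
proof (induction l arbitrary: q)
  case 0
  then show ?case by (auto elim: degree_eq_zeroE)
next
  case (Suc l)
  then have "(pderiv ^^ l) (pderiv q) = [:fact l * coeff (pderiv q) l:]"
    by (intro Suc.IH) (simp add: degree_pderiv)
  then show ?case by (simp add: funpow_swap1 coeff_pderiv algebra_simps)
qed

text \<open>
  The \<open>l\<close>-th derivative is constant, so the lower bound from derivatives, used for \<open>q\<close> and for \<open>-q\<close>,
  is an equality.
\<close>

lemma adiff_poly:
  assumes "degree q \<le> l" and h: "\<And>j. 0 < h j" and "t \<ge> 0"
  shows "adiff l h (poly q) t = (-1) ^ l * fact l * coeff q l * (\<Prod>j<l. h j)"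
proof -
  have le: "(-1) ^ l * fact l * coeff p l * (\<Prod>j<l. h j) \<le> adiff l h (poly p) t" if "degree p \<le> l" for p
  proof (rule adiff_lower_bound_at_0[OF _ h _ \<open>t \<ge> 0\<close>])
    show "continuous_on {0..} (poly p)" by (intro continuous_intros)
    fix s :: real assume "0 < s"
    have "(poly ((pderiv ^^ j) p) has_real_derivative poly ((pderiv ^^ Suc j) p) x) (at x)" for j x
      using poly_DERIV[of "(pderiv ^^ j) p" x] by simp
    then show "(-1) ^ l * fact l * coeff p l * (\<Prod>j<l. h j) \<le> adiff l h (poly p) s"
      using adiff_lower_bound[of l "\<lambda>j. poly ((pderiv ^^ j) p)" "(-1) ^ l * fact l * coeff p l" h s] h \<open>0 < s\<close>
      by (simp add: higher_pderiv_top[OF that])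
  qed
  have "poly (- q) = (\<lambda>s. - 1 * poly q s)" by (rule ext) simp
  then have "adiff l h (poly (- q)) t = - adiff l h (poly q) t"
    using adiff_cmult[of l h "-1" "poly q" t] by simp
  then show ?thesis using le[of q] le[of "- q"] assms(1) by simp
qed

text \<open>
  Values on \<open>(0,\<infinity>)\<close> determine the iterated derivatives there, whatever \<open>f\<close> is elsewhere.
\<close>

lemma derivative_tower:
  assumes "\<And>j t. 0 < t \<Longrightarrow> (G j has_real_derivative G (Suc j) t) (at t)"
    and "\<And>t. 0 < t \<Longrightarrow> f t = G 0 t" and "0 < t"
  shows "(deriv ^^ j) f t = G j t" and "((deriv ^^ j) f has_real_derivative G (Suc j) t) (at t)"
proof -
  have eq: "(deriv ^^ j) f t = G j t" if "0 < t" for j t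
    using that
  proof (induction j arbitrary: t)
    case (Suc j)
    have "((deriv ^^ j) f has_real_derivative G (Suc j) t) (at t)"
      using assms(1)[OF Suc.prems]
      by (rule has_field_derivative_transform_within_open[of _ _ _ "{0<..}"]) (use Suc in auto)
    then show ?case by (simp add: DERIV_imp_deriv)
  qed (use assms(2) in simp)
  show "(deriv ^^ j) f t = G j t" by (rule eq[OF assms(3)])
  show "((deriv ^^ j) f has_real_derivative G (Suc j) t) (at t)"
    using assms(1)[OF assms(3)]
    by (rule has_field_derivative_transform_within_open[of _ _ _ "{0<..}"]) (use assms(3) eq in auto)
qed

text \<open>
  The implication from (iv): on \<open>(0,\<infinity>)\<close> the sign of a difference is that of the derivative of the same
  order, and continuity of \<open>\<psi>\<close> extends this to the base point \<open>0\<close>.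
\<close>

theorem alternating_if_completely_monotone_order:
  assumes cont: "continuous_on {0..} \<psi>" and cm: "completely_monotone_order l \<psi>"
  shows "alternating_from l \<psi>"
  unfolding alternating_from_def
proof (intro allI impI)
  fix m :: nat and h :: "nat \<Rightarrow> real" and t :: real
  assume m: "l \<le> m" and h: "\<forall>j. 0 < h j" and t: "0 \<le> t"
  define F where "F = (\<lambda>j. (deriv ^^ j) \<psi>)"
  have F: "(F j has_real_derivative F (Suc j) s) (at s)" if "0 < s" for j s
    using cm that unfolding completely_monotone_order_def smooth_pos_def F_def
    by (simp add: DERIV_deriv_iff_real_differentiable)
  have sign: "0 \<le> (-1) ^ m * F m s" if "0 < s" for s
  proof -
    have "(deriv ^^ (m - l)) (\<lambda>t. (-1) ^ l * (deriv ^^ l) \<psi> t) s = (-1) ^ l * F (l + (m - l)) s"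
    proof (rule derivative_tower(1)[where G = "\<lambda>j t. (-1) ^ l * F (l + j) t"])
      show "((\<lambda>t. (-1) ^ l * F (l + j) t) has_real_derivative (-1) ^ l * F (l + Suc j) x) (at x)"
        if "0 < x" for j x
        using DERIV_cmult[OF F[OF that, of "l + j"]] by simp
    qed (use that in \<open>auto simp: F_def\<close>)
    moreover have "0 \<le> (-1) ^ (m - l) * (deriv ^^ (m - l)) (\<lambda>t. (-1) ^ l * (deriv ^^ l) \<psi> t) s"
      using cm[unfolded completely_monotone_order_def completely_monotone_def, THEN conjunct2, THEN conjunct2,
          rule_format, OF that] .
    ultimately have "0 \<le> (-1) ^ (m - l) * ((-1) ^ l * F (l + (m - l)) s)" by (simp only:)
    also have "\<dots> = (-1) ^ (m - l + l) * F (l + (m - l)) s" by (simp only: power_add mult.assoc)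
    finally show ?thesis using m by simp
  qed
  have "0 \<le> adiff m h \<psi> s" if "0 < s" for s
  proof -
    have "0 * (\<Prod>j<m. h j) \<le> adiff m h (F 0) s"
      by (rule adiff_lower_bound) (use F sign h that in blast)+
    then show ?thesis by (simp add: F_def)
  qed
  then show "0 \<le> adiff m h \<psi> t"
    by (rule adiff_lower_bound_at_0[OF cont h[rule_format] _ t])
qed

section \<open>The kernel of the representation and its derivatives\<close>

text \<open>
  The mean value theorem bounds the difference quotients by \<open>C\<close>, and \<open>C\<close> is integrable because the
  measure is finite.
\<close>

lemma has_real_derivative_under_integral:
  fixes K K' :: "real \<Rightarrow> 'a \<Rightarrow> real"
  assumes "finite_measure M" and t: "a < t" "t < b"
    and int: "\<And>s. a < s \<Longrightarrow> s < b \<Longrightarrow> integrable M (K s)"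
    and deriv: "\<And>s r. a < s \<Longrightarrow> s < b \<Longrightarrow> r \<in> space M \<Longrightarrow> ((\<lambda>s. K s r) has_real_derivative K' s r) (at s)"
    and bound: "\<And>s r. a < s \<Longrightarrow> s < b \<Longrightarrow> r \<in> space M \<Longrightarrow> \<bar>K' s r\<bar> \<le> C"
    and meas: "K' t \<in> borel_measurable M"
  shows "((\<lambda>s. LINT r|M. K s r) has_real_derivative (LINT r|M. K' t r)) (at t)"
proof -
  interpret finite_measure M by fact
  have "((\<lambda>s. ((LINT r|M. K s r) - (LINT r|M. K t r)) / (s - t)) \<longlongrightarrow> (LINT r|M. K' t r)) (at t within {a<..<b})"
    unfolding tendsto_at_iff_sequentially
  proof (intro allI impI)
    fix X assume X: "\<forall>i. X i \<in> {a<..<b} - {t}" "X \<longlonglongrightarrow> t"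
    define Q where "Q = (\<lambda>i r. (K (X i) r - K t r) / (X i - t))"
    have "((\<lambda>s. ((LINT r|M. K s r) - (LINT r|M. K t r)) / (s - t)) \<circ> X) = (\<lambda>i. LINT r|M. Q i r)"
    proof (rule ext)
      fix i
      have "integrable M (K (X i))" "integrable M (K t)" using X(1) int t by auto
      then show "((\<lambda>s. ((LINT r|M. K s r) - (LINT r|M. K t r)) / (s - t)) \<circ> X) i = (LINT r|M. Q i r)"
        by (simp add: Q_def)
    qed
    moreover have "(\<lambda>i. LINT r|M. Q i r) \<longlonglongrightarrow> (LINT r|M. K' t r)"
    proof (rule integral_dominated_convergence[where w = "\<lambda>_. C"])
      show "Q i \<in> borel_measurable M" for i
        unfolding Q_def using X(1) int t by (intro borel_measurable_divide borel_measurable_diff) auto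
      show "AE r in M. (\<lambda>i. Q i r) \<longlonglongrightarrow> K' t r"
      proof (rule AE_I2)
        fix r assume "r \<in> space M"
        then have "((\<lambda>s. (K s r - K t r) / (s - t)) \<longlongrightarrow> K' t r) (at t)"
          using deriv[OF t] by (simp add: has_field_derivative_iff)
        then show "(\<lambda>i. Q i r) \<longlonglongrightarrow> K' t r"
          using X unfolding tendsto_at_iff_sequentially Q_def comp_def by auto
      qed
      show "AE r in M. norm (Q i r) \<le> C" for i
      proof (rule AE_I2)
        fix r assume r: "r \<in> space M"
        have Xi: "a < X i" "X i < b" "X i \<noteq> t" using X(1) by auto
        obtain z where "a < z" "z < b" "K (X i) r - K t r = (X i - t) * K' z r"
        proof (cases "t < X i")
          case True
          have "\<exists>z>t. z < X i \<and> K (X i) r - K t r = (X i - t) * K' z r"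
            by (rule MVT2[OF True]) (rule deriv[OF _ _ r]; use t Xi in linarith)
          then obtain z where "t < z" "z < X i" "K (X i) r - K t r = (X i - t) * K' z r" by blast
          then show thesis using that[of z] t Xi by linarith
        next
          case False
          then have "X i < t" using Xi by simp
          have "\<exists>z>X i. z < t \<and> K t r - K (X i) r = (t - X i) * K' z r"
            by (rule MVT2[OF \<open>X i < t\<close>]) (rule deriv[OF _ _ r]; use t Xi in linarith)
          then obtain z where "X i < z" "z < t" "K t r - K (X i) r = (t - X i) * K' z r" by blast
          then show thesis using that[of z] t Xi by (simp add: algebra_simps)
        qed
        then show "norm (Q i r) \<le> C"
          using bound[of z r] r Xi by (simp add: Q_def)
      qed
    qed (use meas in auto)
    ultimately show "((\<lambda>s. ((LINT r|M. K s r) - (LINT r|M. K t r)) / (s - t)) \<circ> X) \<longlonglongrightarrow> (LINT r|M. K' t r)"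
      by simp
  qed
  then show ?thesis
    using t by (simp add: has_field_derivative_iff at_within_open[of t "{a<..<b}"])
qed

text \<open>
  The \<open>m\<close>-th derivative of the representing kernel with respect to \<open>t\<close>. Differentiating
  \<open>omega_fun\<close> lowers its index; the truncated difference \<open>l - m\<close> is right because
  \<open>omega_fun 0 = 0\<close>.
\<close>

definition kernel_deriv :: "nat \<Rightarrow> nat \<Rightarrow> real \<Rightarrow> real \<Rightarrow> real" where
  "kernel_deriv l m t r =
     (-r) ^ m * (exp (- (r * t)) - e_fun l r * omega_fun (l - m) (r * t)) * ((1 + r) ^ l / r ^ l)"

lemma kernel_deriv_0: "kernel_deriv l 0 = kernel_rep l"
  by (simp add: kernel_deriv_def kernel_rep_def fun_eq_iff)

lemma omega_fun_has_derivative: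
  "(omega_fun q has_real_derivative - omega_fun (q - 1) s) (at s)"
proof (induction q)
  case (Suc q)
  have eq: "omega_fun (Suc q) = (\<lambda>s. omega_fun q s + (-1) ^ q * (s ^ q / fact q))" for q
    by (simp add: omega_fun_def fun_eq_iff)
  have "((\<lambda>s. (-1) ^ q * (s ^ q / fact q)) has_real_derivative (-1) ^ q * (real q * s ^ (q - 1) / fact q)) (at s)"
    by (auto intro!: derivative_eq_intros)
  from DERIV_add[OF Suc this]
  have "(omega_fun (Suc q) has_real_derivative - omega_fun (q - 1) s + (-1) ^ q * (real q * s ^ (q - 1) / fact q)) (at s)"
    by (simp add: eq)
  also have "- omega_fun (q - 1) s + (-1) ^ q * (real q * s ^ (q - 1) / fact q) = - omega_fun q s"
  proof (cases q)
    case (Suc k)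
    have "real (Suc k) * s ^ k / fact (Suc k) = s ^ k / fact k" by (simp del: of_nat_Suc)
    then show ?thesis unfolding Suc eq by simp
  qed (simp add: omega_fun_def)
  finally show ?case by simp
qed (simp add: omega_fun_def[abs_def])

lemma kernel_deriv_has_derivative:
  "((\<lambda>t. kernel_deriv l m t r) has_real_derivative kernel_deriv l (Suc m) t r) (at t)"
proof -
  have o: "((\<lambda>t. omega_fun (l - m) (r * t)) has_real_derivative - omega_fun (l - m - 1) (r * t) * r) (at t)"
    by (rule DERIV_chain2[OF omega_fun_has_derivative]) (auto intro!: derivative_eq_intros)
  have "((\<lambda>t. (-r) ^ m * (exp (- (r * t)) - e_fun l r * omega_fun (l - m) (r * t)) * ((1 + r) ^ l / r ^ l))
    has_real_derivative (-r) ^ m * (exp (- (r * t)) * (-r) - e_fun l r * (- omega_fun (l - m - 1) (r * t) * r))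
      * ((1 + r) ^ l / r ^ l)) (at t)"
    by (rule DERIV_cmult_right, rule DERIV_cmult, rule DERIV_diff[OF _ DERIV_cmult[OF o]])
       (auto intro!: derivative_eq_intros)
  then show ?thesis
    by (simp add: kernel_deriv_def algebra_simps)
qed

lemma omega_fun_Suc_0: "omega_fun (Suc q) 0 = 1"
  unfolding omega_fun_def by (subst sum.lessThan_Suc_shift) simp

lemma exp_minus_omega_fun_le:
  assumes "0 \<le> s"
  shows "\<bar>exp (- s) - omega_fun q s\<bar> \<le> s ^ q / fact q"
proof (cases "s = 0 \<or> q = 0")
  case True
  then show ?thesis
    using assms by (cases q) (auto simp: omega_fun_Suc_0 omega_fun_def[of 0])
next
  case False
  then obtain t where t: "- s < t" "t < 0"
    "exp (- s) = (\<Sum>m<q. exp 0 / fact m * (- s) ^ m) + exp t / fact q * (- s) ^ q"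
    using Maclaurin_minus[of "- s" q "\<lambda>_. exp" exp] assms by (auto intro: DERIV_exp)
  have "(\<Sum>m<q. exp 0 / fact m * (- s) ^ m) = omega_fun q s"
    by (simp add: omega_fun_def power_minus[of s] mult.commute)
  then have "\<bar>exp (- s) - omega_fun q s\<bar> = exp t * (s ^ q / fact q)"
    using t(3) assms by (simp add: abs_mult power_abs)
  also have "\<dots> \<le> 1 * (s ^ q / fact q)"
    using t(2) assms by (intro mult_right_mono) auto
  finally show ?thesis by simp
qed

lemma abs_one_minus_e_fun_le:
  assumes "0 < r"
  shows "\<bar>1 - e_fun l r\<bar> \<le> r ^ l"
proof (cases "l = 0")
  case False
  then obtain t where t: "0 < t" "t < r"
    "exp r = (\<Sum>m<l. exp 0 / fact m * r ^ m) + exp t / fact l * r ^ l"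
    using Maclaurin[of r l "\<lambda>_. exp" exp] assms by (auto intro: DERIV_exp)
  have "1 - e_fun l r = exp (- r) * (exp r - (\<Sum>m<l. r ^ m / fact m))"
    by (simp add: e_fun_def right_diff_distrib exp_minus_inverse mult.commute flip: exp_add)
  also have "exp r - (\<Sum>m<l. r ^ m / fact m) = exp t / fact l * r ^ l" using t(3) by simp
  also have "exp (- r) * (exp t / fact l * r ^ l) = exp (t - r) / fact l * r ^ l"
    by (simp add: exp_diff exp_minus field_simps)
  finally have eq: "1 - e_fun l r = exp (t - r) / fact l * r ^ l" .
  have "exp (t - r) / fact l \<le> 1 / 1"
    using t(2) by (intro frac_le) (auto simp: fact_ge_1)
  then have "exp (t - r) / fact l * r ^ l \<le> 1 * r ^ l"
    using assms by (intro mult_right_mono) auto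
  then show ?thesis using assms by (simp add: eq)
qed (simp add: e_fun_def)

lemma abs_omega_fun_le:
  assumes "0 \<le> s" "s \<le> c"
  shows "\<bar>omega_fun q s\<bar> \<le> (\<Sum>j<q. c ^ j)"
  unfolding omega_fun_def
proof (rule order_trans[OF sum_abs sum_mono])
  fix j
  have "s ^ j / fact j \<le> c ^ j / 1"
    using assms by (intro frac_le power_mono) (auto simp: fact_ge_1)
  then show "\<bar>(-1) ^ j * (s ^ j / fact j)\<bar> \<le> c ^ j"
    using assms by (simp add: abs_mult)
qed

lemma power_times_exp_minus_le:
  assumes "0 \<le> (s :: real)"
  shows "s ^ k * exp (- s) \<le> fact k"
proof -
  have "s ^ k / fact k \<le> exp s"
    using exp_lower_Taylor_quadratic sum_le_suminf[OF summable_exp[of s], of "{k}"] assms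
    by (simp add: exp_def field_simps)
  then show ?thesis by (simp add: exp_minus field_simps)
qed

text \<open>
  The estimate behind all integrability statements, with a constant that is uniform in \<open>r\<close> and locally
  uniform in \<open>t\<close>. For \<open>r \<le> 1\<close> the Taylor remainders of \<open>exp\<close> provide the factor \<open>r ^ (l - m)\<close> that
  cancels the singularity of \<open>1 / r ^ l\<close>; for \<open>r \<ge> 1\<close> exponentials outweigh the powers of \<open>r\<close>.
  At \<open>t = 0\<close> the exponential \<open>exp (- (r * t))\<close> does not decay, which is harmless only for \<open>m = 0\<close>.
\<close>

lemma kernel_deriv_bounded:
  assumes a: "0 \<le> a" "m = 0 \<or> 0 < a"
  obtains C where "\<And>t r. a \<le> t \<Longrightarrow> t \<le> b \<Longrightarrow> 0 < r \<Longrightarrow> \<bar>kernel_deriv l m t r\<bar> \<le> C"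
proof -
  define q where "q = l - m"
  define \<Omega> where "\<Omega> = (\<Sum>j<q. b ^ j)"
  \<comment> \<open>\<open>C1\<close> is the bound for \<open>r \<le> 1\<close> and \<open>C2\<close> the one for \<open>r \<ge> 1\<close>. At \<open>m = 0\<close> and \<open>a = 0\<close> the term
    \<open>fact m / a ^ m\<close> is \<open>1\<close>.\<close>
  define C1 where "C1 = (b ^ q + \<Omega>) * 2 ^ l"
  define C2 where "C2 = (fact m / a ^ m + (\<Sum>i<l. \<Sum>j<q. fact (m + i + j) * b ^ j)) * 2 ^ l"
  have near: "\<bar>kernel_deriv l m t r\<bar> \<le> C1" if t: "a \<le> t" "t \<le> b" and r: "0 < r" "r \<le> 1" for t r
  proof -
    have b: "0 \<le> b" and t0: "0 \<le> t" using a t by auto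
    have rt: "r * t \<le> b" using mult_mono[of r 1 t b] r t t0 by simp
    have \<Omega>0: "\<bar>omega_fun q (r * t)\<bar> \<le> \<Omega>"
      unfolding \<Omega>_def using rt r t0 by (intro abs_omega_fun_le) auto
    have "exp (- (r * t)) - e_fun l r * omega_fun q (r * t)
        = (exp (- (r * t)) - omega_fun q (r * t)) + (1 - e_fun l r) * omega_fun q (r * t)"
      by (simp add: algebra_simps)
    also have "\<bar>\<dots>\<bar> \<le> r ^ q * b ^ q + r ^ l * \<Omega>"
    proof (rule order_trans[OF abs_triangle_ineq add_mono])
      have "\<bar>exp (- (r * t)) - omega_fun q (r * t)\<bar> \<le> (r * t) ^ q / fact q"
        using r t0 by (intro exp_minus_omega_fun_le) auto
      also have "\<dots> \<le> (r * b) ^ q / 1"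
        using r t t0 by (intro frac_le power_mono mult_left_mono) (auto simp: fact_ge_1)
      finally show "\<bar>exp (- (r * t)) - omega_fun q (r * t)\<bar> \<le> r ^ q * b ^ q"
        by (simp add: power_mult_distrib)
      show "\<bar>(1 - e_fun l r) * omega_fun q (r * t)\<bar> \<le> r ^ l * \<Omega>"
        unfolding abs_mult using abs_one_minus_e_fun_le[of r l] \<Omega>0 r by (intro mult_mono) auto
    qed
    also have "\<dots> \<le> r ^ q * (b ^ q + \<Omega>)"
    proof -
      have "r ^ l * \<Omega> \<le> r ^ q * \<Omega>"
        using r b by (intro mult_right_mono power_decreasing) (auto simp: q_def \<Omega>_def intro!: sum_nonneg)
      then show ?thesis by (simp add: distrib_left)
    qed
    finally have main: "\<bar>exp (- (r * t)) - e_fun l r * omega_fun q (r * t)\<bar> \<le> r ^ q * (b ^ q + \<Omega>)" .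
    have "\<bar>kernel_deriv l m t r\<bar>
        = r ^ m * \<bar>exp (- (r * t)) - e_fun l r * omega_fun q (r * t)\<bar> * ((1 + r) ^ l / r ^ l)"
      using r by (simp add: kernel_deriv_def q_def abs_mult power_abs)
    also have "\<dots> \<le> r ^ m * (r ^ q * (b ^ q + \<Omega>)) * (2 ^ l / r ^ l)"
      using r main by (intro mult_mono divide_right_mono power_mono) auto
    also have "\<dots> = C1 * (r ^ (m + q) / r ^ l)"
      by (simp add: C1_def power_add)
    also have "\<dots> \<le> C1 * 1"
    proof (rule mult_left_mono)
      have "r ^ (m + q) \<le> r ^ l" using r by (intro power_decreasing) (auto simp: q_def)
      then show "r ^ (m + q) / r ^ l \<le> 1" using r by simp
      show "0 \<le> C1" using b by (auto simp: C1_def \<Omega>_def intro!: mult_nonneg_nonneg add_nonneg_nonneg sum_nonneg)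
    qed
    finally show ?thesis by simp
  qed
  have far: "\<bar>kernel_deriv l m t r\<bar> \<le> C2" if t: "a \<le> t" "t \<le> b" and r: "1 \<le> r" for t r
  proof -
    have b: "0 \<le> b" and t0: "0 \<le> t" using a t by auto
    have expo: "r ^ m * exp (- (r * t)) \<le> fact m / a ^ m"
    proof (cases "m = 0")
      case False
      then have "0 < a" using a by simp
      have "r ^ m * exp (- (r * t)) \<le> r ^ m * exp (- (r * a))"
        using r t by (intro mult_left_mono) auto
      also have "\<dots> = ((r * a) ^ m * exp (- (r * a))) / a ^ m"
        using \<open>0 < a\<close> by (simp add: power_mult_distrib)
      also have "\<dots> \<le> fact m / a ^ m"
        using r \<open>0 < a\<close> by (intro divide_right_mono power_times_exp_minus_le) auto
      finally show ?thesis .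
    qed (use r t0 in simp)
    have poly: "r ^ m * \<bar>e_fun l r * omega_fun q (r * t)\<bar> \<le> (\<Sum>i<l. \<Sum>j<q. fact (m + i + j) * b ^ j)"
    proof -
      have "\<bar>omega_fun q (r * t)\<bar> \<le> (\<Sum>j<q. (r * b) ^ j)"
        using r t t0 by (intro abs_omega_fun_le) auto
      moreover have "\<bar>e_fun l r\<bar> \<le> exp (- r) * (\<Sum>i<l. r ^ i)"
      proof -
        have "(\<Sum>i<l. r ^ i / fact i) \<le> (\<Sum>i<l. r ^ i / 1)"
          using r by (intro sum_mono frac_le) (auto simp: fact_ge_1)
        then show ?thesis
          using r by (simp add: e_fun_def abs_mult sum_nonneg)
      qed
      ultimately have "r ^ m * \<bar>e_fun l r * omega_fun q (r * t)\<bar>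
          \<le> r ^ m * ((exp (- r) * (\<Sum>i<l. r ^ i)) * (\<Sum>j<q. (r * b) ^ j))"
        unfolding abs_mult using r b
        by (intro mult_left_mono mult_mono) (auto intro!: sum_nonneg mult_nonneg_nonneg)
      also have "\<dots> = (\<Sum>i<l. \<Sum>j<q. (r ^ (m + i + j) * exp (- r)) * b ^ j)"
        by (simp add: sum_product sum_distrib_left sum_distrib_right power_add power_mult_distrib mult_ac)
      also have "\<dots> \<le> (\<Sum>i<l. \<Sum>j<q. fact (m + i + j) * b ^ j)"
        using r b by (intro sum_mono mult_right_mono power_times_exp_minus_le) auto
      finally show ?thesis .
    qed
    have "\<bar>kernel_deriv l m t r\<bar>
        = r ^ m * \<bar>exp (- (r * t)) - e_fun l r * omega_fun q (r * t)\<bar> * ((1 + r) ^ l / r ^ l)"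
      using r by (simp add: kernel_deriv_def q_def abs_mult power_abs)
    also have "\<dots> \<le> (r ^ m * (exp (- (r * t)) + \<bar>e_fun l r * omega_fun q (r * t)\<bar>)) * ((1 + r) ^ l / r ^ l)"
      using r abs_triangle_ineq4[of "exp (- (r * t))" "e_fun l r * omega_fun q (r * t)"]
      by (intro mult_right_mono mult_left_mono) auto
    also have "\<dots> \<le> (fact m / a ^ m + (\<Sum>i<l. \<Sum>j<q. fact (m + i + j) * b ^ j)) * 2 ^ l"
    proof (rule mult_mono)
      show "r ^ m * (exp (- (r * t)) + \<bar>e_fun l r * omega_fun q (r * t)\<bar>)
          \<le> fact m / a ^ m + (\<Sum>i<l. \<Sum>j<q. fact (m + i + j) * b ^ j)"
        using expo poly by (simp add: distrib_left)
      have "(1 + r) ^ l / r ^ l = ((1 + r) / r) ^ l" by (simp add: power_divide)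
      also have "\<dots> \<le> 2 ^ l" using r by (intro power_mono) (auto simp: divide_simps)
      finally show "(1 + r) ^ l / r ^ l \<le> 2 ^ l" .
      show "0 \<le> fact m / a ^ m + (\<Sum>i<l. \<Sum>j<q. fact (m + i + j) * b ^ j)"
        using a b by (intro add_nonneg_nonneg sum_nonneg) auto
    qed (use r in auto)
    finally show ?thesis by (simp add: C2_def)
  qed
  show thesis
  proof (rule that)
    fix t r :: real assume "a \<le> t" "t \<le> b" "0 < r"
    then show "\<bar>kernel_deriv l m t r\<bar> \<le> max C1 C2"
      using near[of t r] far[of t r] by (cases "r \<le> 1") auto
  qed
qed

lemma space_if_nonneg_finite_measure_pos:
  assumes "nonneg_finite_measure_pos \<eta>"
  shows "space \<eta> = {0<..}" "finite_measure \<eta>"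
proof -
  have s: "sets \<eta> = sets (restrict_space borel {0<..})" and f: "finite_measure \<eta>"
    using assms unfolding nonneg_finite_measure_pos_def by blast+
  show "space \<eta> = {0<..}"
    unfolding sets_eq_imp_space_eq[OF s] space_restrict_space by simp
  show "finite_measure \<eta>" by (rule f)
qed

lemma borel_measurable_if_nonneg_finite_measure_pos:
  assumes "nonneg_finite_measure_pos \<eta>" "f \<in> borel_measurable borel"
  shows "f \<in> borel_measurable \<eta>"
proof -
  have "f \<in> borel_measurable (restrict_space borel {0<..})"
    using assms(2) by (rule measurable_restrict_space1)
  then show ?thesis
    using assms(1) by (simp add: nonneg_finite_measure_pos_def cong: measurable_cong_sets)
qed

lemma borel_measurable_kernel_deriv [measurable]: "kernel_deriv l m t \<in> borel_measurable borel"
  unfolding kernel_deriv_def e_fun_def omega_fun_def by measurable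

lemma integrable_kernel_deriv:
  assumes \<eta>: "nonneg_finite_measure_pos \<eta>" and "0 \<le> t" "m = 0 \<or> 0 < t"
  shows "integrable \<eta> (kernel_deriv l m t)"
proof -
  interpret finite_measure \<eta> by (rule space_if_nonneg_finite_measure_pos[OF \<eta>])
  obtain C where C: "\<And>s r. t \<le> s \<Longrightarrow> s \<le> t \<Longrightarrow> 0 < r \<Longrightarrow> \<bar>kernel_deriv l m s r\<bar> \<le> C"
    by (rule kernel_deriv_bounded[OF assms(2,3), where b = t and l = l]) blast
  then have "AE r in \<eta>. norm (kernel_deriv l m t r) \<le> C"
    using space_if_nonneg_finite_measure_pos(1)[OF \<eta>] by (intro AE_I2) simp
  then show ?thesis
    by (rule integrable_const_bound) (rule borel_measurable_if_nonneg_finite_measure_pos[OF \<eta> borel_measurable_kernel_deriv])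
qed

lemma continuous_on_kernel_integral:
  assumes \<eta>: "nonneg_finite_measure_pos \<eta>"
  shows "continuous_on {0..} (\<lambda>t. LINT r|\<eta>. kernel_rep l t r)"
  unfolding continuous_on_sequentially
proof (intro allI ballI impI, elim conjE)
  interpret finite_measure \<eta> by (rule space_if_nonneg_finite_measure_pos[OF \<eta>])
  fix u :: "nat \<Rightarrow> real" and t assume t: "t \<in> {0..}" and u: "\<forall>n. u n \<in> {0..}" "u \<longlonglongrightarrow> t"
  obtain b where b: "\<And>n. u n \<le> b"
    using Bseq_bdd_above[OF convergent_imp_Bseq[OF convergentI[OF u(2)]]] by (auto simp: bdd_above_def)
  obtain C where C: "\<And>t r. 0 \<le> t \<Longrightarrow> t \<le> b \<Longrightarrow> 0 < r \<Longrightarrow> \<bar>kernel_rep l t r\<bar> \<le> C"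
    unfolding kernel_deriv_0[symmetric] by (rule kernel_deriv_bounded[of 0 0 b l]) (simp, simp, blast)
  have meas: "kernel_rep l s \<in> borel_measurable \<eta>" for s
    unfolding kernel_deriv_0[symmetric]
    by (rule borel_measurable_if_nonneg_finite_measure_pos[OF \<eta> borel_measurable_kernel_deriv])
  have "(\<lambda>n. LINT r|\<eta>. kernel_rep l (u n) r) \<longlonglongrightarrow> (LINT r|\<eta>. kernel_rep l t r)"
  proof (rule integral_dominated_convergence[where w = "\<lambda>_. C"])
    have "isCont (\<lambda>t. kernel_rep l t r) t" for r
      using kernel_deriv_has_derivative[of l 0 r t] unfolding kernel_deriv_0 by (rule DERIV_isCont)
    then show "AE r in \<eta>. (\<lambda>n. kernel_rep l (u n) r) \<longlonglongrightarrow> kernel_rep l t r"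
      using u(2) by (intro AE_I2 isCont_tendsto_compose[of t "\<lambda>t. kernel_rep l t _" u]) auto
    show "AE r in \<eta>. norm (kernel_rep l (u n) r) \<le> C" for n
      using C[OF _ b] u(1) space_if_nonneg_finite_measure_pos(1)[OF \<eta>] by (intro AE_I2) simp
  qed (auto intro: meas)
  then show "((\<lambda>t. LINT r|\<eta>. kernel_rep l t r) \<circ> u) \<longlonglongrightarrow> (LINT r|\<eta>. kernel_rep l t r)"
    by (simp add: comp_def)
qed

lemma kernel_integral_has_derivative:
  assumes \<eta>: "nonneg_finite_measure_pos \<eta>" and "0 < t"
  shows "((\<lambda>t. LINT r|\<eta>. kernel_deriv l m t r) has_real_derivative (LINT r|\<eta>. kernel_deriv l (Suc m) t r)) (at t)"
proof -
  obtain C where C: "\<And>s r. t / 2 \<le> s \<Longrightarrow> s \<le> 2 * t \<Longrightarrow> 0 < r \<Longrightarrow> \<bar>kernel_deriv l (Suc m) s r\<bar> \<le> C"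
    by (rule kernel_deriv_bounded[of "t / 2" "Suc m" "2 * t" l]) (use \<open>0 < t\<close> in simp, use \<open>0 < t\<close> in simp, blast)
  show ?thesis
  proof (rule has_real_derivative_under_integral[where a = "t / 2" and b = "2 * t" and C = C])
    show "finite_measure \<eta>" by (rule space_if_nonneg_finite_measure_pos[OF \<eta>])
    show "integrable \<eta> (kernel_deriv l m s)" if "t / 2 < s" for s
      using that \<open>0 < t\<close> by (intro integrable_kernel_deriv \<eta>) auto
    show "kernel_deriv l (Suc m) t \<in> borel_measurable \<eta>"
      by (rule borel_measurable_if_nonneg_finite_measure_pos[OF \<eta> borel_measurable_kernel_deriv])
    show "\<bar>kernel_deriv l (Suc m) s r\<bar> \<le> C" if "t / 2 < s" "s < 2 * t" "r \<in> space \<eta>" for s r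
      using that C[of s r] space_if_nonneg_finite_measure_pos(1)[OF \<eta>] by simp
  qed (use \<open>0 < t\<close> kernel_deriv_has_derivative in auto)
qed

lemma poly_of_coefficients:
  obtains q :: "real poly" where "degree q \<le> l" "\<And>k. k \<le> l \<Longrightarrow> coeff q k = a k"
    "\<And>t. poly q t = (\<Sum>k\<le>l. a k * t ^ k)"
proof (rule that[of "\<Sum>k\<le>l. monom (a k) k"])
  show "degree (\<Sum>k\<le>l. monom (a k) k) \<le> l"
    by (rule degree_sum_le) (auto intro: order_trans[OF degree_monom_le])
  show "coeff (\<Sum>k\<le>l. monom (a k) k) k = a k" if "k \<le> l" for k
    using that by (simp add: coeff_sum)
  show "poly (\<Sum>k\<le>l. monom (a k) k) t = (\<Sum>k\<le>l. a k * t ^ k)" for t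
    by (simp add: poly_sum poly_monom)
qed

text \<open>
  The implication from (iii) to (iv). In the derivatives of order at least \<open>l\<close> the polynomials
  \<open>omega_fun\<close> have disappeared, and the integrand has the sign of \<open>(-r) ^ m\<close>.
\<close>

theorem completely_monotone_order_if_represents:
  assumes "represents l \<psi> a \<eta>"
  shows "completely_monotone_order l \<psi>"
proof -
  have \<eta>: "nonneg_finite_measure_pos \<eta>" and al: "0 \<le> (-1) ^ l * a l"
    and rep: "\<And>t. 0 \<le> t \<Longrightarrow> \<psi> t = (\<Sum>k\<le>l. a k * t ^ k) + (LINT r|\<eta>. kernel_rep l t r)"
    using assms by (auto simp: represents_def)
  obtain q where q: "degree q \<le> l" "\<And>k. k \<le> l \<Longrightarrow> coeff q k = a k"
    "\<And>t. poly q t = (\<Sum>k\<le>l. a k * t ^ k)" by (rule poly_of_coefficients[of l a]) blast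
  define G where "G = (\<lambda>m t. poly ((pderiv ^^ m) q) t + (LINT r|\<eta>. kernel_deriv l m t r))"
  have G: "(G m has_real_derivative G (Suc m) t) (at t)" if "0 < t" for m t
    unfolding G_def funpow.simps comp_def
    by (intro DERIV_add poly_DERIV kernel_integral_has_derivative \<eta> that)
  have \<psi>: "\<psi> t = G 0 t" if "0 < t" for t
    using rep[of t] q(3) that by (simp add: G_def kernel_deriv_0)
  have tower: "(deriv ^^ j) \<psi> t = G j t" "((deriv ^^ j) \<psi> has_real_derivative G (Suc j) t) (at t)"
    if "0 < t" for j t
    by (rule derivative_tower[of G \<psi>]; use G \<psi> that in blast)+
  have higher: "(deriv ^^ m) (\<lambda>t. (-1) ^ l * (deriv ^^ l) \<psi> t) t = (-1) ^ l * G (l + m) t"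
    "((deriv ^^ m) (\<lambda>t. (-1) ^ l * (deriv ^^ l) \<psi> t) has_real_derivative (-1) ^ l * G (l + Suc m) t) (at t)"
    if "0 < t" for m t
  proof -
    have "((\<lambda>t. (-1) ^ l * G (l + j) t) has_real_derivative (-1) ^ l * G (l + Suc j) x) (at x)"
      if "0 < x" for j x
      using DERIV_cmult[OF G[OF that, of "l + j"]] by simp
    note * = derivative_tower[of "\<lambda>j t. (-1) ^ l * G (l + j) t" "\<lambda>t. (-1) ^ l * (deriv ^^ l) \<psi> t", OF this _ that]
    show "(deriv ^^ m) (\<lambda>t. (-1) ^ l * (deriv ^^ l) \<psi> t) t = (-1) ^ l * G (l + m) t"
      "((deriv ^^ m) (\<lambda>t. (-1) ^ l * (deriv ^^ l) \<psi> t) has_real_derivative (-1) ^ l * G (l + Suc m) t) (at t)"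
      by (rule *; simp add: tower(1))+
  qed
  have sign: "0 \<le> (-1) ^ m * ((-1) ^ l * G (l + m) t)" if "0 < t" for m t
  proof -
    have "0 \<le> (-1) ^ m * ((-1) ^ l * poly ((pderiv ^^ (l + m)) q) t)"
    proof (cases m)
      case 0
      have "(-1) ^ l * poly ((pderiv ^^ l) q) t = fact l * ((-1) ^ l * a l)"
        by (simp add: higher_pderiv_top[OF q(1)] q(2))
      then have "(-1) ^ m * ((-1) ^ l * poly ((pderiv ^^ (l + m)) q) t) = fact l * ((-1) ^ l * a l)"
        by (simp only: 0 power_0 mult_1_left add_0_right)
      then show ?thesis using al by (simp only: mult_nonneg_nonneg fact_ge_zero)
    next
      case (Suc k)
      have "(pderiv ^^ (l + m)) q = (pderiv ^^ (Suc k)) ((pderiv ^^ l) q)"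
        by (simp add: Suc add.commute[of l] funpow_add)
      also have "\<dots> = (pderiv ^^ k) 0"
        by (simp add: higher_pderiv_top[OF q(1)] funpow_swap1 pderiv_pCons del: funpow.simps add: funpow_Suc_right)
      also have "\<dots> = 0" by (induction k) auto
      finally show ?thesis by simp
    qed
    moreover have "0 \<le> (-1) ^ m * ((-1) ^ l * (LINT r|\<eta>. kernel_deriv l (l + m) t r))"
    proof -
      have "(-1) ^ m * ((-1) ^ l * (LINT r|\<eta>. kernel_deriv l (l + m) t r))
          = (LINT r|\<eta>. (-1) ^ m * ((-1) ^ l * kernel_deriv l (l + m) t r))" by simp
      also have "\<dots> \<ge> 0"
      proof (rule integral_nonneg_AE, rule AE_I2)
        fix r assume "r \<in> space \<eta>"
        then have "0 < r" using space_if_nonneg_finite_measure_pos(1)[OF \<eta>] by simp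
        have "(-1) ^ m * ((-1) ^ l * kernel_deriv l (l + m) t r)
            = ((-1) ^ (l + m) * (-r) ^ (l + m)) * exp (- (r * t)) * ((1 + r) ^ l / r ^ l)"
          by (simp add: kernel_deriv_def omega_fun_def power_add)
        also have "(-1) ^ (l + m) * (-r) ^ (l + m) = r ^ (l + m)"
          by (simp flip: power_mult_distrib)
        finally show "0 \<le> (-1) ^ m * ((-1) ^ l * kernel_deriv l (l + m) t r)"
          using \<open>0 < r\<close> by simp
      qed
      finally show ?thesis .
    qed
    ultimately show ?thesis by (simp add: G_def distrib_left)
  qed
  have "(deriv ^^ m) \<psi> differentiable (at t)"
    "(deriv ^^ m) (\<lambda>t. (-1) ^ l * (deriv ^^ l) \<psi> t) differentiable (at t)" if "0 < t" for m t
    using tower(2)[OF that] higher(2)[OF that] unfolding real_differentiable_def by blast+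
  then show ?thesis
    unfolding completely_monotone_order_def completely_monotone_def smooth_pos_def
    using higher(1) sign by simp
qed

section \<open>Uniqueness of the representation\<close>

lemma finite_measure_density:
  assumes "integrable M g" "AE x in M. 0 \<le> g x"
  shows "finite_measure (density M (\<lambda>x. ennreal (g x)))"
proof (rule finite_measureI)
  have "emeasure (density M (\<lambda>x. ennreal (g x))) (space M) = (\<integral>\<^sup>+x. ennreal (g x) \<partial>M)"
    using assms(1) by (subst emeasure_density) (auto intro!: nn_integral_cong)
  also have "\<dots> = ennreal (LINT x|M. g x)" using assms by (rule nn_integral_eq_integral)
  finally show "emeasure (density M (\<lambda>x. ennreal (g x))) (space (density M (\<lambda>x. ennreal (g x)))) \<noteq> \<infinity>" by simp
qed

text \<open>
  Differences of order at least \<open>l\<close> remove the polynomial part of the kernel, which has degree less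
  than \<open>l\<close> in \<open>t\<close>.
\<close>

lemma adiff_kernel:
  assumes "l \<le> k" "\<And>j. 0 < h j" "0 \<le> t"
  shows "adiff k h (\<lambda>t. kernel_rep l t r) t
    = (exp (- (r * t)) * (\<Prod>j<k. 1 - exp (- (r * h j)))) * ((1 + r) ^ l / r ^ l)"
proof -
  define b where "b = (\<lambda>j. if j < l then (-1) ^ j * (r ^ j / fact j) else 0)"
  obtain q where q: "degree q \<le> k" "\<And>j. j \<le> k \<Longrightarrow> coeff q j = b j"
    "\<And>t. poly q t = (\<Sum>j\<le>k. b j * t ^ j)" by (rule poly_of_coefficients[of k b]) blast
  have "omega_fun l (r * t) = poly q t" for t
  proof -
    have "poly q t = (\<Sum>j<l. b j * t ^ j)"
      unfolding q(3) using assms(1) by (intro sum.mono_neutral_right) (auto simp: b_def)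
    then show ?thesis by (simp add: omega_fun_def b_def power_mult_distrib mult.assoc)
  qed
  then have "(\<lambda>t. kernel_rep l t r)
      = (\<lambda>t. ((1 + r) ^ l / r ^ l) * (exp (- (r * t)) - e_fun l r * poly q t))"
    by (simp add: kernel_rep_def fun_eq_iff mult.commute)
  moreover have "adiff k h (poly q) t = 0"
    using adiff_poly[OF q(1) assms(2,3)] q(2)[of k] assms(1) by (simp add: b_def)
  ultimately have "adiff k h (\<lambda>t. kernel_rep l t r) t
      = ((1 + r) ^ l / r ^ l) * (exp (- (r * t)) * (\<Prod>j<k. 1 - exp (- (r * h j))))"
    by (simp only: adiff_cmult adiff_diff adiff_exp mult_zero_right diff_zero)
  then show ?thesis by (simp only: mult.commute)
qed

text \<open>
  Differences of order greater than \<open>l\<close> remove the polynomial in (iii) as well.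
\<close>

lemma adiff_represents:
  assumes rep: "represents l \<psi> a \<eta>" and "l < k" and h: "\<And>j. 0 < h j" and t: "0 \<le> t"
  shows "adiff k h \<psi> t
    = (LINT r|\<eta>. (exp (- (r * t)) * (\<Prod>j<k. 1 - exp (- (r * h j)))) * ((1 + r) ^ l / r ^ l))" (is ?eq)
    and "integrable \<eta> (\<lambda>r. (exp (- (r * t)) * (\<Prod>j<k. 1 - exp (- (r * h j)))) * ((1 + r) ^ l / r ^ l))" (is ?int)
proof -
  define b where "b = (\<lambda>j. if j \<le> l then a j else 0)"
  obtain q where q: "degree q \<le> k" "\<And>j. j \<le> k \<Longrightarrow> coeff q j = b j"
    "\<And>t. poly q t = (\<Sum>j\<le>k. b j * t ^ j)" by (rule poly_of_coefficients[of k b]) blast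
  have poly: "(\<Sum>j\<le>l. a j * s ^ j) = poly q s" for s
    unfolding q(3) using \<open>l < k\<close> by (intro sum.mono_neutral_cong_left) (auto simp: b_def)
  have int: "\<And>s. 0 \<le> s \<Longrightarrow> integrable \<eta> (kernel_rep l s)"
    using rep by (simp add: represents_def)
  have "adiff k h \<psi> t = adiff k h (\<lambda>s. poly q s + (LINT r|\<eta>. kernel_rep l s r)) t"
    using rep t by (intro adiff_cong h) (simp add: represents_def poly)
  also have "\<dots> = adiff k h (poly q) t + adiff k h (\<lambda>s. LINT r|\<eta>. kernel_rep l s r) t"
    by (rule adiff_add)
  also have "adiff k h (poly q) t = 0"
    using adiff_poly[OF q(1) h t] q(2)[of k] \<open>l < k\<close> by (simp add: b_def)
  also have "adiff k h (\<lambda>s. LINT r|\<eta>. kernel_rep l s r) t = (LINT r|\<eta>. adiff k h (\<lambda>s. kernel_rep l s r) t)"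
    by (rule adiff_integral(2)[OF int h t])
  finally show ?eq using \<open>l < k\<close> h t by (simp add: adiff_kernel)
  have "integrable \<eta> (\<lambda>r. adiff k h (\<lambda>s. kernel_rep l s r) t)"
    by (rule adiff_integral(1)[OF int h t])
  then show ?int using \<open>l < k\<close> h t by (simp add: adiff_kernel)
qed

text \<open>
  By \<open>adiff_represents\<close> the differences of \<open>\<psi>\<close> of order \<open>l + 1\<close> with step \<open>1\<close> are the Laplace
  transform of \<open>V \<eta>\<close>, with a positive function \<open>V\<close>. So \<open>V \<eta>\<close> is determined, and \<open>\<eta>\<close> is recovered by
  dividing by \<open>V\<close>.
\<close>

theorem represents_unique:
  assumes "represents l \<psi> a \<eta>" "represents l \<psi> a' \<eta>'"
  shows "\<forall>k\<le>l. a k = a' k" and "\<eta> = \<eta>'"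
proof -
  define V where "V = (\<lambda>r::real. (1 - exp (- r)) ^ Suc l * ((1 + r) ^ l / r ^ l))"
  define N where "N = (\<lambda>\<eta>. distr (density \<eta> (\<lambda>r. ennreal (V r))) borel (\<lambda>r. r))"
  have V[measurable]: "V \<in> borel_measurable borel" unfolding V_def by measurable
  have Vpos: "0 < V r" if "0 < r" for r using that by (simp add: V_def)
  have N: "finite_measure (N \<eta>)" "sets (N \<eta>) = sets borel" "AE r in N \<eta>. 0 \<le> r"
    "(LINT r|N \<eta>. exp (- (r * real k))) = adiff (Suc l) (\<lambda>_. 1) \<psi> (real k)"
    "A \<in> sets \<eta> \<Longrightarrow> A \<in> sets borel \<and> emeasure \<eta> A = (\<integral>\<^sup>+r. indicator A r * ennreal (1 / V r) \<partial>N \<eta>)"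
    if rep: "represents l \<psi> a \<eta>" for a \<eta> k A
  proof -
    have \<eta>: "nonneg_finite_measure_pos \<eta>" using rep by (simp add: represents_def)
    note sp = space_if_nonneg_finite_measure_pos(1)[OF \<eta>]
    note meas = borel_measurable_if_nonneg_finite_measure_pos[OF \<eta>]
    have V\<eta>: "V \<in> borel_measurable \<eta>" by (rule meas[OF V])
    have V0: "AE r in \<eta>. 0 \<le> V r" using Vpos sp by (intro AE_I2) (simp add: less_imp_le)
    have id: "(\<lambda>r. r) \<in> density \<eta> (\<lambda>r. ennreal (V r)) \<rightarrow>\<^sub>M borel"
      using meas[of "\<lambda>r. r"] by simp
    have "integrable \<eta> V"
      using adiff_represents(2)[OF rep, of "Suc l" "\<lambda>_. 1" 0] by (simp add: V_def mult.assoc)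
    from finite_measure_density[OF this V0]
    show "finite_measure (N \<eta>)" unfolding N_def by (rule finite_measure.finite_measure_distr[OF _ id])
    show "sets (N \<eta>) = sets borel" by (simp add: N_def)
    show "AE r in N \<eta>. 0 \<le> r"
      unfolding N_def by (subst AE_distr_iff[OF id]) (auto simp: sp intro!: AE_I2)
    have "(LINT r|N \<eta>. exp (- (r * real k))) = (LINT r|density \<eta> (\<lambda>r. ennreal (V r)). exp (- (r * real k)))"
      unfolding N_def by (subst integral_distr[OF id]) auto
    also have "\<dots> = (LINT r|\<eta>. V r * exp (- (r * real k)))"
      by (subst integral_density) (auto simp: V\<eta> V0 intro!: meas)
    also have "\<dots> = adiff (Suc l) (\<lambda>_. 1) \<psi> (real k)"
      by (subst adiff_represents(1)[OF rep]) (auto simp: V_def mult_ac)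
    finally show "(LINT r|N \<eta>. exp (- (r * real k))) = adiff (Suc l) (\<lambda>_. 1) \<psi> (real k)" .
    assume A: "A \<in> sets \<eta>"
    then have "A \<in> sets (restrict_space borel {0<..})" using \<eta> by (simp add: nonneg_finite_measure_pos_def)
    then have A': "A \<in> sets borel" by (subst (asm) sets_restrict_space_iff) auto
    have ind: "(\<lambda>r. indicator A r * ennreal (1 / V r)) \<in> borel_measurable \<eta>" using A V\<eta> by measurable
    have "(\<integral>\<^sup>+r. indicator A r * ennreal (1 / V r) \<partial>N \<eta>)
        = (\<integral>\<^sup>+r. indicator A r * ennreal (1 / V r) \<partial>density \<eta> (\<lambda>r. ennreal (V r)))"
      unfolding N_def using A' by (intro nn_integral_distr[OF id]) simp
    also have "\<dots> = (\<integral>\<^sup>+r. ennreal (V r) * (indicator A r * ennreal (1 / V r)) \<partial>\<eta>)"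
      using V\<eta> ind by (subst nn_integral_density) auto
    also have "\<dots> = (\<integral>\<^sup>+r. indicator A r \<partial>\<eta>)"
    proof (rule nn_integral_cong)
      fix r assume "r \<in> space \<eta>"
      then have "0 < V r" using Vpos sp by simp
      then have "ennreal (V r) * ennreal (1 / V r) = 1" by (simp flip: ennreal_mult'')
      then show "ennreal (V r) * (indicator A r * ennreal (1 / V r)) = indicator A r"
        by (auto simp: indicator_def)
    qed
    also have "\<dots> = emeasure \<eta> A" using A by simp
    finally show "A \<in> sets borel \<and> emeasure \<eta> A = (\<integral>\<^sup>+r. indicator A r * ennreal (1 / V r) \<partial>N \<eta>)"
      using A' by simp
  qed
  have "N \<eta> = N \<eta>'"
    by (rule Laplace_transform_determines_measure[OF N(1-3)[OF assms(1)] N(1-3)[OF assms(2)]])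
       (simp only: N(4)[OF assms(1)] N(4)[OF assms(2)])
  have sets: "sets \<eta> = sets \<eta>'"
    using assms by (simp add: represents_def nonneg_finite_measure_pos_def)
  show "\<eta> = \<eta>'"
  proof (rule measure_eqI[OF sets])
    fix A assume "A \<in> sets \<eta>"
    then show "emeasure \<eta> A = emeasure \<eta>' A"
      using N(5)[OF assms(1), of A] N(5)[OF assms(2), of A] sets \<open>N \<eta> = N \<eta>'\<close> by metis
  qed
  then have poly: "(\<Sum>k\<le>l. a k * t ^ k) = (\<Sum>k\<le>l. a' k * t ^ k)" if "0 \<le> t" for t
    using assms that unfolding represents_def by (metis add_right_cancel)
  obtain q where q: "\<And>k. k \<le> l \<Longrightarrow> coeff q k = a k" "\<And>t. poly q t = (\<Sum>k\<le>l. a k * t ^ k)"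
    by (rule poly_of_coefficients[of l a]) blast
  obtain q' where q': "\<And>k. k \<le> l \<Longrightarrow> coeff q' k = a' k" "\<And>t. poly q' t = (\<Sum>k\<le>l. a' k * t ^ k)"
    by (rule poly_of_coefficients[of l a']) blast
  have "q = q'" by (rule poly_eq_if_eq_on_nat) (simp add: q(2) q'(2) poly)
  then show "\<forall>k\<le>l. a k = a' k" using q(1) q'(1) by metis
qed

section \<open>From alternating differences to the representation\<close>

text \<open>
  The implication from the difference property to (iii). In the proof, \<open>g p\<close> is the difference of
  order \<open>l\<close> with step \<open>1 / 2 ^ p\<close>, \<open>M p\<close> is its measure from Bernstein's theorem, and \<open>D p\<close> is the
  factor by which such a difference multiplies \<open>exp (- (r * t))\<close>.
\<close>

theorem represents_if_alternating:
  assumes cont: "continuous_on {0..} \<psi>" and alt: "alternating_from l \<psi>"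
  obtains a \<eta> where "represents l \<psi> a \<eta>"
proof -
  define g where "g = (\<lambda>p::nat. adiff l (\<lambda>_. 1 / 2 ^ p) \<psi>)"
  define D where "D = (\<lambda>(p::nat) (r::real). (1 - exp (- (r * (1 / 2 ^ p)))) ^ l)"
  have "\<exists>M. finite_measure M \<and> sets M = sets borel \<and> (AE r in M. 0 \<le> (r::real)) \<and>
      (\<forall>t\<ge>0. g p t = (LINT r|M. exp (- (r * t))))" for p
  proof -
    have "continuous_on {0..} (g p)" unfolding g_def by (intro continuous_on_adiff cont) simp
    moreover have "alternating_from 0 (g p)" unfolding g_def by (intro alternating_from_adiff alt) simp
    ultimately show ?thesis using Bernstein_completely_monotone by metis
  qed
  then obtain M where M: "\<And>p. finite_measure (M p)" "\<And>p. sets (M p) = sets borel"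
    "\<And>p. AE r in M p. 0 \<le> (r::real)" and gM: "\<And>p t. 0 \<le> t \<Longrightarrow> g p t = (LINT r|M p. exp (- (r * t)))"
    by metis
  have meas: "f \<in> borel_measurable (M p)" if "f \<in> borel_measurable borel" for p and f :: "real \<Rightarrow> real"
    using that M(2) by (simp cong: measurable_cong_sets)
  have bounded_integrable: "integrable (M p) f"
    if "f \<in> borel_measurable borel" "\<And>r. 0 \<le> r \<Longrightarrow> \<bar>f r\<bar> \<le> 1" for p and f :: "real \<Rightarrow> real"
  proof -
    have "AE r in M p. norm (f r) \<le> 1" using M(3)[of p] by eventually_elim (simp add: that(2))
    then show ?thesis by (rule finite_measure.integrable_const_bound[OF M(1)]) (rule meas[OF that(1)])
  qed
  have Dm[measurable]: "D p \<in> borel_measurable borel" for p unfolding D_def by measurable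
  have D01: "0 \<le> D p r" "D p r \<le> 1" if "0 \<le> r" for p r
    using that by (auto simp: D_def intro!: power_le_one)
  have Dpos: "0 < D p r" if "0 < r" for p r
    using that by (simp add: D_def)
  have D_AE: "AE r in M q. 0 \<le> D p r" for p q
    using M(3)[of q] by eventually_elim (rule D01)
  have exp01: "\<bar>exp (- (r * t))\<bar> \<le> 1" if "0 \<le> r" "0 \<le> t" for r t :: real
    using that by simp
  have Laplace_D: "(LINT r|density (M q) (\<lambda>r. ennreal (D p r)). exp (- (r * t))) = adiff l (\<lambda>_. 1 / 2 ^ p) (g q) t"
    if "0 \<le> t" for p q t
  proof -
    have "adiff l (\<lambda>_. 1 / 2 ^ p) (g q) t = adiff l (\<lambda>_. 1 / 2 ^ p) (\<lambda>t. LINT r|M q. exp (- (r * t))) t"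
      using that by (intro adiff_cong) (simp_all add: gM)
    also have "\<dots> = (LINT r|M q. adiff l (\<lambda>_. 1 / 2 ^ p) (\<lambda>t. exp (- (r * t))) t)"
      by (rule adiff_integral(2)) (use that in \<open>auto intro!: bounded_integrable exp01\<close>)
    also have "\<dots> = (LINT r|M q. D p r * exp (- (r * t)))"
      by (simp add: adiff_exp D_def mult.commute)
    also have "\<dots> = (LINT r|density (M q) (\<lambda>r. ennreal (D p r)). exp (- (r * t)))"
      using D_AE by (subst integral_density) (auto intro!: meas)
    finally show ?thesis by simp
  qed
  \<comment> \<open>The Laplace transform of either side is the mixed difference of \<open>\<psi>\<close> with \<open>l\<close> steps \<open>1\<close> and \<open>l\<close>
    steps \<open>1 / 2 ^ p\<close>.\<close>
  have consistent: "density (M p) (\<lambda>r. ennreal (D 0 r)) = density (M 0) (\<lambda>r. ennreal (D p r))" for p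
  proof (rule Laplace_transform_determines_measure)
    have "finite_measure (density (M q) (\<lambda>r. ennreal (D p r)))" for p q
      using D01 by (intro finite_measure_density bounded_integrable D_AE) auto
    then show "finite_measure (density (M p) (\<lambda>r. ennreal (D 0 r)))"
      "finite_measure (density (M 0) (\<lambda>r. ennreal (D p r)))" by blast+
    have "AE r in density (M q) (\<lambda>r. ennreal (D p r)). 0 \<le> r" for p q
    proof (subst AE_density)
      show "(\<lambda>r. ennreal (D p r)) \<in> borel_measurable (M q)" using M(2) by (simp cong: measurable_cong_sets)
      show "AE r in M q. 0 < ennreal (D p r) \<longrightarrow> 0 \<le> r" using M(3)[of q] by eventually_elim simp
    qed
    then show "AE r in density (M p) (\<lambda>r. ennreal (D 0 r)). 0 \<le> r"
      "AE r in density (M 0) (\<lambda>r. ennreal (D p r)). 0 \<le> r" by blast+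
    show "(LINT r|density (M p) (\<lambda>r. ennreal (D 0 r)). exp (- (r * real k)))
      = (LINT r|density (M 0) (\<lambda>r. ennreal (D p r)). exp (- (r * real k)))" for k
      unfolding Laplace_D[OF of_nat_0_le_iff] unfolding g_def by (rule adiff_commute)
  qed (use M(2) in auto)
  define I where "I = (indicator {0<..} :: real \<Rightarrow> real)"
  have Im[measurable]: "I \<in> borel_measurable borel" unfolding I_def by measurable
  \<comment> \<open>The density of \<open>\<eta>\<close> with respect to \<open>M 0\<close>. It is bounded because
    \<open>r / (1 + r) \<le> 1 - exp (- r)\<close>.\<close>
  define v where "v = (\<lambda>r::real. I r * ((r / (1 + r)) ^ l / D 0 r))"
  have vm[measurable]: "v \<in> borel_measurable borel" unfolding v_def by measurable
  have v01: "0 \<le> v r" "v r \<le> 1" if "0 \<le> r" for r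
  proof -
    show "0 \<le> v r" using that D01[of r 0] by (simp add: v_def I_def indicator_def)
    have "(r / (1 + r)) ^ l \<le> D 0 r" if "0 < r"
    proof -
      have "(1 + r) * exp (- r) \<le> 1"
        using exp_ge_add_one_self[of r] by (simp add: exp_minus field_simps)
      then have "r / (1 + r) \<le> 1 - exp (- r)" using that by (simp add: field_simps)
      then show ?thesis using that by (auto simp: D_def intro!: power_mono)
    qed
    then show "v r \<le> 1" using Dpos[of r 0] by (auto simp: v_def I_def indicator_def)
  qed
  define \<sigma> where "\<sigma> = density (M 0) (\<lambda>r. ennreal (v r))"
  define \<eta> where "\<eta> = restrict_space \<sigma> {0<..}"
  have v_AE: "AE r in M 0. 0 \<le> v r" using M(3)[of 0] by eventually_elim (rule v01)
  have "finite_measure \<sigma>"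
    unfolding \<sigma>_def using v01 by (intro finite_measure_density bounded_integrable v_AE) auto
  have sets\<sigma>: "sets \<sigma> = sets borel" by (simp add: \<sigma>_def M(2))
  have sp\<sigma>: "space \<sigma> = UNIV" using sets_eq_imp_space_eq[OF sets\<sigma>] by simp
  have \<eta>: "nonneg_finite_measure_pos \<eta>"
    unfolding nonneg_finite_measure_pos_def
  proof
    show "finite_measure \<eta>"
    proof (rule finite_measureI)
      have "emeasure \<eta> (space \<eta>) = emeasure \<sigma> {0<..}"
        unfolding \<eta>_def by (subst emeasure_restrict_space) (auto simp: sets\<sigma> sp\<sigma> space_restrict_space)
      then show "emeasure \<eta> (space \<eta>) \<noteq> \<infinity>"
        using finite_measure.emeasure_finite[OF \<open>finite_measure \<sigma>\<close>] by simp
    qed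
    show "sets \<eta> = sets (restrict_space borel {0<..})"
      unfolding \<eta>_def by (rule sets_restrict_space_cong[OF sets\<sigma>])
  qed
  have int\<eta>: "(LINT r|\<eta>. f r) = (LINT r|M 0. v r * f r)" if [measurable]: "f \<in> borel_measurable borel" for f
  proof -
    have "(LINT r|\<eta>. f r) = (LINT r|\<sigma>. I r * f r)"
      unfolding \<eta>_def I_def by (subst integral_restrict_space) (auto simp: sets\<sigma> sp\<sigma>)
    also have "\<dots> = (LINT r|M 0. v r * (I r * f r))"
      unfolding \<sigma>_def using v_AE by (subst integral_density) (auto intro!: meas)
    also have "\<dots> = (LINT r|M 0. v r * f r)"
      by (intro Bochner_Integration.integral_cong) (auto simp: v_def I_def indicator_def)
    finally show ?thesis .
  qed
  define F where "F = (\<lambda>t. LINT r|\<eta>. kernel_rep l t r)"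
  define u where "u = (\<lambda>t. \<psi> t - F t)"
  have contF: "continuous_on {0..} F" unfolding F_def by (rule continuous_on_kernel_integral[OF \<eta>])
  have kint: "integrable \<eta> (kernel_rep l t)" if "0 \<le> t" for t
    using integrable_kernel_deriv[OF \<eta> that, of 0 l] by (simp add: kernel_deriv_0)
  have adiffF: "adiff l (\<lambda>_. 1 / 2 ^ p) F t = (LINT r|M p. I r * exp (- (r * t)))" if t: "0 \<le> t" for p t
  proof -
    have "adiff l (\<lambda>_. 1 / 2 ^ p) F t = (LINT r|\<eta>. adiff l (\<lambda>_. 1 / 2 ^ p) (\<lambda>t. kernel_rep l t r) t)"
      unfolding F_def by (rule adiff_integral(2)[OF kint _ t]) auto
    also have "\<dots> = (LINT r|\<eta>. exp (- (r * t)) * D p r * ((1 + r) ^ l / r ^ l))"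
      using t by (subst adiff_kernel) (auto simp: D_def)
    also have "\<dots> = (LINT r|M 0. v r * (exp (- (r * t)) * D p r * ((1 + r) ^ l / r ^ l)))"
      by (rule int\<eta>) measurable
    also have "\<dots> = (LINT r|M 0. D p r * (I r * exp (- (r * t)) / D 0 r))"
    proof (rule Bochner_Integration.integral_cong[OF refl])
      fix r :: real
      show "v r * (exp (- (r * t)) * D p r * ((1 + r) ^ l / r ^ l)) = D p r * (I r * exp (- (r * t)) / D 0 r)"
      proof (cases "0 < r")
        case True
        then have "(r / (1 + r)) ^ l * ((1 + r) ^ l / r ^ l) = 1"
          by (simp add: power_divide)
        moreover have "v r * (exp (- (r * t)) * D p r * ((1 + r) ^ l / r ^ l))
          = (r / (1 + r)) ^ l * ((1 + r) ^ l / r ^ l) * (D p r * (I r * exp (- (r * t)) / D 0 r))"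
          by (simp add: v_def mult_ac)
        ultimately show ?thesis by (simp only: mult_1_left)
      qed (simp add: v_def I_def)
    qed
    also have "\<dots> = (LINT r|density (M 0) (\<lambda>r. ennreal (D p r)). I r * exp (- (r * t)) / D 0 r)"
      using D_AE by (subst integral_density) (auto intro!: meas)
    also have "\<dots> = (LINT r|density (M p) (\<lambda>r. ennreal (D 0 r)). I r * exp (- (r * t)) / D 0 r)"
      by (simp only: consistent)
    also have "\<dots> = (LINT r|M p. D 0 r * (I r * exp (- (r * t)) / D 0 r))"
      using D_AE by (subst integral_density) (auto intro!: meas)
    also have "\<dots> = (LINT r|M p. I r * exp (- (r * t)))"
      using Dpos[of _ 0] by (intro Bochner_Integration.integral_cong refl)
        (fastforce simp: I_def indicator_def)
    finally show ?thesis .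
  qed
  \<comment> \<open>\<open>g p\<close> and the difference of \<open>F\<close> are integrals of the same function with respect to \<open>M p\<close>,
    over \<open>[0,\<infinity>)\<close> and over \<open>(0,\<infinity>)\<close>.\<close>
  have const: "adiff l (\<lambda>_. 1 / 2 ^ p) u t = measure (M p) {0}" if t: "0 \<le> t" for p t
  proof -
    have "g p t = (LINT r|M p. I r * exp (- (r * t)) + indicator {0} r)"
      unfolding gM[OF t]
    proof (rule integral_cong_AE)
      show "AE r in M p. exp (- (r * t)) = I r * exp (- (r * t)) + indicator {0} r"
        using M(3)[of p] by eventually_elim (auto simp: I_def indicator_def)
    qed (auto intro!: meas)
    also have "\<dots> = (LINT r|M p. I r * exp (- (r * t))) + (LINT r|M p. indicator {0} r)"
      using t by (intro Bochner_Integration.integral_add bounded_integrable) (auto simp: I_def indicator_def)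
    also have "(LINT r|M p. indicator {0} r) = measure (M p) {0}"
      using M(2)[of p] by (simp add: sets_eq_imp_space_eq[OF M(2)])
    finally show ?thesis using adiffF[OF t, of p] unfolding u_def by (simp add: adiff_diff g_def)
  qed
  have "continuous_on {0..} u" unfolding u_def by (intro continuous_on_diff cont contF)
  moreover have "adiff (Suc l) (\<lambda>_. 1 / 2 ^ p) u t = 0" if "0 \<le> t" for p t
    using const[of t p] const[of "t + 1 / 2 ^ p" p] that by simp
  ultimately obtain q where q: "degree q \<le> l" "\<And>t. 0 \<le> t \<Longrightarrow> u t = poly q t"
    using polynomial_if_adiff_zero[of u l] by blast
  have "(-1) ^ l * coeff q l * fact l = measure (M 0) {0}"
  proof -
    have "measure (M 0) {0} = adiff l (\<lambda>_. 1 / 2 ^ (0::nat)) (poly q) 0"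
      using const[of 0 0] adiff_cong[of 0 u "poly q" "\<lambda>_. 1 / 2 ^ (0::nat)" l] q(2) by simp
    also have "\<dots> = (-1) ^ l * fact l * coeff q l * (\<Prod>j<l. 1 / 2 ^ (0::nat))"
      by (rule adiff_poly[OF q(1)]) auto
    finally show ?thesis by simp
  qed
  then have "0 * fact l \<le> (-1) ^ l * coeff q l * fact l"
    by (simp only: mult_zero_left measure_nonneg)
  then have sign: "0 \<le> (-1) ^ l * coeff q l"
    by (simp only: mult_le_cancel_right_pos[OF fact_gt_zero])
  have "poly q t = (\<Sum>k\<le>l. coeff q k * t ^ k)" for t
    unfolding poly_altdef using q(1) by (intro sum.mono_neutral_left) (auto simp: coeff_eq_0)
  then have "represents l \<psi> (coeff q) \<eta>"
    unfolding represents_def using sign \<eta> kint q(2) by (auto simp: u_def F_def diff_eq_eq)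
  then show thesis by (rule that)
qed

section \<open>From the representation to conditional positive definiteness\<close>

definition inner_Rd :: "nat \<Rightarrow> (nat \<Rightarrow> real) \<Rightarrow> (nat \<Rightarrow> real) \<Rightarrow> real" where
  "inner_Rd d x y = (\<Sum>s<d. x s * y s)"

definition monomial_Rd :: "nat \<Rightarrow> (nat \<Rightarrow> nat) \<Rightarrow> (nat \<Rightarrow> real) \<Rightarrow> real" where
  "monomial_Rd d \<alpha> x = (\<Prod>s<d. x s ^ \<alpha> s)"

lemma sqdist_sum: "sqdist d x y = (\<Sum>s<d. (x s - y s)\<^sup>2)"
  by (simp add: norm_Rd_def L2_set_def sum_nonneg)

lemma sqdist_inner: "sqdist d x y = inner_Rd d x x + inner_Rd d y y - 2 * inner_Rd d x y"
  unfolding sqdist_sum inner_Rd_def sum_distrib_left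
  by (simp add: power2_eq_square algebra_simps sum.distrib sum_subtractf)

lemma poly_fun_monomial:
  assumes "(\<Sum>s<d. \<alpha> s) \<le> k"
  shows "poly_fun d k (monomial_Rd d \<alpha>)"
proof -
  let ?S = "{\<beta>. \<beta> \<in> PiE {..<d} (\<lambda>_. UNIV) \<and> (\<Sum>s<d. \<beta> s) \<le> k} :: (nat \<Rightarrow> nat) set"
  have "?S \<subseteq> PiE {..<d} (\<lambda>_. {..k})"
  proof
    fix \<beta> assume \<beta>: "\<beta> \<in> ?S"
    have "\<beta> s \<le> k" if "s < d" for s
      using \<beta> member_le_sum[of s "{..<d}" \<beta>] that by simp
    with \<beta> show "\<beta> \<in> PiE {..<d} (\<lambda>_. {..k})" by (auto simp: PiE_iff)
  qed
  then have fin: "finite ?S" by (rule finite_subset) (intro finite_PiE; simp)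
  define \<beta> where "\<beta> = restrict \<alpha> {..<d}"
  have \<beta>: "\<beta> \<in> ?S" using assms by (simp add: \<beta>_def)
  have "monomial_Rd d \<alpha> x = (\<Sum>\<gamma>\<in>?S. (if \<gamma> = \<beta> then 1 else 0) * (\<Prod>s<d. x s ^ \<gamma> s))" for x
  proof -
    have "(\<Sum>\<gamma>\<in>?S. (if \<gamma> = \<beta> then 1 else 0) * (\<Prod>s<d. x s ^ \<gamma> s))
        = (\<Sum>\<gamma>\<in>?S. if \<gamma> = \<beta> then (\<Prod>s<d. x s ^ \<gamma> s) else 0)"
      by (intro sum.cong) auto
    also have "\<dots> = (\<Prod>s<d. x s ^ \<beta> s)" using fin \<beta> by simp
    also have "\<dots> = monomial_Rd d \<alpha> x" by (simp add: monomial_Rd_def \<beta>_def)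
    finally show ?thesis by simp
  qed
  then show ?thesis
    unfolding poly_fun_def by (intro exI[of _ "\<lambda>\<gamma>. if \<gamma> = \<beta> then 1 else 0"] allI)
qed

lemma monomial_times_coordinate:
  assumes "s < d"
  shows "monomial_Rd d \<alpha> x * x s = monomial_Rd d (\<alpha>(s := Suc (\<alpha> s))) x"
proof -
  have "monomial_Rd d (\<alpha>(s := Suc (\<alpha> s))) x
      = x s ^ Suc (\<alpha> s) * (\<Prod>i\<in>{..<d} - {s}. x i ^ (\<alpha>(s := Suc (\<alpha> s))) i)"
    unfolding monomial_Rd_def using assms by (subst prod.remove[of _ s]) auto
  also have "(\<Prod>i\<in>{..<d} - {s}. x i ^ (\<alpha>(s := Suc (\<alpha> s))) i) = (\<Prod>i\<in>{..<d} - {s}. x i ^ \<alpha> i)"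
    by (intro prod.cong) auto
  also have "x s ^ Suc (\<alpha> s) * \<dots> = (x s ^ \<alpha> s * \<dots>) * x s" by simp
  also have "x s ^ \<alpha> s * (\<Prod>i\<in>{..<d} - {s}. x i ^ \<alpha> i) = monomial_Rd d \<alpha> x"
    unfolding monomial_Rd_def using assms by (subst (2) prod.remove[of _ s]) auto
  finally show ?thesis by (rule sym)
qed

lemma sum_exponents_Suc:
  fixes s d :: nat
  assumes "s < d"
  shows "(\<Sum>i<d. (\<alpha>(s := Suc (\<alpha> s))) i) = Suc (\<Sum>i<d. \<alpha> i :: nat)"
proof -
  have "(\<Sum>i<d. (\<alpha>(s := Suc (\<alpha> s))) i) = (\<Sum>i<d. \<alpha> i + (if i = s then 1 else 0))"
    by (intro sum.cong) auto
  also have "\<dots> = (\<Sum>i<d. \<alpha> i) + 1"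
    using assms by (subst sum.distrib, subst sum.delta) auto
  finally show ?thesis by simp
qed

text \<open>
  Multiplying a positive definite kernel by \<open>x s * y s\<close> only changes the weights.
\<close>

lemma power_inner_Rd_pos_def:
  fixes c :: "nat \<Rightarrow> real"
  shows "0 \<le> (\<Sum>i<m. \<Sum>j<m. c i * c j * inner_Rd d (x i) (x j) ^ k)"
proof (induction k arbitrary: c)
  case 0
  have "(\<Sum>i<m. \<Sum>j<m. c i * c j * inner_Rd d (x i) (x j) ^ 0) = (\<Sum>i<m. c i) * (\<Sum>j<m. c j)"
    by (simp add: sum_product)
  then show ?case by simp
next
  case (Suc k)
  have "(\<Sum>i<m. \<Sum>j<m. c i * c j * inner_Rd d (x i) (x j) ^ Suc k)
      = (\<Sum>i<m. \<Sum>j<m. \<Sum>s<d. (c i * x i s) * (c j * x j s) * inner_Rd d (x i) (x j) ^ k)"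
    unfolding power_Suc
    by (intro sum.cong refl, subst inner_Rd_def) (simp add: sum_distrib_left sum_distrib_right mult_ac)
  also have "\<dots> = (\<Sum>s<d. \<Sum>i<m. \<Sum>j<m. (c i * x i s) * (c j * x j s) * inner_Rd d (x i) (x j) ^ k)"
    by (subst (2) sum.swap, subst sum.swap) (rule refl)
  also have "0 \<le> \<dots>" by (rule sum_nonneg) (rule Suc.IH)
  finally show ?case .
qed

text \<open>
  Points and weights as in the definition of conditional positive definiteness of order \<open>L + 1\<close>.
\<close>

locale annihilating_weights =
  fixes d L m :: nat and x :: "nat \<Rightarrow> nat \<Rightarrow> real" and c :: "nat \<Rightarrow> real"
  assumes annihilates: "\<And>p. poly_fun d L p \<Longrightarrow> (\<Sum>i<m. c i * p (x i)) = 0"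
begin

text \<open>
  As a function of \<open>x i\<close> the bracket is a polynomial of degree at most \<open>L\<close>. Peeling off one inner
  product at a time reduces it to monomials.
\<close>

lemma annihilates_inner_product_powers:
  "(\<Sum>s<d. \<alpha> s) + 2 * a + b \<le> L \<Longrightarrow>
    (\<Sum>i<m. c i * (monomial_Rd d \<alpha> (x i) * inner_Rd d (x i) (x i) ^ a * inner_Rd d (x i) y ^ b)) = 0"
proof (induction a arbitrary: \<alpha>)
  case 0
  then show ?case
  proof (induction b arbitrary: \<alpha>)
    case 0
    then show ?case using annihilates[OF poly_fun_monomial[of \<alpha> d L]] by simp
  next
    case (Suc b)
    have "(\<Sum>i<m. c i * (monomial_Rd d \<alpha> (x i) * inner_Rd d (x i) (x i) ^ 0 * inner_Rd d (x i) y ^ Suc b))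
        = (\<Sum>i<m. \<Sum>s<d. y s * (c i * ((monomial_Rd d \<alpha> (x i) * x i s) * inner_Rd d (x i) (x i) ^ 0 * inner_Rd d (x i) y ^ b)))"
      unfolding power_Suc inner_Rd_def[of d _ y]
      by (intro sum.cong refl) (simp add: sum_distrib_left sum_distrib_right mult_ac)
    also have "\<dots> = (\<Sum>s<d. y s * (\<Sum>i<m. c i * ((monomial_Rd d \<alpha> (x i) * x i s) * inner_Rd d (x i) (x i) ^ 0 * inner_Rd d (x i) y ^ b)))"
      by (subst sum.swap) (simp add: sum_distrib_left)
    also have "\<dots> = 0"
    proof (rule sum.neutral, rule ballI)
      fix s assume "s \<in> {..<d}"
      then have s: "s < d" by simp
      have "(\<Sum>i<d. (\<alpha>(s := Suc (\<alpha> s))) i) + 2 * 0 + b \<le> L"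
        using Suc.prems unfolding sum_exponents_Suc[OF s] by simp
      from Suc.IH[OF this] show "y s * (\<Sum>i<m. c i * ((monomial_Rd d \<alpha> (x i) * x i s) * inner_Rd d (x i) (x i) ^ 0 * inner_Rd d (x i) y ^ b)) = 0"
        unfolding monomial_times_coordinate[OF s] by (simp only: mult_zero_right)
    qed
    finally show ?case .
  qed
next
  case (Suc a)
  have "(\<Sum>i<m. c i * (monomial_Rd d \<alpha> (x i) * inner_Rd d (x i) (x i) ^ Suc a * inner_Rd d (x i) y ^ b))
      = (\<Sum>i<m. \<Sum>s<d. c i * ((monomial_Rd d \<alpha> (x i) * x i s * x i s) * inner_Rd d (x i) (x i) ^ a * inner_Rd d (x i) y ^ b))"
    by (intro sum.cong refl) (simp add: inner_Rd_def[of d "x _" "x _"] sum_distrib_left sum_distrib_right mult_ac)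
  also have "\<dots> = (\<Sum>s<d. \<Sum>i<m. c i * ((monomial_Rd d \<alpha> (x i) * x i s * x i s) * inner_Rd d (x i) (x i) ^ a * inner_Rd d (x i) y ^ b))"
    by (rule sum.swap)
  also have "\<dots> = 0"
  proof (rule sum.neutral, rule ballI)
    fix s assume "s \<in> {..<d}"
    then have s: "s < d" by simp
    let ?\<alpha> = "\<alpha>(s := Suc (\<alpha> s))"
    have "(\<Sum>i<d. (?\<alpha>(s := Suc (?\<alpha> s))) i) = Suc (Suc (\<Sum>i<d. \<alpha> i))"
      by (simp only: sum_exponents_Suc[OF s])
    note double = this
    have "(\<Sum>i<d. (?\<alpha>(s := Suc (?\<alpha> s))) i) + 2 * a + b \<le> L"
      unfolding double using Suc.prems by simp
    from Suc.IH[OF this]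
    show "(\<Sum>i<m. c i * ((monomial_Rd d \<alpha> (x i) * x i s * x i s) * inner_Rd d (x i) (x i) ^ a * inner_Rd d (x i) y ^ b)) = 0"
      unfolding monomial_times_coordinate[OF s] .
  qed
  finally show ?case .
qed

text \<open>
  The quadratic form of the radial kernel with profile \<open>f\<close>, as a linear functional of \<open>f\<close>.
\<close>

definition pairing :: "(real \<Rightarrow> real) \<Rightarrow> real" where
  "pairing f = (\<Sum>i<m. \<Sum>j<m. c i * c j * f (sqdist d (x i) (x j)))"

lemma pairing_add: "pairing (\<lambda>t. f t + g t) = pairing f + pairing g"
  by (simp add: pairing_def distrib_left sum.distrib)

lemma pairing_diff: "pairing (\<lambda>t. f t - g t) = pairing f - pairing g"
  by (simp add: pairing_def right_diff_distrib sum_subtractf)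

lemma pairing_cmult: "pairing (\<lambda>t. a * f t) = a * pairing f"
  by (simp add: pairing_def sum_distrib_left mult_ac)

lemma pairing_sum: "pairing (\<lambda>t. \<Sum>k\<in>K. f k t) = (\<Sum>k\<in>K. pairing (f k))"
  by (induction K rule: infinite_finite_induct) (simp_all add: pairing_add, simp_all add: pairing_def)

text \<open>
  Expand \<open>\<bar>x - y\<bar>\<^sup>2 = \<bar>x\<bar>\<^sup>2 + \<bar>y\<bar>\<^sup>2 - 2 \<langle>x,y\<rangle>\<close> to the power \<open>k\<close>. In a term with \<open>\<bar>x\<bar> ^ (2 f)\<close> and
  \<open>\<bar>y\<bar> ^ (2 (e - f))\<close> one of the two variables has degree at most \<open>k\<close>, and summation over that
  variable gives \<open>0\<close>.
\<close>

lemma pairing_power_zero: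
  assumes "k \<le> L"
  shows "pairing (\<lambda>t. t ^ k) = 0"
proof -
  define N where "N = (\<lambda>i. inner_Rd d (x i) (x i))"
  define ip where "ip = (\<lambda>i j. inner_Rd d (x i) (x j))"
  have ip: "ip i j = ip j i" for i j by (simp add: ip_def inner_Rd_def mult.commute)
  have half: "(\<Sum>i<m. c i * (N i ^ a * ip i j ^ b)) = 0" if "2 * a + b \<le> L" for a b j
    using annihilates_inner_product_powers[where \<alpha> = "\<lambda>_. 0" and a = a and b = b and y = "x j"] that
    by (simp add: monomial_Rd_def N_def ip_def)
  have zero: "(\<Sum>i<m. \<Sum>j<m. c i * c j * (N i ^ f * N j ^ (e - f) * ip i j ^ (k - e))) = 0"
    if "f \<le> e" "e \<le> k" for e f
  proof (cases "2 * f \<le> e")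
    case True
    have "(\<Sum>i<m. \<Sum>j<m. c i * c j * (N i ^ f * N j ^ (e - f) * ip i j ^ (k - e)))
        = (\<Sum>j<m. (c j * N j ^ (e - f)) * (\<Sum>i<m. c i * (N i ^ f * ip i j ^ (k - e))))"
      by (subst sum.swap) (simp add: sum_distrib_left mult_ac)
    also have "\<dots> = 0" using half[of f "k - e"] True that assms by simp
    finally show ?thesis .
  next
    case False
    have "(\<Sum>i<m. \<Sum>j<m. c i * c j * (N i ^ f * N j ^ (e - f) * ip i j ^ (k - e)))
        = (\<Sum>i<m. (c i * N i ^ f) * (\<Sum>j<m. c j * (N j ^ (e - f) * ip j i ^ (k - e))))"
      by (simp add: sum_distrib_left mult_ac ip)
    also have "\<dots> = 0" using half[of "e - f" "k - e"] False that assms by simp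
    finally show ?thesis .
  qed
  have expand: "sqdist d (x i) (x j) ^ k
      = (\<Sum>e\<le>k. \<Sum>f\<le>e. (real (k choose e) * real (e choose f) * (- 2) ^ (k - e)) *
          (N i ^ f * N j ^ (e - f) * ip i j ^ (k - e)))" for i j
  proof -
    have "sqdist d (x i) (x j) ^ k = ((N i + N j) + (- 2 * ip i j)) ^ k"
      by (simp add: sqdist_inner N_def ip_def)
    also have "\<dots> = (\<Sum>e\<le>k. real (k choose e) * (N i + N j) ^ e * (- 2 * ip i j) ^ (k - e))"
      by (rule binomial_ring)
    also have "\<dots> = (\<Sum>e\<le>k. \<Sum>f\<le>e. (real (k choose e) * real (e choose f) * (- 2) ^ (k - e)) *
          (N i ^ f * N j ^ (e - f) * ip i j ^ (k - e)))"
      unfolding binomial_ring[of "N i" "N j"] power_mult_distrib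
      by (intro sum.cong refl) (simp add: sum_distrib_left sum_distrib_right mult_ac)
    finally show ?thesis .
  qed
  have "pairing (\<lambda>t. t ^ k) = (\<Sum>e\<le>k. \<Sum>f\<le>e. (real (k choose e) * real (e choose f) * (- 2) ^ (k - e)) *
      (\<Sum>i<m. \<Sum>j<m. c i * c j * (N i ^ f * N j ^ (e - f) * ip i j ^ (k - e))))"
  proof -
    have "pairing (\<lambda>t. t ^ k) = (\<Sum>i<m. \<Sum>j<m. \<Sum>e\<le>k. \<Sum>f\<le>e. (real (k choose e) * real (e choose f) * (- 2) ^ (k - e)) *
        (c i * c j * (N i ^ f * N j ^ (e - f) * ip i j ^ (k - e))))"
      unfolding pairing_def expand by (simp add: sum_distrib_left mult_ac)
    also have "\<dots> = (\<Sum>e\<le>k. \<Sum>i<m. \<Sum>j<m. \<Sum>f\<le>e. (real (k choose e) * real (e choose f) * (- 2) ^ (k - e)) *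
        (c i * c j * (N i ^ f * N j ^ (e - f) * ip i j ^ (k - e))))"
      by (subst (2) sum.swap, subst sum.swap) (rule refl)
    also have "\<dots> = (\<Sum>e\<le>k. \<Sum>f\<le>e. \<Sum>i<m. \<Sum>j<m. (real (k choose e) * real (e choose f) * (- 2) ^ (k - e)) *
        (c i * c j * (N i ^ f * N j ^ (e - f) * ip i j ^ (k - e))))"
      by (rule sum.cong[OF refl], subst (2) sum.swap, subst sum.swap) (rule refl)
    finally show ?thesis by (simp only: sum_distrib_left)
  qed
  also have "\<dots> = 0"
    by (intro sum.neutral ballI) (simp add: zero)
  finally show ?thesis .
qed

text \<open>
  The Gaussian kernel is positive definite: after the factors \<open>exp (- r \<bar>x\<bar>\<^sup>2)\<close> have been absorbed in
  the weights, the power series of \<open>exp (2 r \<langle>x,y\<rangle>)\<close> has nonnegative coefficients.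
\<close>

lemma pairing_exp_nonneg:
  assumes "0 \<le> r"
  shows "0 \<le> pairing (\<lambda>t. exp (- (r * t)))"
proof -
  define b where "b = (\<lambda>i. c i * exp (- (r * inner_Rd d (x i) (x i))))"
  have "c i * c j * exp (- (r * sqdist d (x i) (x j))) = b i * b j * exp (2 * r * inner_Rd d (x i) (x j))" for i j
  proof -
    have "exp (- (r * sqdist d (x i) (x j)))
        = exp (- (r * inner_Rd d (x i) (x i))) * exp (- (r * inner_Rd d (x j) (x j))) * exp (2 * r * inner_Rd d (x i) (x j))"
      unfolding sqdist_inner exp_add[symmetric] by (simp add: algebra_simps)
    then show ?thesis by (simp add: b_def)
  qed
  then have eq: "pairing (\<lambda>t. exp (- (r * t))) = (\<Sum>i<m. \<Sum>j<m. b i * b j * exp (2 * r * inner_Rd d (x i) (x j)))"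
    by (simp add: pairing_def)
  have series: "(\<lambda>k. \<Sum>i<m. \<Sum>j<m. b i * b j * ((2 * r * inner_Rd d (x i) (x j)) ^ k /\<^sub>R fact k))
      sums (\<Sum>i<m. \<Sum>j<m. b i * b j * exp (2 * r * inner_Rd d (x i) (x j)))"
    by (intro sums_sum sums_mult exp_converges)
  have "0 \<le> (\<Sum>i<m. \<Sum>j<m. b i * b j * ((2 * r * inner_Rd d (x i) (x j)) ^ k /\<^sub>R fact k))" for k
  proof -
    have "(\<Sum>i<m. \<Sum>j<m. b i * b j * ((2 * r * inner_Rd d (x i) (x j)) ^ k /\<^sub>R fact k))
        = ((2 * r) ^ k / fact k) * (\<Sum>i<m. \<Sum>j<m. b i * b j * inner_Rd d (x i) (x j) ^ k)"
      by (simp add: sum_distrib_left power_mult_distrib divide_inverse mult_ac)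
    also have "\<dots> \<ge> 0"
      using assms by (intro mult_nonneg_nonneg power_inner_Rd_pos_def) simp
    finally show ?thesis .
  qed
  then show ?thesis
    unfolding eq by (rule sums_le[OF _ sums_zero series])
qed

lemma pairing_omega_fun_zero:
  assumes "l \<le> Suc L"
  shows "pairing (\<lambda>t. omega_fun l (r * t)) = 0"
proof -
  have "(\<lambda>t. omega_fun l (r * t)) = (\<lambda>t. \<Sum>j<l. ((-1) ^ j * r ^ j / fact j) * t ^ j)"
    by (simp add: omega_fun_def power_mult_distrib fun_eq_iff mult.assoc)
  then have "pairing (\<lambda>t. omega_fun l (r * t)) = (\<Sum>j<l. ((-1) ^ j * r ^ j / fact j) * pairing (\<lambda>t. t ^ j))"
    by (simp only: pairing_sum pairing_cmult)
  also have "\<dots> = 0" using assms by (intro sum.neutral) (simp add: pairing_power_zero)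
  finally show ?thesis .
qed

text \<open>
  As \<open>r\<close> tends to \<open>0\<close>, the Gaussian \<open>exp (- (r * t))\<close> equals, up to invisible lower powers of \<open>t\<close>,
  \<open>(- (r * t)) ^ l / fact l\<close> with an error of order \<open>r ^ (l + 1)\<close>, where \<open>l = L + 1\<close>.
\<close>

lemma pairing_power_Suc_nonneg: "0 \<le> (-1) ^ Suc L * pairing (\<lambda>t. t ^ Suc L)"
proof -
  define l where "l = Suc L"
  define X where "X = (-1) ^ l / fact l * pairing (\<lambda>t. t ^ l)"
  define C where "C = (\<Sum>i<m. \<Sum>j<m. \<bar>c i * c j\<bar> * (sqdist d (x i) (x j) ^ Suc l))"
  have C0: "0 \<le> C" unfolding C_def by (intro sum_nonneg mult_nonneg_nonneg) auto
  have main: "0 \<le> X + r * C" if r: "0 < r" for r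
  proof -
    have "(\<lambda>t. exp (- (r * t))) = (\<lambda>t. (exp (- (r * t)) - omega_fun (Suc l) (r * t))
        + (((-1) ^ l * r ^ l / fact l) * t ^ l + omega_fun l (r * t)))"
      by (simp add: omega_fun_def fun_eq_iff power_mult_distrib mult.assoc)
    then have "pairing (\<lambda>t. exp (- (r * t))) = pairing (\<lambda>t. exp (- (r * t)) - omega_fun (Suc l) (r * t))
        + (((-1) ^ l * r ^ l / fact l) * pairing (\<lambda>t. t ^ l) + pairing (\<lambda>t. omega_fun l (r * t)))"
      by (simp only: pairing_add pairing_cmult)
    also have "pairing (\<lambda>t. omega_fun l (r * t)) = 0" by (rule pairing_omega_fun_zero) (simp add: l_def)
    also have "pairing (\<lambda>t. exp (- (r * t)) - omega_fun (Suc l) (r * t)) \<le> r ^ Suc l * C"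
      unfolding pairing_def C_def sum_distrib_left
    proof (intro sum_mono)
      fix i j
      let ?T = "sqdist d (x i) (x j)"
      have "c i * c j * (exp (- (r * ?T)) - omega_fun (Suc l) (r * ?T))
          \<le> \<bar>c i * c j\<bar> * \<bar>exp (- (r * ?T)) - omega_fun (Suc l) (r * ?T)\<bar>"
        unfolding abs_mult[symmetric] by (rule abs_ge_self)
      also have "\<dots> \<le> \<bar>c i * c j\<bar> * ((r * ?T) ^ Suc l / fact (Suc l))"
        using r by (intro mult_left_mono exp_minus_omega_fun_le) auto
      also have "\<dots> \<le> \<bar>c i * c j\<bar> * ((r * ?T) ^ Suc l / 1)"
        using r by (intro mult_left_mono frac_le) (auto simp: fact_ge_1 simp del: fact_Suc)
      finally show "c i * c j * (exp (- (r * ?T)) - omega_fun (Suc l) (r * ?T))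
          \<le> r ^ Suc l * (\<bar>c i * c j\<bar> * ?T ^ Suc l)"
        by (simp add: power_mult_distrib mult_ac)
    qed
    finally have "pairing (\<lambda>t. exp (- (r * t))) \<le> r ^ l * (X + r * C)"
      by (simp add: X_def algebra_simps)
    with pairing_exp_nonneg[of r] r have "r ^ l * 0 \<le> r ^ l * (X + r * C)" by linarith
    then show ?thesis using r by (simp only: mult_le_cancel_left_pos zero_less_power)
  qed
  have "0 \<le> X"
  proof (rule field_le_epsilon)
    fix e :: real assume "0 < e"
    \<comment> \<open>The choice \<open>r = e / (C + 1)\<close> makes the error at most \<open>e\<close>.\<close>
    then have "0 \<le> X + e / (C + 1) * C" using C0 by (intro main) simp
    also have "e / (C + 1) * C \<le> e" using C0 \<open>0 < e\<close> by (simp add: field_simps)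
    finally show "0 \<le> X + e" by simp
  qed
  then have "0 \<le> fact l * X" by simp
  then show ?thesis by (simp add: X_def l_def del: fact_Suc)
qed

lemma pairing_represents_nonneg:
  assumes rep: "represents (Suc L) \<psi> a \<eta>"
  shows "0 \<le> pairing \<psi>"
proof -
  let ?l = "Suc L"
  have \<eta>: "nonneg_finite_measure_pos \<eta>" and sign: "0 \<le> (-1) ^ ?l * a ?l"
    using rep by (simp_all add: represents_def)
  have T0: "0 \<le> sqdist d (x i) (x j)" for i j by simp
  have "pairing \<psi> = pairing (\<lambda>t. (\<Sum>k\<le>?l. a k * t ^ k) + (LINT r|\<eta>. kernel_rep ?l t r))"
    unfolding pairing_def using rep T0 by (simp add: represents_def del: sum.atMost_Suc)
  also have "\<dots> = (\<Sum>k\<le>?l. a k * pairing (\<lambda>t. t ^ k)) + pairing (\<lambda>t. LINT r|\<eta>. kernel_rep ?l t r)"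
    by (simp only: pairing_add pairing_sum pairing_cmult)
  also have "(\<Sum>k\<le>?l. a k * pairing (\<lambda>t. t ^ k)) = a ?l * pairing (\<lambda>t. t ^ ?l)"
    by (simp add: pairing_power_zero)
  also have "pairing (\<lambda>t. LINT r|\<eta>. kernel_rep ?l t r) = (LINT r|\<eta>. pairing (\<lambda>t. kernel_rep ?l t r))"
  proof -
    have "integrable \<eta> (kernel_rep ?l (sqdist d (x i) (x j)))" for i j
      using rep T0 by (simp add: represents_def)
    then show ?thesis unfolding pairing_def by (simp add: Bochner_Integration.integral_sum)
  qed
  finally have eq: "pairing \<psi> = a ?l * pairing (\<lambda>t. t ^ ?l) + (LINT r|\<eta>. pairing (\<lambda>t. kernel_rep ?l t r))" .
  have "0 \<le> ((-1) ^ ?l * a ?l) * ((-1) ^ ?l * pairing (\<lambda>t. t ^ ?l))"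
    by (intro mult_nonneg_nonneg sign pairing_power_Suc_nonneg)
  also have "\<dots> = ((-1) ^ ?l * (-1) ^ ?l) * (a ?l * pairing (\<lambda>t. t ^ ?l))" by (simp only: mult_ac)
  also have "(-1) ^ ?l * (-1) ^ ?l = (1 :: real)" by (simp flip: power_mult_distrib)
  finally have "0 \<le> a ?l * pairing (\<lambda>t. t ^ ?l)" by simp
  moreover have "0 \<le> (LINT r|\<eta>. pairing (\<lambda>t. kernel_rep ?l t r))"
  proof (rule integral_nonneg_AE, rule AE_I2)
    fix r assume "r \<in> space \<eta>"
    then have r: "0 < r" using space_if_nonneg_finite_measure_pos(1)[OF \<eta>] by simp
    have "(\<lambda>t. kernel_rep ?l t r)
        = (\<lambda>t. ((1 + r) ^ ?l / r ^ ?l) * (exp (- (r * t)) - e_fun ?l r * omega_fun ?l (r * t)))"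
      by (simp only: kernel_rep_def mult.commute)
    then have "pairing (\<lambda>t. kernel_rep ?l t r) = ((1 + r) ^ ?l / r ^ ?l) *
        (pairing (\<lambda>t. exp (- (r * t))) - e_fun ?l r * pairing (\<lambda>t. omega_fun ?l (r * t)))"
      by (simp only: pairing_cmult pairing_diff)
    also have "pairing (\<lambda>t. omega_fun ?l (r * t)) = 0" by (rule pairing_omega_fun_zero) simp
    finally show "0 \<le> pairing (\<lambda>t. kernel_rep ?l t r)"
      using r pairing_exp_nonneg[of r] by simp
  qed
  ultimately show ?thesis using eq by linarith
qed

end

theorem CPD_if_represents:
  assumes "represents l \<psi> a \<eta>" and "l \<ge> 1"
  shows "CPD l d (\<lambda>x y. \<psi> (sqdist d x y))"
  unfolding CPD_def
proof (intro allI impI, elim conjE)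
  fix m x and c :: "nat \<Rightarrow> real"
  assume "\<forall>p. poly_fun d (l - 1) p \<longrightarrow> (\<Sum>i<m. c i * p (x i)) = 0"
  then interpret annihilating_weights d "l - 1" m x c by unfold_locales blast
  show "0 \<le> (\<Sum>i<m. \<Sum>j<m. c i * c j * \<psi> (sqdist d (x i) (x j)))"
    using pairing_represents_nonneg[of \<psi> a \<eta>] assms by (simp add: pairing_def)
qed

section \<open>From conditional positive definiteness to the product spaces\<close>

lemma sum_blocks:
  fixes f :: "nat \<Rightarrow> 'a :: comm_monoid_add"
  shows "(\<Sum>k<n * d. f k) = (\<Sum>i<n. \<Sum>j<d. f (i * d + j))"
proof -
  have "(\<Sum>k\<in>{i * d..<i * d + d}. f k) = (\<Sum>j<d. f (i * d + j))" for i
    using sum.shift_bounds_nat_ivl[of f 0 "i * d" d] by (simp add: lessThan_atLeast0 add.commute)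
  then show ?thesis by (simp add: sum.nat_group[symmetric])
qed

text \<open>
  The identification of the \<open>n\<close>-fold product of a space of dimension \<open>d\<close> with a space of dimension
  \<open>n * d\<close>, under which the squared distances of the blocks add up.
\<close>

definition concat_Rd :: "nat \<Rightarrow> nat \<Rightarrow> (nat \<Rightarrow> nat \<Rightarrow> real) \<Rightarrow> nat \<Rightarrow> real" where
  "concat_Rd n d u k = (if k < n * d then u (k div d) (k mod d) else 0)"

lemma sqdist_concat_Rd:
  "sqdist (n * d) (concat_Rd n d u) (concat_Rd n d v) = (\<Sum>i<n. sqdist d (u i) (v i))"
proof -
  have "concat_Rd n d w (i * d + j) = w i j" if "i < n" "j < d" for w i j
  proof -
    have "i * d + j < Suc i * d" using that by simp
    also have "\<dots> \<le> n * d" using that by (intro mult_right_mono) auto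
    finally show ?thesis using that by (simp add: concat_Rd_def)
  qed
  then show ?thesis unfolding sqdist_sum sum_blocks by simp
qed

text \<open>
  The sum is grouped by the values of \<open>u\<close> on \<open>T\<close>. Each group is the measure of a product set
  that restricts only the factors in \<open>T\<close>, of which there are fewer than \<open>l\<close>.
\<close>

lemma M_space_annihilates_function_of_few_blocks:
  assumes \<mu>: "\<mu> \<in> M_space l n d" and l: "1 \<le> l" "l \<le> n" and T: "T \<subseteq> {..<n}" "card T < l"
    and f: "\<And>u v. (\<And>i. i \<in> T \<Longrightarrow> u i = v i) \<Longrightarrow> f u = f v"
  shows "(\<Sum>u | \<mu> u \<noteq> 0. \<mu> u * f u) = 0"
proof -
  let ?S = "{u. \<mu> u \<noteq> 0}"
  have fin: "finite ?S" and S: "?S \<subseteq> PiE {..<n} (\<lambda>_. Rd d)"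
    and vanish: "\<And>A. (\<And>i. i < n \<Longrightarrow> A i \<subseteq> Rd d) \<Longrightarrow> n + 1 - l \<le> card {i. i < n \<and> A i = Rd d}
      \<Longrightarrow> dmeasure \<mu> (PiE {..<n} A) = 0"
    using \<mu> by (auto simp: M_space_def discrete_measure_on_def)
  have fibre: "(\<Sum>u\<in>{u \<in> ?S. restrict u T = w}. \<mu> u * f u) = 0" if w: "w \<in> (\<lambda>u. restrict u T) ` ?S" for w
  proof -
    obtain v where v: "v \<in> ?S" "w = restrict v T" using w by auto
    \<comment> \<open>The group of \<open>v\<close> is the part of the support of \<open>\<mu>\<close> in the product of the \<open>A i\<close>.\<close>
    define A where "A = (\<lambda>i. if i \<in> T then {v i} else Rd d)"
    have vR: "v i \<in> Rd d" if "i < n" for i using v(1) S that by (auto simp: PiE_iff)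
    have "{..<n} - T \<subseteq> {i. i < n \<and> A i = Rd d}" by (auto simp: A_def)
    then have "card ({..<n} - T) \<le> card {i. i < n \<and> A i = Rd d}" by (rule card_mono[rotated]) simp
    moreover have "card ({..<n} - T) = n - card T"
      using T(1) by (simp add: card_Diff_subset finite_subset)
    ultimately have "n + 1 - l \<le> card {i. i < n \<and> A i = Rd d}" using T(2) l by linarith
    then have "dmeasure \<mu> (PiE {..<n} A) = 0"
      using vR by (intro vanish) (auto simp: A_def)
    moreover have "{u. \<mu> u \<noteq> 0 \<and> u \<in> PiE {..<n} A} = {u \<in> ?S. restrict u T = w}"
    proof (intro set_eqI iffI)
      fix u assume "u \<in> {u. \<mu> u \<noteq> 0 \<and> u \<in> PiE {..<n} A}"
      then have "u \<in> ?S" and uA: "u \<in> PiE {..<n} A" by auto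
      moreover have "u i = v i" if "i \<in> T" for i
        using PiE_mem[OF uA, of i] T(1) that by (auto simp: A_def)
      ultimately show "u \<in> {u \<in> ?S. restrict u T = w}" by (auto simp: v(2) restrict_def fun_eq_iff)
    next
      fix u assume u: "u \<in> {u \<in> ?S. restrict u T = w}"
      then have "u i = v i" if "i \<in> T" for i using that v(2) by (metis (mono_tags, lifting) mem_Collect_eq restrict_apply')
      then show "u \<in> {u. \<mu> u \<noteq> 0 \<and> u \<in> PiE {..<n} A}" using u S by (auto simp: PiE_iff A_def)
    qed
    ultimately have "(\<Sum>u\<in>{u \<in> ?S. restrict u T = w}. \<mu> u) = 0" by (simp add: dmeasure_def)
    moreover have "(\<Sum>u\<in>{u \<in> ?S. restrict u T = w}. \<mu> u * f u) = (\<Sum>u\<in>{u \<in> ?S. restrict u T = w}. \<mu> u) * f v"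
      unfolding sum_distrib_right
    proof (rule sum.cong[OF refl])
      fix u assume "u \<in> {u \<in> ?S. restrict u T = w}"
      then have "u i = v i" if "i \<in> T" for i using that v(2) by (metis (mono_tags, lifting) mem_Collect_eq restrict_apply')
      then show "\<mu> u * f u = \<mu> u * f v" using f[of u v] by simp
    qed
    ultimately show ?thesis by simp
  qed
  have "(\<Sum>u\<in>?S. \<mu> u * f u) = (\<Sum>w\<in>(\<lambda>u. restrict u T) ` ?S. \<Sum>u\<in>{u \<in> ?S. restrict u T = w}. \<mu> u * f u)"
    by (rule sum.group[symmetric]) (use fin in auto)
  also have "\<dots> = 0" by (rule sum.neutral) (use fibre in blast)
  finally show ?thesis .
qed

text \<open>
  A monomial of degree at most \<open>l - 1\<close> contains variables from at most \<open>l - 1\<close> blocks.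
\<close>

lemma M_space_annihilates_polynomials:
  assumes \<mu>: "\<mu> \<in> M_space l n d" and l: "1 \<le> l" "l \<le> n" and d: "1 \<le> d"
    and p: "poly_fun (n * d) (l - 1) p"
  shows "(\<Sum>u | \<mu> u \<noteq> 0. \<mu> u * p (concat_Rd n d u)) = 0"
proof -
  let ?E = "{\<alpha>. \<alpha> \<in> PiE {..<n * d} (\<lambda>_. UNIV) \<and> (\<Sum>k<n * d. \<alpha> k) \<le> l - 1} :: (nat \<Rightarrow> nat) set"
  obtain b where b: "\<And>x. p x = (\<Sum>\<alpha>\<in>?E. b \<alpha> * (\<Prod>k<n * d. x k ^ \<alpha> k))"
    using p unfolding poly_fun_def by blast
  have mono: "(\<Sum>u | \<mu> u \<noteq> 0. \<mu> u * (\<Prod>k<n * d. concat_Rd n d u k ^ \<alpha> k)) = 0" if \<alpha>: "\<alpha> \<in> ?E" for \<alpha>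
  proof (rule M_space_annihilates_function_of_few_blocks[OF \<mu> l])
    define T where "T = {i. i < n \<and> (\<exists>j<d. \<alpha> (i * d + j) \<noteq> 0)}"
    show "T \<subseteq> {..<n}" by (auto simp: T_def)
    have "card T = (\<Sum>i\<in>T. 1)" by simp
    also have "\<dots> \<le> (\<Sum>i\<in>T. \<Sum>j<d. \<alpha> (i * d + j))"
    proof (rule sum_mono)
      fix i assume "i \<in> T"
      then obtain j where "j < d" "\<alpha> (i * d + j) \<noteq> 0" by (auto simp: T_def)
      then show "1 \<le> (\<Sum>j<d. \<alpha> (i * d + j))"
        using member_le_sum[of j "{..<d}" "\<lambda>j. \<alpha> (i * d + j)"] by simp
    qed
    also have "\<dots> \<le> (\<Sum>i<n. \<Sum>j<d. \<alpha> (i * d + j))" by (rule sum_mono2) (auto simp: T_def)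
    also have "\<dots> \<le> l - 1" using \<alpha> by (simp flip: sum_blocks)
    finally show "card T < l" using l by linarith
    fix u v :: "nat \<Rightarrow> nat \<Rightarrow> real" assume uv: "\<And>i. i \<in> T \<Longrightarrow> u i = v i"
    show "(\<Prod>k<n * d. concat_Rd n d u k ^ \<alpha> k) = (\<Prod>k<n * d. concat_Rd n d v k ^ \<alpha> k)"
    proof (rule prod.cong[OF refl])
      fix k assume k: "k \<in> {..<n * d}"
      show "concat_Rd n d u k ^ \<alpha> k = concat_Rd n d v k ^ \<alpha> k"
      proof (cases "\<alpha> k = 0")
        case False
        have "k div d < n" using k by (simp add: less_mult_imp_div_less)
        moreover have "k mod d < d" using d by simp
        moreover have "\<alpha> (k div d * d + k mod d) \<noteq> 0" using False by simp
        ultimately have "k div d \<in> T" unfolding T_def by blast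
        then show ?thesis using uv by (simp add: concat_Rd_def)
      qed simp
    qed
  qed
  have "(\<Sum>u | \<mu> u \<noteq> 0. \<mu> u * p (concat_Rd n d u))
      = (\<Sum>u | \<mu> u \<noteq> 0. \<Sum>\<alpha>\<in>?E. b \<alpha> * (\<mu> u * (\<Prod>k<n * d. concat_Rd n d u k ^ \<alpha> k)))"
    unfolding b sum_distrib_left by (intro sum.cong refl) (simp only: mult.left_commute)
  also have "\<dots> = (\<Sum>\<alpha>\<in>?E. b \<alpha> * (\<Sum>u | \<mu> u \<noteq> 0. \<mu> u * (\<Prod>k<n * d. concat_Rd n d u k ^ \<alpha> k)))"
    by (subst sum.swap) (simp only: sum_distrib_left)
  also have "\<dots> = 0" by (rule sum.neutral) (use mono in simp)
  finally show ?thesis .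
qed

lemma dintegral_twice:
  "dintegral \<mu> (\<lambda>v. dintegral \<mu> (\<lambda>u. (-1) ^ l * ((-1) ^ l * \<psi> (\<Sum>i<n. (\<lambda>i\<in>{..<n}. sqdist d (u i) (v i)) i))))
    = (\<Sum>u | \<mu> u \<noteq> 0. \<Sum>v | \<mu> v \<noteq> 0. \<mu> u * \<mu> v * \<psi> (\<Sum>i<n. sqdist d (u i) (v i)))"
proof -
  have sign: "(-1) ^ l * ((-1) ^ l * y) = y" for y :: real
    by (simp flip: mult.assoc power_mult_distrib)
  show ?thesis
    unfolding dintegral_def sign sum_distrib_right
    by (subst sum.swap) (simp add: mult_ac)
qed

text \<open>
  The points of the support of \<open>\<mu>\<close>, read as vectors of dimension \<open>n * d\<close>, and their masses form an
  admissible system for conditional positive definiteness in that dimension.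
\<close>

theorem PDI_if_CPD:
  assumes CPD: "\<And>d. 1 \<le> d \<Longrightarrow> CPD l d (\<lambda>x y. \<psi> (sqdist d x y))" and l: "1 \<le> l" "l \<le> n"
  shows "PDI l n (\<lambda>t. (-1) ^ l * \<psi> (\<Sum>i<n. t i))"
  unfolding PDI_def dintegral_twice
proof (intro allI impI ballI)
  fix d :: nat and \<mu> assume d: "1 \<le> d" and \<mu>: "\<mu> \<in> M_space l n d"
  let ?S = "{u. \<mu> u \<noteq> 0}"
  have "finite ?S" using \<mu> by (simp add: M_space_def discrete_measure_on_def)
  then obtain e where e: "bij_betw e {..<card ?S} ?S"
    using ex_bij_betw_nat_finite[of ?S] by (auto simp: lessThan_atLeast0)
  define c where "c = (\<lambda>i. \<mu> (e i))"
  define x where "x = (\<lambda>i. concat_Rd n d (e i))"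
  have "CPD l (n * d) (\<lambda>x y. \<psi> (sqdist (n * d) x y))" using d l by (intro CPD) simp
  moreover have "x i \<in> Rd (n * d)" for i
    by (simp add: x_def concat_Rd_def topspace_Euclidean_space)
  moreover have "(\<Sum>i<card ?S. c i * p (x i)) = 0" if "poly_fun (n * d) (l - 1) p" for p
    using M_space_annihilates_polynomials[OF \<mu> l d that]
      sum.reindex_bij_betw[OF e, of "\<lambda>u. \<mu> u * p (concat_Rd n d u)"]
    by (simp add: c_def x_def)
  ultimately have "0 \<le> (\<Sum>i<card ?S. \<Sum>j<card ?S. c i * c j * \<psi> (sqdist (n * d) (x i) (x j)))"
    unfolding CPD_def by blast
  also have "\<dots> = (\<Sum>u\<in>?S. \<Sum>v\<in>?S. \<mu> u * \<mu> v * \<psi> (\<Sum>i<n. sqdist d (u i) (v i)))"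
    unfolding x_def c_def sqdist_concat_Rd
    by (simp add: sum.reindex_bij_betw[OF e, of "\<lambda>v. \<mu> (e _) * \<mu> v * \<psi> (\<Sum>i<n. sqdist d (e _ i) (v i))"]
        sum.reindex_bij_betw[OF e, of "\<lambda>u. \<Sum>v\<in>?S. \<mu> u * \<mu> v * \<psi> (\<Sum>i<n. sqdist d (u i) (v i))"])
  finally show "0 \<le> (\<Sum>u\<in>?S. \<Sum>v\<in>?S. \<mu> u * \<mu> v * \<psi> (\<Sum>i<n. sqdist d (u i) (v i)))" .
qed

section \<open>From the product spaces to alternating differences\<close>

text \<open>
  This is \<open>(-1) ^ card \<epsilon>\<close> for \<open>\<epsilon> \<subseteq> {..<m}\<close>, written as a product over coordinates so that it is
  visibly multiplicative for symmetric differences.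
\<close>

definition subset_sign :: "nat \<Rightarrow> nat set \<Rightarrow> real" where
  "subset_sign m \<epsilon> = (\<Prod>c<m. if c \<in> \<epsilon> then - 1 else 1)"

lemma adiff_subset_sum:
  "adiff m h f t = (\<Sum>\<epsilon>\<in>Pow {..<m}. subset_sign m \<epsilon> * f (t + (\<Sum>c\<in>\<epsilon>. h c)))"
proof (induction m arbitrary: t)
  case 0
  show ?case by (simp add: subset_sign_def)
next
  case (Suc m)
  have fin: "finite \<epsilon>" if "\<epsilon> \<in> Pow {..<m}" for \<epsilon> using that finite_subset by auto
  have notin: "m \<notin> \<epsilon>" if "\<epsilon> \<in> Pow {..<m}" for \<epsilon> using that by auto
  have sign: "subset_sign (Suc m) \<epsilon> = subset_sign m \<epsilon>" "subset_sign (Suc m) (insert m \<epsilon>) = - subset_sign m \<epsilon>"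
    if "\<epsilon> \<in> Pow {..<m}" for \<epsilon>
  proof -
    have "(\<Prod>c<m. if c \<in> insert m \<epsilon> then - 1 else 1) = (\<Prod>c<m. if c \<in> \<epsilon> then - 1 else (1 :: real))"
      by (rule prod.cong) auto
    then show "subset_sign (Suc m) \<epsilon> = subset_sign m \<epsilon>" "subset_sign (Suc m) (insert m \<epsilon>) = - subset_sign m \<epsilon>"
      using notin[OF that] by (simp_all add: subset_sign_def)
  qed
  have "(\<Sum>\<epsilon>\<in>Pow {..<Suc m}. subset_sign (Suc m) \<epsilon> * f (t + (\<Sum>c\<in>\<epsilon>. h c)))
      = (\<Sum>\<epsilon>\<in>Pow {..<m}. subset_sign (Suc m) \<epsilon> * f (t + (\<Sum>c\<in>\<epsilon>. h c)))
      + (\<Sum>\<epsilon>\<in>insert m ` Pow {..<m}. subset_sign (Suc m) \<epsilon> * f (t + (\<Sum>c\<in>\<epsilon>. h c)))"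
    unfolding lessThan_Suc Pow_insert by (rule sum.union_disjoint) auto
  also have "(\<Sum>\<epsilon>\<in>insert m ` Pow {..<m}. subset_sign (Suc m) \<epsilon> * f (t + (\<Sum>c\<in>\<epsilon>. h c)))
      = (\<Sum>\<epsilon>\<in>Pow {..<m}. subset_sign (Suc m) (insert m \<epsilon>) * f (t + (\<Sum>c\<in>insert m \<epsilon>. h c)))"
    by (subst sum.reindex) (auto intro!: inj_onI simp: insert_ident notin)
  also have "\<dots> = - (\<Sum>\<epsilon>\<in>Pow {..<m}. subset_sign m \<epsilon> * f ((t + h m) + (\<Sum>c\<in>\<epsilon>. h c)))"
    unfolding sum_negf[symmetric] by (intro sum.cong refl) (simp add: sign fin notin add.assoc del: Pow_iff)
  also have "(\<Sum>\<epsilon>\<in>Pow {..<m}. subset_sign (Suc m) \<epsilon> * f (t + (\<Sum>c\<in>\<epsilon>. h c))) = adiff m h f t"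
    unfolding Suc.IH by (intro sum.cong refl) (simp add: sign del: Pow_iff)
  finally show ?case unfolding adiff.simps Suc.IH by simp
qed

lemma subset_sign_sym_diff:
  "subset_sign m (sym_diff \<delta> \<epsilon>) = subset_sign m \<delta> * subset_sign m \<epsilon>"
  unfolding subset_sign_def prod.distrib[symmetric] by (rule prod.cong) auto

text \<open>
  For fixed \<open>\<delta>\<close> the substitution \<open>\<epsilon> \<mapsto> sym_diff \<delta> \<epsilon>\<close> makes the inner sum independent of \<open>\<delta>\<close>.
\<close>

lemma sum_sign_sym_diff:
  "(\<Sum>\<delta>\<in>Pow {..<m}. \<Sum>\<epsilon>\<in>Pow {..<m}. subset_sign m \<delta> * subset_sign m \<epsilon> * f (sym_diff \<delta> \<epsilon>))
    = 2 ^ m * (\<Sum>\<epsilon>\<in>Pow {..<m}. subset_sign m \<epsilon> * f \<epsilon>)"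
proof -
  have "(\<Sum>\<epsilon>\<in>Pow {..<m}. subset_sign m \<delta> * subset_sign m \<epsilon> * f (sym_diff \<delta> \<epsilon>))
      = (\<Sum>\<epsilon>\<in>Pow {..<m}. subset_sign m \<epsilon> * f \<epsilon>)" if "\<delta> \<in> Pow {..<m}" for \<delta>
  proof (rule sum.reindex_bij_witness[of _ "sym_diff \<delta>" "sym_diff \<delta>"])
    show "subset_sign m (sym_diff \<delta> \<epsilon>) * f (sym_diff \<delta> \<epsilon>) = subset_sign m \<delta> * subset_sign m \<epsilon> * f (sym_diff \<delta> \<epsilon>)" for \<epsilon>
      by (simp only: subset_sign_sym_diff)
  qed (use that in auto)
  then show ?thesis by (simp add: card_Pow)
qed

text \<open>
  The weight function of \<open>\<Sum>k\<in>K. w k \<delta>\<^bsub>pt k\<^esub>\<close>. The points \<open>pt k\<close> may coincide.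
\<close>

definition point_masses :: "'k set \<Rightarrow> ('k \<Rightarrow> real) \<Rightarrow> ('k \<Rightarrow> 'a) \<Rightarrow> 'a \<Rightarrow> real" where
  "point_masses K w pt u = (\<Sum>k | k \<in> K \<and> pt k = u. w k)"

lemma support_point_masses: "{u. point_masses K w pt u \<noteq> 0} \<subseteq> pt ` K"
proof
  fix u assume "u \<in> {u. point_masses K w pt u \<noteq> 0}"
  then have "{k. k \<in> K \<and> pt k = u} \<noteq> {}" unfolding point_masses_def by force
  then show "u \<in> pt ` K" by auto
qed

lemma dintegral_point_masses:
  assumes "finite K"
  shows "dintegral (point_masses K w pt) f = (\<Sum>k\<in>K. w k * f (pt k))"
proof -
  have "dintegral (point_masses K w pt) f = (\<Sum>u\<in>pt ` K. f u * point_masses K w pt u)"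
    unfolding dintegral_def
    by (rule sum.mono_neutral_left) (use assms support_point_masses[of K w pt] in auto)
  also have "\<dots> = (\<Sum>u\<in>pt ` K. \<Sum>k | k \<in> K \<and> pt k = u. w k * f (pt k))"
    unfolding point_masses_def sum_distrib_left by (intro sum.cong refl) auto
  also have "\<dots> = (\<Sum>k\<in>K. w k * f (pt k))"
    by (rule sum.group) (use assms in auto)
  finally show ?thesis .
qed

lemma dmeasure_point_masses:
  assumes "finite K"
  shows "dmeasure (point_masses K w pt) A = (\<Sum>k\<in>K. if pt k \<in> A then w k else 0)"
proof -
  have "finite {u. point_masses K w pt u \<noteq> 0}"
    by (rule finite_subset[OF support_point_masses]) (use assms in simp)
  then have "dmeasure (point_masses K w pt) A = dintegral (point_masses K w pt) (\<lambda>u. if u \<in> A then 1 else 0)"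
    unfolding dmeasure_def dintegral_def
    by (subst Collect_conj_eq, subst sum.inter_restrict) (auto intro!: sum.cong)
  then show ?thesis
    unfolding dintegral_point_masses[OF assms] by (auto intro!: sum.cong)
qed

lemma sum_lessThan_add:
  fixes f :: "nat \<Rightarrow> 'a :: comm_monoid_add"
  shows "(\<Sum>c<m + N. f c) = (\<Sum>c<m. f c) + (\<Sum>q<N. f (m + q))"
  by (induction N) (simp_all add: add.assoc)

text \<open>
  The block that carries the edge \<open>c\<close> of the cube; the first \<open>l\<close> edges get different blocks, as
  membership in \<open>M_space l\<close> demands.
\<close>

definition block :: "nat \<Rightarrow> nat \<Rightarrow> nat" where
  "block l c = (if c < l then c else 0)"

text \<open>
  The vertex \<open>\<epsilon>\<close> of the \<open>p\<close>-th copy of the cube. The copies are displaced by \<open>sqrt (t / 2)\<close> along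
  different axes \<open>m + p\<close>, so that the same vertex in two different copies has squared distance \<open>t\<close>.
\<close>

definition cube_point :: "nat \<Rightarrow> nat \<Rightarrow> nat \<Rightarrow> (nat \<Rightarrow> real) \<Rightarrow> real \<Rightarrow> nat set \<times> nat \<Rightarrow> nat \<Rightarrow> nat \<Rightarrow> real" where
  "cube_point l n m h t = (\<lambda>(\<epsilon>, p). \<lambda>i\<in>{..<n}. \<lambda>c.
     if c < m then (if c \<in> \<epsilon> \<and> block l c = i then sqrt (h c) else 0)
     else if i = 0 \<and> c = m + p then sqrt (t / 2) else 0)"

lemma sqdist_cube_points:
  assumes l: "1 \<le> l" "l \<le> n" and h: "\<And>c. 0 < h c" and t: "0 \<le> t" and p: "p < N" "q < N"
    and \<delta>: "\<delta> \<subseteq> {..<m}" and \<epsilon>: "\<epsilon> \<subseteq> {..<m}"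
  shows "(\<Sum>i<n. sqdist (m + N) (cube_point l n m h t (\<delta>, p) i) (cube_point l n m h t (\<epsilon>, q) i))
    = (if p = q then 0 else t) + (\<Sum>c\<in>sym_diff \<delta> \<epsilon>. h c)"
proof -
  let ?u = "cube_point l n m h t (\<delta>, p)" and ?v = "cube_point l n m h t (\<epsilon>, q)"
  have "(\<Sum>i<n. sqdist (m + N) (?u i) (?v i)) = (\<Sum>c<m + N. \<Sum>i<n. (?u i c - ?v i c)\<^sup>2)"
    unfolding sqdist_sum by (rule sum.swap)
  also have "\<dots> = (\<Sum>c<m. \<Sum>i<n. (?u i c - ?v i c)\<^sup>2) + (\<Sum>s<N. \<Sum>i<n. (?u i (m + s) - ?v i (m + s))\<^sup>2)"
    by (rule sum_lessThan_add)
  also have "(\<Sum>c<m. \<Sum>i<n. (?u i c - ?v i c)\<^sup>2) = (\<Sum>c<m. if c \<in> sym_diff \<delta> \<epsilon> then h c else 0)"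
  proof (rule sum.cong[OF refl])
    fix c assume "c \<in> {..<m}"
    then have "(\<Sum>i<n. (?u i c - ?v i c)\<^sup>2) = (\<Sum>i<n. if i = block l c then (if c \<in> sym_diff \<delta> \<epsilon> then h c else 0) else 0)"
      using h[of c] by (intro sum.cong) (auto simp: cube_point_def)
    also have "\<dots> = (if c \<in> sym_diff \<delta> \<epsilon> then h c else 0)"
      using l by (subst sum.delta) (auto simp: block_def)
    finally show "(\<Sum>i<n. (?u i c - ?v i c)\<^sup>2) = (if c \<in> sym_diff \<delta> \<epsilon> then h c else 0)" .
  qed
  also have "\<dots> = (\<Sum>c\<in>sym_diff \<delta> \<epsilon>. h c)"
    by (subst sum.inter_restrict[symmetric]) (use \<delta> \<epsilon> in \<open>auto intro!: sum.cong\<close>)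
  also have "(\<Sum>s<N. \<Sum>i<n. (?u i (m + s) - ?v i (m + s))\<^sup>2) = (\<Sum>s<N. (if p \<noteq> q \<and> s = p then t / 2 else 0) + (if p \<noteq> q \<and> s = q then t / 2 else 0))"
  proof (rule sum.cong[OF refl])
    fix s
    have "(\<Sum>i<n. (?u i (m + s) - ?v i (m + s))\<^sup>2)
        = (\<Sum>i<n. if i = 0 then (if p \<noteq> q \<and> s = p then t / 2 else 0) + (if p \<noteq> q \<and> s = q then t / 2 else 0) else 0)"
      using t by (intro sum.cong) (auto simp: cube_point_def)
    also have "\<dots> = (if p \<noteq> q \<and> s = p then t / 2 else 0) + (if p \<noteq> q \<and> s = q then t / 2 else 0)"
      using l by (subst sum.delta) auto
    finally show "(\<Sum>i<n. (?u i (m + s) - ?v i (m + s))\<^sup>2)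
        = (if p \<noteq> q \<and> s = p then t / 2 else 0) + (if p \<noteq> q \<and> s = q then t / 2 else 0)" .
  qed
  also have "\<dots> = (if p = q then 0 else t)"
    using p by (simp add: sum.distrib)
  finally show ?thesis by simp
qed

text \<open>
  If fewer than \<open>l\<close> factors of a product set are restricted, then one of the blocks
  \<open>0, ..., l - 1\<close>, say \<open>i\<close>, is not. Moving a vertex along the edge \<open>i\<close> does not affect membership in
  the product set but changes the sign, so all contributions cancel in pairs.
\<close>

lemma cube_measure_in_M_space:
  assumes l: "1 \<le> l" "l \<le> n" "l \<le> m"
  shows "point_masses (Pow {..<m} \<times> {..<N}) (\<lambda>(\<epsilon>, p). subset_sign m \<epsilon>) (cube_point l n m h t)
    \<in> M_space l n (m + N)"
proof -
  let ?K = "Pow {..<m} \<times> {..<N}"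
  let ?w = "\<lambda>(\<epsilon>, p :: nat). subset_sign m \<epsilon>"
  let ?\<mu> = "point_masses ?K ?w (cube_point l n m h t)"
  have fin: "finite ?K" by simp
  have "cube_point l n m h t k \<in> PiE {..<n} (\<lambda>_. Rd (m + N))" if kK: "k \<in> ?K" for k
  proof (rule PiE_I)
    obtain \<epsilon> p where k: "k = (\<epsilon>, p)" "p < N" using kK by auto
    show "cube_point l n m h t k i \<in> Rd (m + N)" if "i \<in> {..<n}" for i
      using that k(2) by (simp add: k(1) cube_point_def topspace_Euclidean_space)
    show "cube_point l n m h t k i = undefined" if "i \<notin> {..<n}" for i
      using that by (simp add: k(1) cube_point_def)
  qed
  then have "{u. ?\<mu> u \<noteq> 0} \<subseteq> PiE {..<n} (\<lambda>_. Rd (m + N))"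
    using support_point_masses[of ?K ?w "cube_point l n m h t"] by blast
  moreover have "finite {u. ?\<mu> u \<noteq> 0}"
    by (rule finite_subset[OF support_point_masses]) simp
  moreover have "dmeasure ?\<mu> (PiE {..<n} A) = 0"
    if A: "card {i. i < n \<and> A i = Rd (m + N)} \<ge> n + 1 - l" for A
  proof -
    have "\<exists>i<l. A i = Rd (m + N)"
    proof (rule ccontr)
      assume "\<not> ?thesis"
      then have "{i. i < n \<and> A i = Rd (m + N)} \<subseteq> {l..<n}" by (auto simp: not_less[symmetric])
      then have "card {i. i < n \<and> A i = Rd (m + N)} \<le> n - l"
        using card_mono[of "{l..<n}"] by fastforce
      then show False using A l by linarith
    qed
    then obtain i where i: "i < l" "A i = Rd (m + N)" by blast
    \<comment> \<open>\<open>\<tau>\<close> moves a vertex along the edge \<open>i\<close>.\<close>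
    define \<tau> where "\<tau> = (\<lambda>(\<epsilon>, p :: nat). (sym_diff {i} \<epsilon>, p))"
    define G where "G = (\<lambda>k. if cube_point l n m h t k \<in> PiE {..<n} A then ?w k else 0)"
    have mem: "cube_point l n m h t (\<tau> k) \<in> PiE {..<n} A \<longleftrightarrow> cube_point l n m h t k \<in> PiE {..<n} A" if kK: "k \<in> ?K" for k
    proof -
      obtain \<epsilon> p where k: "k = (\<epsilon>, p)" "p < N" using kK by auto
      have "cube_point l n m h t (\<tau> k) j \<in> A j \<longleftrightarrow> cube_point l n m h t k j \<in> A j" if "j < n" for j
      proof (cases "j = i")
        case True
        then show ?thesis using k(2) that i(2) by (simp add: k(1) cube_point_def \<tau>_def topspace_Euclidean_space)
      next
        case False
        then have "cube_point l n m h t (\<tau> k) j = cube_point l n m h t k j"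
          using k that i by (auto simp: cube_point_def \<tau>_def block_def fun_eq_iff)
        then show ?thesis by simp
      qed
      moreover have "cube_point l n m h t k' \<in> extensional {..<n}" for k'
        by (cases k') (simp add: cube_point_def)
      ultimately show ?thesis by (simp add: PiE_iff)
    qed
    have wi: "subset_sign m {i} = - 1"
    proof -
      have "subset_sign m {i} = (\<Prod>c\<in>{i}. - 1)"
        unfolding subset_sign_def using i l by (intro prod.mono_neutral_cong_right) auto
      then show ?thesis by simp
    qed
    have "sum G ?K = (\<Sum>k\<in>?K. - G k)"
    proof (rule sum.reindex_bij_witness[of _ \<tau> \<tau>])
      fix k assume k: "k \<in> ?K"
      show "\<tau> (\<tau> k) = k" by (auto simp: \<tau>_def split: prod.split)
      show "\<tau> k \<in> ?K" using k i l by (auto simp: \<tau>_def)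
      have "?w (\<tau> k) = - ?w k" by (auto simp: \<tau>_def subset_sign_sym_diff wi split: prod.split)
      then show "- G (\<tau> k) = G k" using mem[OF k] by (simp add: G_def)
    qed (use i l in \<open>auto simp: \<tau>_def\<close>)
    then have "sum G ?K = 0" by (simp add: sum_negf)
    then show ?thesis by (simp add: dmeasure_point_masses[OF fin] G_def)
  qed
  ultimately show ?thesis by (simp add: M_space_def discrete_measure_on_def)
qed

text \<open>
  The implication from (i) to the difference property. With \<open>N + 1\<close> copies of the cube, pairs of
  vertices of the same copy contribute a difference at \<open>0\<close>, and the far more numerous pairs from
  different copies contribute a difference at \<open>t\<close>.
\<close>

theorem alternating_if_PDI:
  assumes PDI: "PDI l n (\<lambda>t. (-1) ^ l * \<psi> (\<Sum>i<n. t i))" and l: "1 \<le> l" "l \<le> n"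
  shows "alternating_from l \<psi>"
  unfolding alternating_from_def
proof (intro allI impI)
  fix m :: nat and h :: "nat \<Rightarrow> real" and t :: real
  assume m: "l \<le> m" and h: "\<forall>j. 0 < h j" and t: "0 \<le> t"
  have main: "0 \<le> adiff m h \<psi> 0 + real N * adiff m h \<psi> t" for N
  proof -
    let ?N = "Suc N"
    let ?K = "Pow {..<m} \<times> {..<?N}"
    let ?w = "\<lambda>(\<epsilon>, p :: nat). subset_sign m \<epsilon>"
    let ?pt = "cube_point l n m h t"
    let ?\<mu> = "point_masses ?K ?w ?pt"
    define H where "H = (\<lambda>\<epsilon>. \<Sum>c\<in>\<epsilon>. h c)"
    have fin: "finite ?K" by simp
    have sign: "(-1) ^ l * ((-1) ^ l * y) = y" for y :: real
      by (simp flip: mult.assoc power_mult_distrib)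
    have "0 \<le> dintegral ?\<mu> (\<lambda>v. dintegral ?\<mu> (\<lambda>u. (-1) ^ l *
        ((-1) ^ l * \<psi> (\<Sum>i<n. (\<lambda>i\<in>{..<n}. sqdist (m + ?N) (u i) (v i)) i))))"
      using PDI cube_measure_in_M_space[OF l m, of ?N h t] unfolding PDI_def by simp
    also have "\<dots> = (\<Sum>k\<in>?K. \<Sum>k'\<in>?K. ?w k * ?w k' * \<psi> (\<Sum>i<n. sqdist (m + ?N) (?pt k' i) (?pt k i)))"
      unfolding sign dintegral_point_masses[OF fin] by (simp add: sum_distrib_left mult_ac)
    also have "\<dots> = (\<Sum>k\<in>?K. \<Sum>k'\<in>?K. ?w k * ?w k' * \<psi> ((if snd k' = snd k then 0 else t) + H (sym_diff (fst k') (fst k))))"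
    proof (intro sum.cong refl)
      fix k k' assume "k \<in> ?K" "k' \<in> ?K"
      then obtain \<epsilon> p \<delta> q where k: "k = (\<epsilon>, p)" "k' = (\<delta>, q)" "\<epsilon> \<subseteq> {..<m}" "\<delta> \<subseteq> {..<m}" "p < ?N" "q < ?N"
        by (cases k, cases k') auto
      then show "?w k * ?w k' * \<psi> (\<Sum>i<n. sqdist (m + ?N) (?pt k' i) (?pt k i))
          = ?w k * ?w k' * \<psi> ((if snd k' = snd k then 0 else t) + H (sym_diff (fst k') (fst k)))"
        using sqdist_cube_points[OF l h[rule_format] t k(6,5,4,3)] by (simp only: H_def fst_conv snd_conv)
    qed
    also have "\<dots> = (\<Sum>\<epsilon>\<in>Pow {..<m}. \<Sum>p<?N. \<Sum>\<delta>\<in>Pow {..<m}. \<Sum>q<?N.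
        subset_sign m \<epsilon> * subset_sign m \<delta> * \<psi> ((if q = p then 0 else t) + H (sym_diff \<delta> \<epsilon>)))"
      by (simp only: sum.cartesian_product' fst_conv snd_conv prod.case)
    also have "\<dots> = (\<Sum>p<?N. \<Sum>q<?N. \<Sum>\<epsilon>\<in>Pow {..<m}. \<Sum>\<delta>\<in>Pow {..<m}.
        subset_sign m \<epsilon> * subset_sign m \<delta> * \<psi> ((if q = p then 0 else t) + H (sym_diff \<delta> \<epsilon>)))"
      by (subst sum.swap, intro sum.cong refl, subst (2) sum.swap, subst sum.swap) (rule refl)
    also have "\<dots> = (\<Sum>p<?N. \<Sum>q<?N. 2 ^ m * adiff m h \<psi> (if q = p then 0 else t))"
    proof (intro sum.cong refl)
      fix p q
      have "sym_diff \<delta> \<epsilon> = sym_diff \<epsilon> \<delta>" for \<delta> \<epsilon> :: "nat set" by blast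
      then show "(\<Sum>\<epsilon>\<in>Pow {..<m}. \<Sum>\<delta>\<in>Pow {..<m}.
          subset_sign m \<epsilon> * subset_sign m \<delta> * \<psi> ((if q = p then 0 else t) + H (sym_diff \<delta> \<epsilon>)))
          = 2 ^ m * adiff m h \<psi> (if q = p then 0 else t)"
        unfolding adiff_subset_sum H_def[symmetric]
        using sum_sign_sym_diff[of m "\<lambda>\<epsilon>. \<psi> ((if q = p then 0 else t) + H \<epsilon>)"] by simp
    qed
    also have "\<dots> = (\<Sum>p<?N. 2 ^ m * (adiff m h \<psi> 0 + real N * adiff m h \<psi> t))"
    proof (rule sum.cong[OF refl])
      fix p assume p: "p \<in> {..<?N}"
      have "(\<Sum>q<?N. 2 ^ m * adiff m h \<psi> (if q = p then 0 else t))
          = 2 ^ m * adiff m h \<psi> 0 + (\<Sum>q\<in>{..<?N} - {p}. 2 ^ m * adiff m h \<psi> (if q = p then 0 else t))"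
        using p by (subst sum.remove[of _ p]) auto
      also have "(\<Sum>q\<in>{..<?N} - {p}. 2 ^ m * adiff m h \<psi> (if q = p then 0 else t))
          = (\<Sum>q\<in>{..<?N} - {p}. 2 ^ m * adiff m h \<psi> t)"
        by (intro sum.cong) auto
      also have "\<dots> = real N * (2 ^ m * adiff m h \<psi> t)"
        using p by (simp only: sum_constant card_Diff_singleton card_lessThan) simp
      finally show "(\<Sum>q<?N. 2 ^ m * adiff m h \<psi> (if q = p then 0 else t))
          = 2 ^ m * (adiff m h \<psi> 0 + real N * adiff m h \<psi> t)" by (simp add: algebra_simps)
    qed
    also have "\<dots> = (real ?N * 2 ^ m) * (adiff m h \<psi> 0 + real N * adiff m h \<psi> t)"
      by (simp only: sum_constant card_lessThan mult.assoc)
    finally have "(real ?N * 2 ^ m) * 0 \<le> (real ?N * 2 ^ m) * (adiff m h \<psi> 0 + real N * adiff m h \<psi> t)"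
      by (simp only: mult_zero_right)
    moreover have "0 < real ?N * (2 :: real) ^ m" by simp
    ultimately show ?thesis by (simp only: mult_le_cancel_left_pos)
  qed
  show "0 \<le> adiff m h \<psi> t"
  proof (rule ccontr)
    assume "\<not> ?thesis"
    then have neg: "0 < - adiff m h \<psi> t" by simp
    obtain N where "adiff m h \<psi> 0 < real N * (- adiff m h \<psi> t)"
      using reals_Archimedean3[OF neg] by blast
    then show False using main[of N] by simp
  qed
qed

section \<open>The equivalence\<close>

theorem theorem7p3:
  fixes \<psi> :: "real \<Rightarrow> real" and l n :: nat
  assumes "continuous_on {0..} \<psi>" and "l \<ge> 1" and "n \<ge> l"
  shows "(PDI l n (\<lambda>t. (-1) ^ l * \<psi> (\<Sum>i<n. t i)) \<longleftrightarrow>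
            (\<forall>d\<ge>1. CPD l d (\<lambda>x y. \<psi> (sqdist d x y)))) \<and>
         ((\<forall>d\<ge>1. CPD l d (\<lambda>x y. \<psi> (sqdist d x y))) \<longleftrightarrow> (\<exists>a \<eta>. represents l \<psi> a \<eta>)) \<and>
         ((\<exists>a \<eta>. represents l \<psi> a \<eta>) \<longleftrightarrow> completely_monotone_order l \<psi>) \<and>
         (\<forall>a \<eta> a' \<eta>'. represents l \<psi> a \<eta> \<and> represents l \<psi> a' \<eta>' \<longrightarrow>
            (\<forall>k\<le>l. a k = a' k) \<and> \<eta> = \<eta>')"
proof -
  let ?i = "PDI l n (\<lambda>t. (-1) ^ l * \<psi> (\<Sum>i<n. t i))"
  let ?ii = "\<forall>d\<ge>1. CPD l d (\<lambda>x y. \<psi> (sqdist d x y))"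
  let ?iii = "\<exists>a \<eta>. represents l \<psi> a \<eta>"
  let ?iv = "completely_monotone_order l \<psi>"
  have "?i \<Longrightarrow> alternating_from l \<psi>"
    using alternating_if_PDI[OF _ assms(2,3)] .
  moreover have "alternating_from l \<psi> \<Longrightarrow> ?iii"
    using represents_if_alternating[OF assms(1)] by blast
  moreover have "?iii \<Longrightarrow> ?ii"
    using CPD_if_represents[OF _ assms(2)] by blast
  moreover have "?ii \<Longrightarrow> ?i"
    using PDI_if_CPD[OF _ assms(2,3)] by blast
  moreover have "?iii \<Longrightarrow> ?iv"
    using completely_monotone_order_if_represents by blast
  moreover have "?iv \<Longrightarrow> alternating_from l \<psi>"
    by (rule alternating_if_completely_monotone_order[OF assms(1)])
  moreover have "\<forall>a \<eta> a' \<eta>'. represents l \<psi> a \<eta> \<and> represents l \<psi> a' \<eta>' \<longrightarrow>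
      (\<forall>k\<le>l. a k = a' k) \<and> \<eta> = \<eta>'"
    using represents_unique by blast
  ultimately show ?thesis by blast
qed

end
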